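(* Let $\mu,\nu$ be probability measures on $\mathbb{R}$ with $\mu\ll\nu$, and let $w=d\mu/d\nu$. Let $X_1,X_2,\dots$ be i.i.d. with law $\nu$, and $\nu_n^w=\frac1n\sum_{i=1}^n w(X_i)\delta_{X_i}$. Let $F$ be the distribution function of $\mu$, $T=1-F$, and $T_n^w(t)=\nu_n^w(I\{\cdot>t\})$, $t\in\mathbb{R}$. Let $\{\lambda_n\}$ be an increasing sequence of positive reals with $\lambda_n\to\infty$, $\lambda_n=o(\sqrt n)$, such that for some constants $A\ge1$, $\delta\in(0,1)$, $\lambda_{nk}\le A\,k^{-(\delta-1/2)}\lambda_n$ for all integers $n,k\ge1$; put $b_n=\sqrt n/\lambda_n$. Let $0<q<p<1$ and suppose that, for some $\epsilon>0$, $F$ has a continuous density $f>0$ with respect to Lebesgue measure on the interval $[T^{-1}(p)-\epsilon,\,T^{-1}(q)+\epsilon]$. Suppose $\mathbb{E}_\nu[\exp\{\alpha w(X)\}]<\infty$ for every $\alpha>0$. Then the sequence $$\big\{ b_n\big((T_n^w)^{-1}-T^{-1}\big)\big\}$$ satisfies the large deviation principle in $\ell_\infty[q,p]$ with speed $\lambda_n^{-2}$ and rate function $$I^w_{T^{-1}}(G)=\inf\Big\{ I_\nu(\eta):\eta\in\mathcal{M}_b^{\nu,0},\ \frac{\eta\big(I\{\cdot>T^{-1}(u)\}\,w\big)}{f(T^{-1}(u))}=G(u)\ \text{for all } u\in[q,p]\Big\},\quad G\in\ell_\infty[q,p].$$ Moreover, the sequence converges in probability to the zero element of $\ell_\inf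ty[q,p]$.
   Context: Notation: $I\{\cdot\}$ is the indicator function; $\mathbb{E}_\nu$ denotes expectation when $X$ has law $\nu$; $\eta(g)=\int g\,d\eta$. For a non-increasing càdlàg $H:\mathbb{R}\to\mathbb{R}$ and $u\in(0,1)$, $H^{-1}(u)=\inf\{t: H(t)\le u\}$; this defines $T^{-1}$ and $(T_n^w)^{-1}$. $\ell_\infty[q,p]$ is the space of bounded real functions on $[q,p]$ with the sup-norm. $\mathcal{M}_b$ is the space of signed measures of finite variation on $\mathbb{R}$; $\mathcal{M}_b^{\nu,0}$ is the set of $\eta\in\mathcal{M}_b$ with $\eta\ll\nu$ and $\eta(\mathbb{R})=0$. $I_\nu(\eta)=\frac12\int (d\eta/d\nu)^2\,d\nu$ if $\eta\in\mathcal{M}_b^{\nu,0}$ and $I_\nu(\eta)=+\infty$ otherwise. $\inf\emptyset=+\infty$ in the rate function. Large deviation principle: maps $Y_n$ from probability spaces $(\Omega_n,\mathcal{F}_n,\mathbb{P}_n)$ to a metric space $\mathcal{X}$ satisfy the LDP with speed $c_n^{-1}$ ($c_n>0$, $c_n\to\infty$) and rate function $I:\mathcal{X}\to[0,\infty]$ if $I$ is lower semicontinuous with compact level sets and, for any measurable $A\subset\mathcal{X}$, $$-\inf_{x\in A^o}I(x)\le\liminf_{n}\tfrac1{c_n}\log\mathbb{P}_{n*}(Y_n\in A)\le\limsup_{n}\tfrac1{c_n}\log\mathbb{P}_n^{*}(Y_n\in A)\le-\inf_{x\in\bar A}I(x),$$ where $A^o$, $\bar A$ are interior and closure and $\mathbb{P}_{n*},\mathbb{P}_n^*$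 are inner and outer probability. Here $c_n=\lambda_n^2$. *)

theory Defs
  imports "HOL-Probability.Probability" "HOL-Library.Landau_Symbols"
begin

section \<open>Large deviation principles in metric spaces\<close>

definition elog :: "ennreal \<Rightarrow> ereal" where
  "elog x = (if x = 0 then -\<infinity> else if x = \<infinity> then \<infinity> else ereal (ln (enn2real x)))"

text \<open>Counterpart of \<^const>\<open>outer_measure_of\<close>.\<close>

definition inner_measure_of :: "'a measure \<Rightarrow> 'a set \<Rightarrow> ennreal" where
  "inner_measure_of M A = (SUP B \<in> {B \<in> sets M. B \<subseteq> A}. emeasure M B)"

definition borel_sets_of :: "'b metric \<Rightarrow> 'b set set" where
  "borel_sets_of m = sigma_sets (mspace m) {U. openin (mtopology_of m) U}"

definition good_rate_function :: "'b metric \<Rightarrow> ('b \<Rightarrow> ennreal) \<Rightarrow> bool" where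
  "good_rate_function m I \<longleftrightarrow>
     (\<forall>a. openin (mtopology_of m) {x \<in> mspace m. a < I x}) \<and>
     (\<forall>a. a < \<infinity> \<longrightarrow> compactin (mtopology_of m) {x \<in> mspace m. I x \<le> a})"

text \<open>
  Sequences are indexed by \<open>n \<ge> 1\<close>; the speed is \<open>1 / c n\<close>. The maps \<open>Y n\<close> are not assumed to be
  measurable. Infima are taken in \<^typ>\<open>ennreal\<close>, so the infimum over the empty set is \<open>\<infinity>\<close>.
\<close>

definition satisfies_LDP ::
  "(nat \<Rightarrow> 'a measure) \<Rightarrow> (nat \<Rightarrow> 'a \<Rightarrow> 'b) \<Rightarrow> 'b metric \<Rightarrow> (nat \<Rightarrow> real) \<Rightarrow> ('b \<Rightarrow> ennreal) \<Rightarrow> bool" where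
  "satisfies_LDP P Y m c I \<longleftrightarrow>
     (\<forall>n\<ge>1. prob_space (P n) \<and> Y n \<in> space (P n) \<rightarrow> mspace m) \<and>
     (\<forall>n\<ge>1. 0 < c n) \<and> filterlim c at_top sequentially \<and>
     good_rate_function m I \<and>
     (\<forall>A \<in> borel_sets_of m.
        - enn2ereal (INF x \<in> mtopology_of m interior_of A. I x)
          \<le> liminf (\<lambda>n. ereal (1 / c n) * elog (inner_measure_of (P n) {\<omega> \<in> space (P n). Y n \<omega> \<in> A})) \<and>
        limsup (\<lambda>n. ereal (1 / c n) * elog (outer_measure_of (P n) {\<omega> \<in> space (P n). Y n \<omega> \<in> A}))
          \<le> - enn2ereal (INF x \<in> mtopology_of m closure_of A. I x))"

definition converges_in_outer_prob ::
  "(nat \<Rightarrow> 'a measure) \<Rightarrow> (nat \<Rightarrow> 'a \<Rightarrow> 'b) \<Rightarrow> 'b metric \<Rightarrow> 'b \<Rightarrow> bool" where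
  "converges_in_outer_prob P Y m y \<longleftrightarrow>
     y \<in> mspace m \<and> (\<forall>n\<ge>1. Y n \<in> space (P n) \<rightarrow> mspace m) \<and>
     (\<forall>\<epsilon>>0. (\<lambda>n. outer_measure_of (P n) {\<omega> \<in> space (P n). \<epsilon> < mdist m (Y n \<omega>) y}) \<longlonglongrightarrow> 0)"

text \<open>Elements are functions equal to \<^term>\<open>undefined\<close> outside \<open>[q, p]\<close>.\<close>

definition l_infty :: "real \<Rightarrow> real \<Rightarrow> (real \<Rightarrow> real) metric" where
  "l_infty q p = funspace {q..p} euclidean_metric"


section \<open>Signed measures of finite variation on the real line\<close>

text \<open>A signed measure is a set function; only its values on Borel sets matter.\<close>

definition total_variation :: "(real set \<Rightarrow> real) \<Rightarrow> ennreal" where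
  "total_variation \<eta> =
     (SUP \<P> \<in> {\<P>. finite \<P> \<and> disjoint \<P> \<and> \<P> \<subseteq> sets borel}. \<Sum>A\<in>\<P>. ennreal \<bar>\<eta> A\<bar>)"

definition Mb :: "(real set \<Rightarrow> real) set" where
  "Mb = {\<eta>. (\<forall>A :: nat \<Rightarrow> real set. range A \<subseteq> sets borel \<longrightarrow> disjoint_family A \<longrightarrow>
               (\<lambda>i. \<eta> (A i)) sums \<eta> (\<Union>i. A i)) \<and>
             total_variation \<eta> < \<infinity>}"

definition Mb0 :: "real measure \<Rightarrow> (real set \<Rightarrow> real) set" where
  "Mb0 \<nu> = {\<eta> \<in> Mb. (\<forall>A \<in> null_sets \<nu>. \<eta> A = 0) \<and> \<eta> UNIV = 0}"

text \<open>
  The parts of the Jordan decomposition. In the supremum \<^const>\<open>ennreal\<close> truncates negative values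
  to \<open>0\<close>, which is the value attained at \<open>B = {}\<close>.
\<close>

definition pos_part :: "(real set \<Rightarrow> real) \<Rightarrow> real measure" where
  "pos_part \<eta> = measure_of UNIV (sets borel) (\<lambda>A. SUP B \<in> {B \<in> sets borel. B \<subseteq> A}. ennreal (\<eta> B))"

definition neg_part :: "(real set \<Rightarrow> real) \<Rightarrow> real measure" where
  "neg_part \<eta> = pos_part (\<lambda>A. - \<eta> A)"

definition signed_integral :: "(real set \<Rightarrow> real) \<Rightarrow> (real \<Rightarrow> real) \<Rightarrow> real" where
  "signed_integral \<eta> g = (LINT x|pos_part \<eta>. g x) - (LINT x|neg_part \<eta>. g x)"

text \<open>A version of the density of \<open>\<eta>\<close> with respect to \<open>\<nu>\<close>; it is unique up to \<open>\<nu>\<close>-null sets.\<close>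

definition signed_RN_deriv :: "real measure \<Rightarrow> (real set \<Rightarrow> real) \<Rightarrow> real \<Rightarrow> real" where
  "signed_RN_deriv \<nu> \<eta> =
     (SOME h. integrable \<nu> h \<and> (\<forall>A \<in> sets borel. \<eta> A = (LINT x:A|\<nu>. h x)))"

definition I_meas :: "real measure \<Rightarrow> (real set \<Rightarrow> real) \<Rightarrow> ennreal" where
  "I_meas \<nu> \<eta> =
     (if \<eta> \<in> Mb0 \<nu> then (\<integral>\<^sup>+ x. ennreal ((signed_RN_deriv \<nu> \<eta> x)\<^sup>2) \<partial>\<nu>) / 2 else \<infinity>)"


section \<open>Weighted empirical measures and quantiles\<close>

text \<open>
  The sum of the point masses \<open>w (X i \<omega>) / n\<close> at \<open>X i \<omega>\<close>, for \<open>1 \<le> i \<le> n\<close>.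
\<close>

definition weighted_empirical ::
  "(real \<Rightarrow> real) \<Rightarrow> (nat \<Rightarrow> 'a \<Rightarrow> real) \<Rightarrow> nat \<Rightarrow> 'a \<Rightarrow> real measure" where
  "weighted_empirical w X n \<omega> =
     distr (density (uniform_count_measure {1..n}) (\<lambda>i. ennreal (w (X i \<omega>)))) borel (\<lambda>i. X i \<omega>)"

definition emp_tail :: "(real \<Rightarrow> real) \<Rightarrow> (nat \<Rightarrow> 'a \<Rightarrow> real) \<Rightarrow> nat \<Rightarrow> 'a \<Rightarrow> real \<Rightarrow> real" where
  "emp_tail w X n \<omega> t = (LINT x|weighted_empirical w X n \<omega>. indicator {t<..} x)"

lemma emp_tail_eq_sum:
  assumes "\<And>x. 0 \<le> w x"
  shows "emp_tail w X n \<omega> t = (\<Sum>i=1..n. w (X i \<omega>) * indicator {t<..} (X i \<omega>)) / n"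
proof -
  let ?U = "uniform_count_measure {1..n}"
  have "emp_tail w X n \<omega> t
      = (LINT i|density ?U (\<lambda>i. ennreal (w (X i \<omega>))). indicator {t<..} (X i \<omega>))"
    unfolding emp_tail_def weighted_empirical_def
    by (rule integral_distr)
      (simp add: measurable_def space_uniform_count_measure sets_uniform_count_measure, measurable)
  also have "\<dots> = (LINT i|?U. w (X i \<omega>) *\<^sub>R indicator {t<..} (X i \<omega>))"
    using assms by (intro integral_density)
      (auto simp: measurable_def space_uniform_count_measure sets_uniform_count_measure)
  finally show ?thesis
    by (simp add: integral_uniform_count_measure)
qed

definition tail :: "real measure \<Rightarrow> real \<Rightarrow> real" where
  "tail \<mu> t = 1 - cdf \<mu> t"

text \<open>
  If \<open>u\<close> is at least the total mass of the weighted empirical measure, the set below is all of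
  \<^typ>\<open>real\<close> for \<open>H = emp_tail w X n \<omega>\<close>. The infimum is then \<open>-\<infinity>\<close> mathematically, while the
  real-valued \<^const>\<open>Inf\<close> is some fixed real number. This occurs for some \<open>u \<in> [q, p]\<close>, \<open>p < 1\<close>, only with
  probability exponentially small in \<open>n\<close>, so it does not affect an LDP whose \<open>c n\<close> is \<open>o(n)\<close>.
\<close>

definition ginv :: "(real \<Rightarrow> real) \<Rightarrow> real \<Rightarrow> real" where
  "ginv H u = Inf {t. H t \<le> u}"

definition quantile_dev ::
  "real measure \<Rightarrow> (real \<Rightarrow> real) \<Rightarrow> (nat \<Rightarrow> 'a \<Rightarrow> real) \<Rightarrow> (nat \<Rightarrow> real) \<Rightarrow> real \<Rightarrow> real \<Rightarrow>
   nat \<Rightarrow> 'a \<Rightarrow> real \<Rightarrow> real" where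
  "quantile_dev \<mu> w X b q p n \<omega> =
     (\<lambda>u\<in>{q..p}. b n * (ginv (emp_tail w X n \<omega>) u - ginv (tail \<mu>) u))"

text \<open>
  \<open>signed_integral\<close> is \<open>0\<close> by convention where the integral does not exist. This has no effect on the
  infimum when \<open>w\<close> is \<open>\<nu>\<close>-square-integrable, because then the integral exists whenever \<open>I_meas \<nu> \<eta>\<close> is finite.
\<close>

definition quantile_rate ::
  "real measure \<Rightarrow> real measure \<Rightarrow> (real \<Rightarrow> real) \<Rightarrow> (real \<Rightarrow> real) \<Rightarrow> real \<Rightarrow> real \<Rightarrow>
   (real \<Rightarrow> real) \<Rightarrow> ennreal" where
  "quantile_rate \<mu> \<nu> w f q p G =
     (INF \<eta> \<in> {\<eta> \<in> Mb0 \<nu>. \<forall>u\<in>{q..p}.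
        signed_integral \<eta> (\<lambda>x. indicator {ginv (tail \<mu>) u<..} x * w x) / f (ginv (tail \<mu>) u) = G u}.
      I_meas \<nu> \<eta>)"

end

theory Submission
  imports Defs "HOL-Complex_Analysis.Great_Picard"
begin

text \<open>
  With \<open>S n \<psi> = (\<Sum>i=1..n. \<psi> (X i) - E \<psi>) / (sqrt n * lam n)\<close>, the moments of \<open>exp ((lam n)\<^sup>2 * S n \<psi>)\<close> have
  logarithm \<open>(lam n)\<^sup>2 * (Var \<psi> / 2 + o(1))\<close> for every \<open>\<psi>\<close> of linear growth in \<open>w\<close>. Let \<open>Z n t\<close> be \<open>S n\<close> applied to
  \<open>w\<close> restricted to \<open>{t<..}\<close>.

  Dyadic chaining along points that are equidistributed for the measure with density \<open>w + w\<^sup>2 * exp w\<close> gives \<open>Z n\<close> a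
  modulus of continuity outside an event of superexponentially small probability; a finite grid therefore
  suffices. On the grid, the points far from the paths \<open>t \<mapsto> \<integral> h w 1\<^bsub>{t<..}\<^esub> d\<nu>\<close> with \<open>\<parallel>h\<parallel>\<^sup>2 / 2 \<le> \<alpha>\<close> are
  covered by finitely many half-spaces of Chernoff probability about \<open>exp (- \<alpha> * (lam n)\<^sup>2)\<close>: this is the upper bound.
  The lower bound comes from the exponential tilt \<open>exp ((lam n)\<^sup>2 * S n h)\<close> with \<open>h\<close> bounded.

  Finally, the empirical quantile at \<open>u\<close> is at most \<open>s\<close> iff the empirical tail at \<open>s\<close> is at most \<open>u\<close>, so the normalised
  quantile deviation is superexponentially close to \<open>Z n / f\<close> at the true quantile.
\<close>

section \<open>Square-integrable functions\<close>

text \<open>The target space is not separable and the quantile maps need not be measurable, so both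
  bounds are proved in Freidlin--Wentzell form: measurable events on which, or off which, the
  process is uniformly close to a path of bounded energy. The dual inequalities
  \<open>(\<Sum>t\<in>F. c t * y t) \<le> \<alpha> + var (\<lambda>x. \<Sum>t\<in>F. c t * tailw t
  x) / 2\<close> over finite \<open>F\<close> have three uses. They characterise the paths of energy
  at most \<alpha>; each fails on an open half-space that Chernoff's bound controls; and they
  survive pointwise limits and limits in \<alpha>. One representation lemma therefore yields the
  finite covering, the attainment of the infimum and the compactness of the level sets. Chaining
  cannot be continued indefinitely, since the Bernstein bound is Gaussian only for tilts with
  \<open>\<kappa> * \<theta> n \<le> 1\<close>. It stops at the level where the mean mass of a cell,
  times \<open>scale n\<close>, is about the tolerance; there the monotonicity of the two tails
  takes over.\<close>

definition L2 :: "'a measure \<Rightarrow> ('a \<Rightarrow> real) set" where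
  "L2 M = {h \<in> borel_measurable M. integrable M (\<lambda>x. (h x)\<^sup>2)}"

lemma L2_measurable [measurable_dest]: "h \<in> L2 M \<Longrightarrow> h \<in> borel_measurable M"
  by (simp add: L2_def)

lemma L2_sq: "h \<in> L2 M \<Longrightarrow> integrable M (\<lambda>x. (h x)\<^sup>2)"
  by (simp add: L2_def)

lemma L2_mult:
  assumes "h \<in> L2 M" "g \<in> L2 M"
  shows "integrable M (\<lambda>x. h x * g x)"
proof (rule Bochner_Integration.integrable_bound)
  show "integrable M (\<lambda>x. (h x)\<^sup>2 + (g x)\<^sup>2)"
    using assms by (auto simp: L2_def)
  show "(\<lambda>x. h x * g x) \<in> borel_measurable M"
    using assms by (auto simp: L2_def)
  have "\<bar>x * y\<bar> \<le> x\<^sup>2 + y\<^sup>2" for x y :: real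
  proof -
    have "2 * \<bar>x * y\<bar> \<le> x\<^sup>2 + y\<^sup>2"
      using sum_squares_bound[of "\<bar>x\<bar>" "\<bar>y\<bar>"] by (simp add: abs_mult)
    then show ?thesis using abs_ge_zero[of "x * y"] by linarith
  qed
  then show "AE x in M. norm (h x * g x) \<le> norm ((h x)\<^sup>2 + (g x)\<^sup>2)"
    by simp
qed

lemma L2_lincomb:
  assumes "h \<in> L2 M" "g \<in> L2 M"
  shows "(\<lambda>x. a * h x + b * g x) \<in> L2 M"
proof -
  have "(\<lambda>x. (a * h x + b * g x)\<^sup>2) = (\<lambda>x. a\<^sup>2 * (h x)\<^sup>2 + b\<^sup>2 * (g x)\<^sup>2 + 2 * a * b * (h x * g x))"
    by (auto simp: power2_eq_square algebra_simps)
  then show ?thesis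
    using assms L2_mult[OF assms] by (auto simp: L2_def)
qed

lemma L2_diff: "h \<in> L2 M \<Longrightarrow> g \<in> L2 M \<Longrightarrow> (\<lambda>x. h x - g x) \<in> L2 M"
  using L2_lincomb[of h M g 1 "-1"] by simp

lemma L2_const: "finite_measure M \<Longrightarrow> (\<lambda>_. c) \<in> L2 M"
  by (auto simp: L2_def finite_measure.integrable_const)

lemma L2_integrable: "finite_measure M \<Longrightarrow> h \<in> L2 M \<Longrightarrow> integrable M h"
  using L2_mult[of h M "\<lambda>_. 1"] L2_const[of M 1] by simp

lemma L2_lincomb_sq:
  assumes "h \<in> L2 M" "g \<in> L2 M"
  shows "(LINT x|M. (a * h x + b * g x)\<^sup>2) =
    a\<^sup>2 * (LINT x|M. (h x)\<^sup>2) + b\<^sup>2 * (LINT x|M. (g x)\<^sup>2) + 2 * a * b * (LINT x|M. h x * g x)"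
proof -
  have "(\<lambda>x. (a * h x + b * g x)\<^sup>2) = (\<lambda>x. a\<^sup>2 * (h x)\<^sup>2 + b\<^sup>2 * (g x)\<^sup>2 + 2 * a * b * (h x * g x))"
    by (auto simp: power2_eq_square algebra_simps)
  then show ?thesis
    using assms L2_mult[OF assms] by (auto simp: L2_sq)
qed

text \<open>The form \<open>a\<^sup>2 * ?A + b\<^sup>2 * ?B + 2 * a * b * ?C\<close> is a squared
  norm, hence nonnegative; \<open>(a, b) = (?B, - ?C)\<close> turns this into
  \<open>?B * (?A * ?B - ?C\<^sup>2) \<ge> 0\<close>. For \<open>?B = 0\<close> the form is affine
  in \<open>b\<close>, which forces \<open>?C = 0\<close>.\<close>

lemma L2_Cauchy_Schwarz:
  assumes "h \<in> L2 M" "g \<in> L2 M"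
  shows "(LINT x|M. h x * g x)\<^sup>2 \<le> (LINT x|M. (h x)\<^sup>2) * (LINT x|M. (g x)\<^sup>2)"
proof -
  let ?A = "LINT x|M. (h x)\<^sup>2" and ?B = "LINT x|M. (g x)\<^sup>2" and ?C = "LINT x|M. h x * g x"
  have nn: "0 \<le> a\<^sup>2 * ?A + b\<^sup>2 * ?B + 2 * a * b * ?C" for a b
    unfolding L2_lincomb_sq[OF assms, symmetric] by simp
  have "0 \<le> ?A" "0 \<le> ?B" by simp_all
  show ?thesis
  proof (cases "?B = 0")
    case True
    have "?C = 0"
    proof (rule ccontr)
      assume "?C \<noteq> 0"
      then show False
        using nn[of 1 "- (?A + 1) / (2 * ?C)"] True by (simp add: field_simps)
    qed
    then show ?thesis using True by simp
  next
    case False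
    then have "0 < ?B" using \<open>0 \<le> ?B\<close> by linarith
    have "0 \<le> ?B * (?A * ?B - ?C\<^sup>2)"
      using nn[of "?B" "- ?C"] by (simp add: power2_eq_square algebra_simps)
    then show ?thesis using \<open>0 < ?B\<close> by (simp add: zero_le_mult_iff)
  qed
qed

text \<open>Riesz--Fischer. Along indices where the squared distances are at most
  \<open>(1/4)^k\<close>, the increments are summable in L1 because the measure is finite, so the
  subsequence converges almost everywhere. Fatou's lemma transfers the Cauchy bound to that
  limit.\<close>

lemma L2_complete:
  fixes h :: "nat \<Rightarrow> 'a \<Rightarrow> real"
  assumes fin: "finite_measure M" and h: "\<And>n. h n \<in> L2 M"
    and cauchy: "\<And>e. 0 < e \<Longrightarrow> \<exists>N. \<forall>m\<ge>N. \<forall>n\<ge>N. (LINT x|M. (h m x - h n x)\<^sup>2) \<le> e"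
  obtains g where "g \<in> L2 M" "(\<lambda>n. LINT x|M. (h n x - g x)\<^sup>2) \<longlonglongrightarrow> 0"
proof -
  interpret finite_measure M by fact
  note [measurable] = L2_measurable[OF h]
  have "\<exists>N. \<forall>k. \<forall>m\<ge>N k. \<forall>n\<ge>N k. (LINT x|M. (h m x - h n x)\<^sup>2) \<le> (1/4)^k"
    by (intro choice allI cauchy) simp
  then obtain N where N: "\<And>k m n. m \<ge> N k \<Longrightarrow> n \<ge> N k \<Longrightarrow> (LINT x|M. (h m x - h n x)\<^sup>2) \<le> (1/4)^k"
    by blast
  \<comment> \<open>The sum makes \<open>r\<close> monotone and at least \<open>N k\<close>; the
    summand \<open>k\<close> makes it tend to infinity.\<close>
  define r where "r k = k + (\<Sum>i\<le>k. N i)" for k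
  have rN: "N k \<le> r k" for k
    using member_le_sum[of k "{..k}" N] unfolding r_def by simp
  have rmono: "r k \<le> r (Suc k)" for k unfolding r_def by simp
  have rk: "k \<le> r k" for k unfolding r_def by simp
  define d where "d k x = \<bar>h (r (Suc k)) x - h (r k) x\<bar>" for k x
  have [measurable]: "d k \<in> borel_measurable M" for k unfolding d_def by simp
  have dL2: "d k \<in> L2 M" for k
    using L2_diff[OF h h, of "r (Suc k)" "r k"] by (auto simp: L2_def d_def)
  have d1: "(LINT x|M. d k x) \<le> sqrt (measure M (space M)) * (1/2)^k" for k
  proof -
    have "(LINT x|M. d k x)\<^sup>2 \<le> (LINT x|M. (d k x)\<^sup>2) * measure M (space M)"
      using L2_Cauchy_Schwarz[OF dL2 L2_const[OF fin, of 1]] by simp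
    also have "\<dots> \<le> (1/4)^k * measure M (space M)"
      using N[of k "r (Suc k)" "r k"] rN[of k] rmono[of k]
      by (intro mult_right_mono) (auto simp: d_def)
    finally have "(LINT x|M. d k x) \<le> sqrt ((1/4)^k * measure M (space M))"
      by (rule real_le_rsqrt)
    also have "\<dots> = sqrt (measure M (space M)) * (1/2)^k"
      by (simp add: real_sqrt_mult real_sqrt_power real_sqrt_divide)
    finally show ?thesis .
  qed
  have "(\<integral>\<^sup>+x. (\<Sum>k. ennreal (d k x)) \<partial>M) = (\<Sum>k. \<integral>\<^sup>+x. ennreal (d k x) \<partial>M)"
    by (rule nn_integral_suminf) simp
  also have "\<dots> = (\<Sum>k. ennreal (LINT x|M. d k x))"
    using L2_integrable[OF fin dL2] by (subst nn_integral_eq_integral) (auto simp: d_def)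
  also have "\<dots> \<le> (\<Sum>k. ennreal (sqrt (measure M (space M)) * (1/2)^k))"
    by (intro suminf_le ennreal_leI d1) auto
  also have "\<dots> < \<infinity>"
    by (subst suminf_ennreal2) (auto intro!: summable_mult summable_geometric)
  finally have "AE x in M. (\<Sum>k. ennreal (d k x)) \<noteq> \<infinity>"
    by (intro nn_integral_PInf_AE) auto
  then have conv: "AE x in M. convergent (\<lambda>k. h (r k) x)"
  proof eventually_elim
    case (elim x)
    have "summable (\<lambda>k. d k x)"
      using elim by (intro summable_suminf_not_top) (auto simp: d_def)
    then have "summable (\<lambda>k. h (r (Suc k)) x - h (r k) x)"
      unfolding d_def by (rule summable_rabs_cancel)
    then have "convergent (\<lambda>n. \<Sum>k<n. h (r (Suc k)) x - h (r k) x)"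
      by (simp add: summable_iff_convergent)
    then have "convergent (\<lambda>n. h (r n) x - h (r 0) x)"
      by (subst (asm) sum_lessThan_telescope[where f = "\<lambda>k. h (r k) x"])
    then show ?case
      by (metis convergent_diff_const_right_iff)
  qed
  \<comment> \<open>\<open>lim\<close> is an unspecified value on the null set of divergence; only
    the almost sure limit matters.\<close>
  define g where "g x = lim (\<lambda>k. h (r k) x)" for x
  have g[measurable]: "g \<in> borel_measurable M" unfolding g_def by measurable
  have fatou: "(\<integral>\<^sup>+x. ennreal ((h m x - g x)\<^sup>2) \<partial>M) \<le> ennreal e"
    if "\<And>m n. K \<le> m \<Longrightarrow> K \<le> n \<Longrightarrow> (LINT x|M. (h m x - h n x)\<^sup>2) \<le> e" "K \<le> m" for m K e
  proof -
    have "(\<integral>\<^sup>+x. ennreal ((h m x - g x)\<^sup>2) \<partial>M) = (\<integral>\<^sup>+x. liminf (\<lambda>k. ennreal ((h m x - h (r (k + K)) x)\<^sup>2)) \<partial>M)"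
    proof (rule nn_integral_cong_AE, use conv in eventually_elim)
      case (elim x)
      then have "(\<lambda>k. h (r k) x) \<longlonglongrightarrow> g x" by (simp add: g_def convergent_LIMSEQ_iff)
      then have "(\<lambda>k. h (r (k + K)) x) \<longlonglongrightarrow> g x" by (rule LIMSEQ_ignore_initial_segment)
      then have "(\<lambda>k. ennreal ((h m x - h (r (k + K)) x)\<^sup>2)) \<longlonglongrightarrow> ennreal ((h m x - g x)\<^sup>2)"
        by (intro tendsto_ennrealI tendsto_intros)
      then show ?case by (rule lim_imp_Liminf[OF sequentially_bot, symmetric])
    qed
    also have "\<dots> \<le> liminf (\<lambda>k. \<integral>\<^sup>+x. ennreal ((h m x - h (r (k + K)) x)\<^sup>2) \<partial>M)"
      by (rule nn_integral_liminf) simp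
    also have "\<dots> \<le> liminf (\<lambda>k. ennreal e)"
    proof (rule Liminf_mono, rule eventuallyI)
      fix k
      have "K \<le> r (k + K)" using rk[of "k + K"] by simp
      show "(\<integral>\<^sup>+x. ennreal ((h m x - h (r (k + K)) x)\<^sup>2) \<partial>M) \<le> ennreal e"
        using that \<open>K \<le> r (k + K)\<close> L2_sq[OF L2_diff[OF h h]]
        by (subst nn_integral_eq_integral) (auto intro!: ennreal_leI)
    qed
    finally show ?thesis by (simp add: Liminf_const)
  qed
  have int: "integrable M (\<lambda>x. (h m x - g x)\<^sup>2) \<and> (LINT x|M. (h m x - g x)\<^sup>2) \<le> e"
    if "\<And>m n. K \<le> m \<Longrightarrow> K \<le> n \<Longrightarrow> (LINT x|M. (h m x - h n x)\<^sup>2) \<le> e" "K \<le> m" "0 \<le> e" for m K e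
  proof
    have le: "(\<integral>\<^sup>+x. ennreal ((h m x - g x)\<^sup>2) \<partial>M) \<le> ennreal e" using that fatou by blast
    then show 1: "integrable M (\<lambda>x. (h m x - g x)\<^sup>2)"
      by (intro integrableI_bounded) (auto simp: le_less_trans)
    show "(LINT x|M. (h m x - g x)\<^sup>2) \<le> e"
      using le that(3) by (subst (asm) nn_integral_eq_integral[OF 1]) auto
  qed
  obtain K1 where K1: "\<And>m n. K1 \<le> m \<Longrightarrow> K1 \<le> n \<Longrightarrow> (LINT x|M. (h m x - h n x)\<^sup>2) \<le> 1"
    using cauchy[of 1] by auto
  have "(\<lambda>x. h K1 x - g x) \<in> L2 M"
    using int[OF K1, of K1] by (auto simp: L2_def)
  from L2_diff[OF h[of K1] this] have gL2: "g \<in> L2 M" by simp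
  moreover have "(\<lambda>n. LINT x|M. (h n x - g x)\<^sup>2) \<longlonglongrightarrow> 0"
  proof (rule LIMSEQ_I)
    fix e :: real assume "0 < e"
    then obtain K where K: "\<And>m n. K \<le> m \<Longrightarrow> K \<le> n \<Longrightarrow> (LINT x|M. (h m x - h n x)\<^sup>2) \<le> e / 2"
      using cauchy[of "e/2"] by auto
    show "\<exists>no. \<forall>n\<ge>no. norm ((LINT x|M. (h n x - g x)\<^sup>2) - 0) < e"
      using int[OF K] \<open>0 < e\<close> by (intro exI[of _ K]) (fastforce simp: integral_nonneg_AE)
  qed
  ultimately show ?thesis by (rule that)
qed

lemma L2_tendsto_inner:
  assumes "\<And>n. h n \<in> L2 M" "g \<in> L2 M" "(\<lambda>n. LINT x|M. (h n x - g x)\<^sup>2) \<longlonglongrightarrow> 0" "k \<in> L2 M"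
  shows "(\<lambda>n. LINT x|M. h n x * k x) \<longlonglongrightarrow> (LINT x|M. g x * k x)"
proof (rule LIM_zero_cancel, rule Lim_null_comparison)
  let ?B = "LINT x|M. (k x)\<^sup>2"
  show "\<forall>\<^sub>F n in sequentially. norm ((LINT x|M. h n x * k x) - (LINT x|M. g x * k x)) \<le> sqrt ((LINT x|M. (h n x - g x)\<^sup>2) * ?B)"
  proof (rule always_eventually, rule allI)
    fix n
    have "(LINT x|M. h n x * k x) - (LINT x|M. g x * k x) = (LINT x|M. (h n x - g x) * k x)"
      using assms by (simp add: left_diff_distrib L2_mult)
    then show "norm ((LINT x|M. h n x * k x) - (LINT x|M. g x * k x)) \<le> sqrt ((LINT x|M. (h n x - g x)\<^sup>2) * ?B)"
      using L2_Cauchy_Schwarz[OF L2_diff[OF assms(1,2)] assms(4), of n] by (intro real_le_rsqrt) simp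
  qed
  have "(\<lambda>n. sqrt ((LINT x|M. (h n x - g x)\<^sup>2) * ?B)) \<longlonglongrightarrow> sqrt (0 * ?B)"
    by (intro tendsto_intros assms)
  then show "(\<lambda>n. sqrt ((LINT x|M. (h n x - g x)\<^sup>2) * ?B)) \<longlonglongrightarrow> 0" by simp
qed

lemma L2_tendsto_sq:
  assumes h: "\<And>n. h n \<in> L2 M" and g: "g \<in> L2 M" and lim: "(\<lambda>n. LINT x|M. (h n x - g x)\<^sup>2) \<longlonglongrightarrow> 0"
  shows "(\<lambda>n. LINT x|M. (h n x)\<^sup>2) \<longlonglongrightarrow> (LINT x|M. (g x)\<^sup>2)"
proof -
  have "(LINT x|M. (h n x)\<^sup>2) = (LINT x|M. (h n x - g x)\<^sup>2) + 2 * (LINT x|M. h n x * g x) - (LINT x|M. (g x)\<^sup>2)" for n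
    using L2_lincomb_sq[OF h[of n] g, of 1 "-1"] by simp
  moreover have "(\<lambda>n. (LINT x|M. (h n x - g x)\<^sup>2) + 2 * (LINT x|M. h n x * g x) - (LINT x|M. (g x)\<^sup>2)) \<longlonglongrightarrow>
     0 + 2 * (LINT x|M. g x * g x) - (LINT x|M. (g x)\<^sup>2)"
    by (intro tendsto_intros lim L2_tendsto_inner h g)
  ultimately show ?thesis by (simp add: power2_eq_square)
qed

text \<open>The first-order condition at a minimum: near 0 the linear term dominates, so a nonzero
  \<open>C\<close> would make the form negative for a small \<open>s\<close> of opposite sign. The
  choice \<open>s = - C / (B + 1)\<close> is small enough.\<close>

lemma quadratic_nonneg_imp_linear_zero:
  fixes B C :: real
  assumes "\<And>s. 0 \<le> s\<^sup>2 * B / 2 + s * C" "0 \<le> B"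
  shows "C = 0"
proof (rule ccontr)
  assume "C \<noteq> 0"
  define t where "t = 1 / (B + 1)"
  have t: "0 < t" "t * B < 1" using assms(2) by (auto simp: t_def)
  have p: "0 < t * C\<^sup>2" using t \<open>C \<noteq> 0\<close> by (intro mult_pos_pos) auto
  have "0 \<le> (- C * t)\<^sup>2 * B / 2 + (- C * t) * C" by (rule assms)
  also have "\<dots> = t * C\<^sup>2 * (t * B / 2 - 1)" by (simp add: power2_eq_square algebra_simps)
  finally have "0 \<le> t * B / 2 - 1" using p by (simp add: zero_le_mult_iff)
  then show False using t by linarith
qed

text \<open>
  A Riesz representation on a space that need not be closed: the representing element is the limit of
  a minimising sequence of \<open>\<phi> \<mapsto> \<parallel>\<phi>\<parallel>\<^sup>2 / 2 - l\<close>, which is Cauchy by the parallelogram law.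
\<close>

lemma L2_representation:
  fixes V :: "(('a \<Rightarrow> real) \<times> real) set"
  assumes fin: "finite_measure M" and ne: "V \<noteq> {}"
    and lin: "\<And>p p' a b. p \<in> V \<Longrightarrow> p' \<in> V \<Longrightarrow> (\<lambda>x. a * fst p x + b * fst p' x, a * snd p + b * snd p') \<in> V"
    and L2: "\<And>p. p \<in> V \<Longrightarrow> fst p \<in> L2 M"
    and bd: "\<And>p. p \<in> V \<Longrightarrow> snd p \<le> a + (LINT x|M. (fst p x)\<^sup>2) / 2"
  obtains h where "h \<in> L2 M" "(LINT x|M. (h x)\<^sup>2) / 2 \<le> a" "\<And>p. p \<in> V \<Longrightarrow> (LINT x|M. h x * fst p x) = snd p"
proof -
  define J where "J p = (LINT x|M. (fst p x)\<^sup>2) / 2 - snd p" for p :: "('a \<Rightarrow> real) \<times> real"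
  define j where "j = Inf (J ` V)"
  have Ja: "- a \<le> J p" if "p \<in> V" for p using bd[OF that] by (simp add: J_def)
  have bdd: "bdd_below (J ` V)" using Ja by (intro bdd_belowI[of _ "- a"]) auto
  have jle: "j \<le> J p" if "p \<in> V" for p unfolding j_def using bdd that by (auto intro: cInf_lower)
  have "\<exists>p. p \<in> V \<and> J p < j + 1 / Suc n" for n
  proof -
    have "Inf (J ` V) < j + 1 / Suc n" by (simp add: j_def)
    then show ?thesis using ne bdd by (auto simp: cInf_less_iff)
  qed
  then obtain p where pV: "\<And>n. p n \<in> V" and pJ: "\<And>n. J (p n) < j + 1 / Suc n" by metis
  let ?h = "\<lambda>n. fst (p n)"
  have hL2: "?h n \<in> L2 M" for n using L2 pV by blast
  \<comment> \<open>The midpoint stays in \<open>V\<close>, so \<open>J\<close> is at least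
    \<open>j\<close> there. In \<open>J (p m) + J (p n) - 2 * J ?m\<close> the linear parts cancel
    and a quarter of the squared distance remains.\<close>
  have par: "(LINT x|M. (?h m x - ?h n x)\<^sup>2) \<le> 4 * (1 / Suc m + 1 / Suc n)" for m n
  proof -
    let ?m = "(\<lambda>x. (1/2) * ?h m x + (1/2) * ?h n x, (1/2) * snd (p m) + (1/2) * snd (p n))"
    have "?m \<in> V" by (intro lin pV)
    then have "j \<le> J ?m" by (rule jle)
    moreover have "(LINT x|M. (?h m x - ?h n x)\<^sup>2) = 4 * (J (p m) + J (p n) - 2 * J ?m)"
      using L2_lincomb_sq[OF hL2[of m] hL2[of n], of 1 "-1"] L2_lincomb_sq[OF hL2[of m] hL2[of n], of "1/2" "1/2"]
      by (simp add: J_def power2_eq_square field_simps)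
    ultimately show ?thesis using pJ[of m] pJ[of n] by argo
  qed
  obtain h where h: "h \<in> L2 M" and lim: "(\<lambda>n. LINT x|M. (?h n x - h x)\<^sup>2) \<longlonglongrightarrow> 0"
  proof (rule L2_complete[OF fin hL2])
    fix e :: real assume "0 < e"
    then obtain N where N: "inverse (real (Suc N)) < e / 8" using reals_Archimedean[of "e/8"] by auto
    show "\<exists>N. \<forall>m\<ge>N. \<forall>n\<ge>N. (LINT x|M. (?h m x - ?h n x)\<^sup>2) \<le> e"
    proof (intro exI allI impI)
      fix m n assume "N \<le> m" "N \<le> n"
      then have "1 / real (Suc m) \<le> inverse (real (Suc N))" "1 / real (Suc n) \<le> inverse (real (Suc N))"
        by (auto simp: field_simps)
      then show "(LINT x|M. (?h m x - ?h n x)\<^sup>2) \<le> e" using par[of m n] N by argo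
    qed
  qed
  have inv0: "(\<lambda>n. 1 / real (Suc n)) \<longlonglongrightarrow> 0" using LIMSEQ_inverse_real_of_nat by (simp add: field_simps)
  have eq: "(LINT x|M. h x * fst q x) = snd q" if q: "q \<in> V" for q
  proof -
    let ?B = "LINT x|M. (fst q x)\<^sup>2" and ?C = "(LINT x|M. h x * fst q x) - snd q"
    \<comment> \<open>Moving the near-minimiser \<open>p n\<close> by \<open>s\<close> times
      \<open>q\<close> cannot lower \<open>J\<close> by more than \<open>1 / Suc n\<close>; this
      error vanishes in the limit.\<close>
    have nn: "0 \<le> s\<^sup>2 * ?B / 2 + s * ?C" for s
    proof (rule tendsto_le[OF sequentially_bot])
      show "(\<lambda>n. s\<^sup>2 * ?B / 2 + s * ((LINT x|M. ?h n x * fst q x) - snd q) + 1 / Suc n) \<longlonglongrightarrow> s\<^sup>2 * ?B / 2 + s * ?C"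
        using tendsto_add[OF tendsto_add[OF tendsto_const tendsto_mult[OF tendsto_const tendsto_diff[OF L2_tendsto_inner[OF hL2 h lim L2[OF q]] tendsto_const]]] inv0]
        by simp
      show "(\<lambda>_. 0) \<longlonglongrightarrow> 0" by simp
      show "\<forall>\<^sub>F n in sequentially. 0 \<le> s\<^sup>2 * ?B / 2 + s * ((LINT x|M. ?h n x * fst q x) - snd q) + 1 / Suc n"
      proof (rule always_eventually, rule allI)
        fix n
        let ?m = "(\<lambda>x. 1 * ?h n x + s * fst q x, 1 * snd (p n) + s * snd q)"
        have "j \<le> J ?m" by (intro jle lin pV q)
        also have "J ?m = J (p n) + (s\<^sup>2 * ?B / 2 + s * ((LINT x|M. ?h n x * fst q x) - snd q))"
          using L2_lincomb_sq[OF hL2[of n] L2[OF q], of 1 s] by (simp add: J_def field_simps)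
        finally show "0 \<le> s\<^sup>2 * ?B / 2 + s * ((LINT x|M. ?h n x * fst q x) - snd q) + 1 / Suc n"
          using pJ[of n] by argo
      qed
    qed
    have "0 \<le> ?B" by simp
    have "?C = 0" using nn by (rule quadratic_nonneg_imp_linear_zero) simp
    then show ?thesis by simp
  qed
  have "(LINT x|M. (h x)\<^sup>2) / 2 \<le> a"
  proof (rule tendsto_le[OF sequentially_bot tendsto_const])
    \<comment> \<open>Since \<open>snd (p n)\<close> is the inner product of \<open>h\<close> with
      \<open>?h n\<close>, this sequence is \<open>- J (p n)\<close>, which is bounded by
      \<open>a\<close>.\<close>
    show "(\<lambda>n. (LINT x|M. h x * ?h n x) - (LINT x|M. (?h n x)\<^sup>2) / 2) \<longlonglongrightarrow> (LINT x|M. (h x)\<^sup>2) / 2"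
      using tendsto_diff[OF L2_tendsto_inner[OF hL2 h lim h] tendsto_divide[OF L2_tendsto_sq[OF hL2 h lim] tendsto_const[of 2]]]
      by (simp add: mult.commute power2_eq_square)
    show "\<forall>\<^sub>F n in sequentially. (LINT x|M. h x * ?h n x) - (LINT x|M. (?h n x)\<^sup>2) / 2 \<le> a"
    proof (intro always_eventually allI)
      fix n
      show "(LINT x|M. h x * ?h n x) - (LINT x|M. (?h n x)\<^sup>2) / 2 \<le> a"
        using Ja[OF pV[of n]] eq[OF pV[of n]] unfolding J_def by linarith
    qed
  qed
  with h eq that show ?thesis by blast
qed

section \<open>Signed measures\<close>

lemma integrable_indicator_times:
  fixes h :: "'a \<Rightarrow> real"
  shows "A \<in> sets M \<Longrightarrow> integrable M h \<Longrightarrow> integrable M (\<lambda>x. indicator A x * h x)"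
  using integrable_mult_indicator[of A M h] by simp

text \<open>The upper variation, the set function behind \<open>pos_part\<close>; a separate name
  lets its additivity be proved before it is turned into a measure.\<close>

definition upper_var :: "(real set \<Rightarrow> real) \<Rightarrow> real set \<Rightarrow> ennreal" where
  "upper_var \<eta> A = (SUP B \<in> {B \<in> sets borel. B \<subseteq> A}. ennreal (\<eta> B))"

lemma upper_var_upper: "B \<in> sets borel \<Longrightarrow> B \<subseteq> A \<Longrightarrow> ennreal (\<eta> B) \<le> upper_var \<eta> A"
  unfolding upper_var_def by (rule SUP_upper) auto

lemma upper_var_mono: "A \<subseteq> A' \<Longrightarrow> upper_var \<eta> A \<le> upper_var \<eta> A'"
  unfolding upper_var_def by (rule SUP_subset_mono) auto

lemma upper_var_finite: "\<eta> \<in> Mb \<Longrightarrow> upper_var \<eta> A < \<infinity>"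
proof -
  assume "\<eta> \<in> Mb"
  have "upper_var \<eta> A \<le> total_variation \<eta>"
    unfolding upper_var_def
  proof (rule SUP_least)
    fix B assume "B \<in> {B \<in> sets borel. B \<subseteq> A}"
    then have "(\<Sum>A\<in>{B}. ennreal \<bar>\<eta> A\<bar>) \<le> total_variation \<eta>"
      unfolding total_variation_def by (intro SUP_upper) auto
    then show "ennreal (\<eta> B) \<le> total_variation \<eta>"
      by (auto intro: order_trans[rotated] ennreal_leI)
  qed
  also have "\<dots> < \<infinity>" using \<open>\<eta> \<in> Mb\<close> by (simp add: Mb_def)
  finally show ?thesis .
qed

lemma Mb_sums: "\<eta> \<in> Mb \<Longrightarrow> range A \<subseteq> sets borel \<Longrightarrow> disjoint_family A \<Longrightarrow> (\<lambda>i. \<eta> (A i)) sums \<eta> (\<Union>i. A i)"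
  by (simp add: Mb_def)

lemma Mb_empty: "\<eta> \<in> Mb \<Longrightarrow> \<eta> {} = 0"
proof -
  assume "\<eta> \<in> Mb"
  then have "(\<lambda>_::nat. \<eta> {}) sums \<eta> (\<Union>i::nat. {})" by (rule Mb_sums) (auto simp: disjoint_family_on_def)
  then have "(\<lambda>_::nat. \<eta> {}) \<longlonglongrightarrow> 0" by (intro summable_LIMSEQ_zero sums_summable)
  then show ?thesis by (simp add: LIMSEQ_const_iff)
qed

lemma Mb_Un:
  assumes "\<eta> \<in> Mb" "A \<in> sets borel" "B \<in> sets borel" "A \<inter> B = {}"
  shows "\<eta> (A \<union> B) = \<eta> A + \<eta> B"
proof -
  have "(\<lambda>i. \<eta> (binaryset A B i)) sums \<eta> (\<Union>i. binaryset A B i)"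
    using assms by (intro Mb_sums) (auto simp: range_binaryset_eq disjoint_family_on_def binaryset_def)
  moreover have "(\<lambda>i. \<eta> (binaryset A B i)) sums (\<eta> A + \<eta> B)"
    using Mb_empty[OF assms(1)] by (intro binaryset_sums) simp
  ultimately show ?thesis by (simp add: UN_binaryset_eq sums_unique2)
qed

lemma Mb_uminus: "\<eta> \<in> Mb \<Longrightarrow> (\<lambda>A. - \<eta> A) \<in> Mb"
  by (auto simp: Mb_def total_variation_def intro: sums_minus)

text \<open>Subsets of \<open>A\<close> and of \<open>A'\<close> are disjoint, so their union
  competes in the supremum on the right.\<close>

lemma upper_var_add:
  assumes \<eta>: "\<eta> \<in> Mb" and A: "A \<inter> A' = {}" "A' \<in> sets borel"
  shows "upper_var \<eta> A + upper_var \<eta> A' \<le> upper_var \<eta> (A \<union> A')"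
proof -
  have ne: "{B \<in> sets borel. B \<subseteq> A} \<noteq> {}" "{B \<in> sets borel. B \<subseteq> A'} \<noteq> {}" for A A' :: "real set" by auto
  have "upper_var \<eta> A + upper_var \<eta> A' = (SUP B\<in>{B \<in> sets borel. B \<subseteq> A}. ennreal (\<eta> B) + upper_var \<eta> A')"
    unfolding upper_var_def[of \<eta> A] by (rule ennreal_SUP_add_left[symmetric]) (rule ne)
  also have "\<dots> \<le> upper_var \<eta> (A \<union> A')"
  proof (rule SUP_least)
    fix B assume B: "B \<in> {B \<in> sets borel. B \<subseteq> A}"
    have "ennreal (\<eta> B) + upper_var \<eta> A' = (SUP B'\<in>{B \<in> sets borel. B \<subseteq> A'}. ennreal (\<eta> B) + ennreal (\<eta> B'))"
      using ennreal_SUP_add_left[OF ne(2), of "\<lambda>B. ennreal (\<eta> B)" "ennreal (\<eta> B)"]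
      by (simp add: upper_var_def add.commute)
    also have "\<dots> \<le> upper_var \<eta> (A \<union> A')"
    proof (rule SUP_least)
      fix B' assume B': "B' \<in> {B \<in> sets borel. B \<subseteq> A'}"
      have "\<eta> (B \<union> B') = \<eta> B + \<eta> B'" using A B B' by (intro Mb_Un \<eta>) auto
      moreover have "ennreal (\<eta> (B \<union> B')) \<le> upper_var \<eta> (A \<union> A')" "ennreal (\<eta> B) \<le> upper_var \<eta> (A \<union> A')"
          "ennreal (\<eta> B') \<le> upper_var \<eta> (A \<union> A')"
        using B B' by (auto intro!: upper_var_upper)
      \<comment> \<open>\<open>ennreal\<close> sends negative values to 0: if one of the two values
        is negative, the other set alone is the competitor.\<close>
      ultimately show "ennreal (\<eta> B) + ennreal (\<eta> B') \<le> upper_var \<eta> (A \<union> A')"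
        by (cases "\<eta> B \<ge> 0"; cases "\<eta> B' \<ge> 0") (auto simp: ennreal_neg ennreal_plus[symmetric] simp del: ennreal_plus)
    qed
    finally show "ennreal (\<eta> B) + upper_var \<eta> A' \<le> upper_var \<eta> (A \<union> A')" .
  qed
  finally show ?thesis .
qed

text \<open>The sum is at most the variation of the union by finite superadditivity. Conversely, a
  set inside the union is cut along the \<open>A i\<close>, and each piece is replaced by the
  positive part of its value, which is what \<open>ennreal\<close> keeps.\<close>

lemma upper_var_countably_additive:
  assumes \<eta>: "\<eta> \<in> Mb"
  shows "countably_additive (sets borel) (upper_var \<eta>)"
proof (rule countably_additiveI)
  fix A :: "nat \<Rightarrow> real set"
  assume A: "range A \<subseteq> sets borel" "disjoint_family A"
  have fin: "(\<Sum>i<n. upper_var \<eta> (A i)) \<le> upper_var \<eta> (\<Union>i<n. A i)" for n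
  proof (induction n)
    case (Suc n)
    have "(\<Sum>i<Suc n. upper_var \<eta> (A i)) \<le> upper_var \<eta> (\<Union>i<n. A i) + upper_var \<eta> (A n)"
      using Suc by (simp add: add_right_mono)
    also have "\<dots> \<le> upper_var \<eta> ((\<Union>i<n. A i) \<union> A n)"
      using A by (intro upper_var_add \<eta>) (auto simp: disjoint_family_on_def dest!: less_imp_neq)
    also have "(\<Union>i<n. A i) \<union> A n = (\<Union>i<Suc n. A i)" by (auto simp: less_Suc_eq)
    finally show ?case .
  qed simp
  show "(\<Sum>i. upper_var \<eta> (A i)) = upper_var \<eta> (\<Union>i. A i)"
  proof (rule antisym)
    show "(\<Sum>i. upper_var \<eta> (A i)) \<le> upper_var \<eta> (\<Union>i. A i)"
      by (intro suminf_le_const order_trans[OF fin] upper_var_mono) auto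
    show "upper_var \<eta> (\<Union>i. A i) \<le> (\<Sum>i. upper_var \<eta> (A i))"
      unfolding upper_var_def[of \<eta> "\<Union>i. A i"]
    proof (rule SUP_least)
      fix B assume B: "B \<in> {B \<in> sets borel. B \<subseteq> (\<Union>i. A i)}"
      have "(\<lambda>i. \<eta> (B \<inter> A i)) sums \<eta> (\<Union>i. B \<inter> A i)"
        using A B by (intro Mb_sums \<eta>) (auto simp: disjoint_family_on_def)
      also have "(\<Union>i. B \<inter> A i) = B" using B by auto
      finally have s: "(\<lambda>i. \<eta> (B \<inter> A i)) sums \<eta> B" .
      have "(\<lambda>n. ennreal (\<Sum>i<n. \<eta> (B \<inter> A i))) \<longlonglongrightarrow> ennreal (\<eta> B)"
        using s by (intro tendsto_ennrealI) (simp add: sums_def)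
      moreover have "ennreal (\<Sum>i<n. \<eta> (B \<inter> A i)) \<le> (\<Sum>i. upper_var \<eta> (A i))" for n
      proof -
        have "ennreal (\<Sum>i<n. \<eta> (B \<inter> A i)) \<le> ennreal (\<Sum>i<n. max 0 (\<eta> (B \<inter> A i)))"
          by (intro ennreal_leI sum_mono) auto
        also have "\<dots> = (\<Sum>i<n. ennreal (\<eta> (B \<inter> A i)))"
          unfolding sum_ennreal[OF max.cobounded1, symmetric]
          by (intro sum.cong) (auto simp: max_def ennreal_neg)
        also have "\<dots> \<le> (\<Sum>i<n. upper_var \<eta> (A i))"
          using A B by (intro sum_mono upper_var_upper) auto
        also have "\<dots> \<le> (\<Sum>i. upper_var \<eta> (A i))" by (rule sum_le_suminf) auto
        finally show ?thesis .
      qed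
      ultimately show "ennreal (\<eta> B) \<le> (\<Sum>i. upper_var \<eta> (A i))"
        by (intro LIMSEQ_le_const2) auto
    qed
  qed
qed

lemma pos_part_eq: "pos_part \<eta> = measure_of UNIV (sets borel) (upper_var \<eta>)"
  by (simp only: pos_part_def upper_var_def[abs_def])

lemma sets_pos_part [simp, measurable_cong]: "sets (pos_part \<eta>) = sets borel"
  and space_pos_part [simp]: "space (pos_part \<eta>) = UNIV"
  using sets.sigma_sets_eq[of "borel :: real measure"] by (simp_all add: pos_part_eq space_measure_of_conv)

lemma emeasure_pos_part:
  assumes "\<eta> \<in> Mb" "A \<in> sets borel"
  shows "emeasure (pos_part \<eta>) A = upper_var \<eta> A"
proof (rule emeasure_measure_of[OF pos_part_eq])
  have "{B \<in> sets borel. B \<subseteq> {}} = {{} :: real set}" by auto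
  then show "positive (sets (pos_part \<eta>)) (upper_var \<eta>)"
    using Mb_empty[OF assms(1)] by (simp add: positive_def upper_var_def)
  show "countably_additive (sets (pos_part \<eta>)) (upper_var \<eta>)"
    using upper_var_countably_additive[OF assms(1)] by simp
qed (use assms in auto)

text \<open>The Jordan decomposition by complementation:
  \<open>\<eta> B = \<eta> A - \<eta> (A - B)\<close>, so maximising \<open>\<eta> B\<close> means
  minimising \<open>\<eta> (A - B)\<close>. The opposite inequality is the same one for the negated
  set function.\<close>

lemma upper_var_diff:
  assumes \<eta>: "\<eta> \<in> Mb" and A: "A \<in> sets borel"
  shows "enn2real (upper_var \<eta> A) - enn2real (upper_var (\<lambda>A. - \<eta> A) A) = \<eta> A"
proof -
  have le: "enn2real (upper_var \<eta> A) \<le> \<eta> A + enn2real (upper_var (\<lambda>A. - \<eta> A) A)" if \<eta>: "\<eta> \<in> Mb" for \<eta>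
  proof -
    have "upper_var \<eta> A \<le> ennreal (\<eta> A + enn2real (upper_var (\<lambda>A. - \<eta> A) A))"
      unfolding upper_var_def[of \<eta>]
    proof (rule SUP_least)
      fix B assume B: "B \<in> {B \<in> sets borel. B \<subseteq> A}"
      have "\<eta> A = \<eta> B + \<eta> (A - B)" using Mb_Un[OF \<eta>, of B "A - B"] A B by (auto simp: Un_absorb1)
      moreover have "ennreal (- \<eta> (A - B)) \<le> upper_var (\<lambda>A. - \<eta> A) A"
        using A B by (intro upper_var_upper) auto
      then have "- \<eta> (A - B) \<le> enn2real (upper_var (\<lambda>A. - \<eta> A) A)"
        using upper_var_finite[OF Mb_uminus[OF \<eta>], of A]
        by (metis enn2real_mono enn2real_ennreal enn2real_nonneg infinity_ennreal_def linorder_le_cases order_trans)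
      ultimately show "ennreal (\<eta> B) \<le> ennreal (\<eta> A + enn2real (upper_var (\<lambda>A. - \<eta> A) A))"
        by (intro ennreal_leI) linarith
    qed
    \<comment> \<open>The sign is needed because \<open>ennreal\<close> would truncate a negative
      right-hand side to 0.\<close>
    moreover have "0 \<le> \<eta> A + enn2real (upper_var (\<lambda>A. - \<eta> A) A)"
    proof -
      have "ennreal (- \<eta> A) \<le> upper_var (\<lambda>A. - \<eta> A) A"
        using A by (intro upper_var_upper) auto
      then have "- \<eta> A \<le> enn2real (upper_var (\<lambda>A. - \<eta> A) A)"
        using upper_var_finite[OF Mb_uminus[OF \<eta>], of A]
        by (metis enn2real_mono enn2real_ennreal enn2real_nonneg infinity_ennreal_def linorder_le_cases order_trans)
      then show ?thesis by linarith
    qed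
    ultimately show ?thesis
      by (metis enn2real_mono enn2real_ennreal ennreal_less_top)
  qed
  show ?thesis using le[OF \<eta>] le[OF Mb_uminus[OF \<eta>]] by simp
qed

section \<open>Densities of signed measures and integrals against them\<close>

text \<open>Radon--Nikodym for the two Jordan parts. Each inherits absolute continuity because Borel
  subsets of a null set are null.\<close>

lemma Mb0_density_exists:
  assumes "real_distribution \<nu>" and \<eta>: "\<eta> \<in> Mb0 \<nu>"
  shows "\<exists>h. integrable \<nu> h \<and> (\<forall>A\<in>sets borel. \<eta> A = (LINT x:A|\<nu>. h x))"
proof -
  interpret real_distribution \<nu> by fact
  have Mb: "\<eta> \<in> Mb" "(\<lambda>A. - \<eta> A) \<in> Mb" and null: "\<And>A. A \<in> null_sets \<nu> \<Longrightarrow> \<eta> A = 0"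
    using \<eta> Mb_uminus by (auto simp: Mb0_def)
  have ex: "\<exists>h. integrable \<nu> h \<and> (\<forall>A\<in>sets borel. enn2real (upper_var \<theta> A) = (LINT x:A|\<nu>. h x))"
    if Mb: "\<theta> \<in> Mb" and null: "\<And>A. A \<in> null_sets \<nu> \<Longrightarrow> \<theta> A = 0" for \<theta>
  proof -
    have "absolutely_continuous \<nu> (pos_part \<theta>)"
      unfolding absolutely_continuous_def
    proof
      fix A assume A: "A \<in> null_sets \<nu>"
      have "\<theta> B = 0" if "B \<in> sets borel" "B \<subseteq> A" for B
        using that A null_sets_subset[OF A] by (intro null) auto
      then have "upper_var \<theta> A \<le> 0" unfolding upper_var_def by (intro SUP_least) auto
      then have "upper_var \<theta> A = 0" by simp
      then show "A \<in> null_sets (pos_part \<theta>)"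
        using A emeasure_pos_part[OF Mb] by (auto simp: null_sets_def)
    qed
    then have d: "density \<nu> (RN_deriv \<nu> (pos_part \<theta>)) = pos_part \<theta>"
      by (intro density_RN_deriv) simp_all
    let ?r = "RN_deriv \<nu> (pos_part \<theta>)"
    have em: "(\<integral>\<^sup>+x. ?r x * indicator A x \<partial>\<nu>) = upper_var \<theta> A" if "A \<in> sets borel" for A
      using emeasure_density[of ?r \<nu> A] d emeasure_pos_part[OF Mb that] that by simp
    have "(\<integral>\<^sup>+x. ?r x \<partial>\<nu>) \<noteq> \<infinity>" using em[of UNIV] upper_var_finite[OF Mb, of UNIV] by auto
    \<comment> \<open>Finite total mass makes the \<open>ennreal\<close>-valued derivative finite
      almost everywhere, so its real version has the same integrals.\<close>
    then have AE: "AE x in \<nu>. ?r x \<noteq> \<infinity>" by (intro nn_integral_PInf_AE) auto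
    have r: "(\<integral>\<^sup>+x. ennreal (enn2real (?r x) * indicator A x) \<partial>\<nu>) = upper_var \<theta> A" if "A \<in> sets borel" for A
      unfolding em[OF that, symmetric] using AE
      by (intro nn_integral_cong_AE) (auto split: split_indicator simp: less_top)
    have "integrable \<nu> (\<lambda>x. enn2real (?r x))"
      using r[of UNIV] upper_var_finite[OF Mb, of UNIV] by (intro integrableI_bounded) auto
    moreover have "enn2real (upper_var \<theta> A) = (LINT x:A|\<nu>. enn2real (?r x))" if A: "A \<in> sets borel" for A
      unfolding r[OF A, symmetric] set_lebesgue_integral_def using A
      by (subst integral_eq_nn_integral) (auto simp: mult.commute)
    ultimately show ?thesis by blast
  qed
  obtain h where h: "integrable \<nu> h" "\<forall>A\<in>sets borel. enn2real (upper_var \<eta> A) = (LINT x:A|\<nu>. h x)"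
    using ex[OF Mb(1) null] by blast
  obtain k where k: "integrable \<nu> k" "\<forall>A\<in>sets borel. enn2real (upper_var (\<lambda>A. - \<eta> A) A) = (LINT x:A|\<nu>. k x)"
    using ex[OF Mb(2)] null by auto
  show ?thesis
  proof (intro exI conjI ballI)
    show "integrable \<nu> (\<lambda>x. h x - k x)" using h k by simp
    fix A :: "real set" assume A: "A \<in> sets borel"
    have "(LINT x:A|\<nu>. h x - k x) = (LINT x:A|\<nu>. h x) - (LINT x:A|\<nu>. k x)"
      using A h k by (intro set_integral_diff) (auto simp: set_integrable_def intro!: integrable_indicator_times)
    then show "\<eta> A = (LINT x:A|\<nu>. h x - k x)"
      using upper_var_diff[OF Mb(1) A] h k A by simp
  qed
qed

text \<open>The Hahn decomposition is explicit: the supremum defining the upper variation of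
  \<open>A\<close> is attained at \<open>A \<inter> {x. 0 \<le> h x}\<close>.\<close>

lemma pos_part_density:
  assumes "sets \<nu> = sets borel" and h: "integrable \<nu> h" and \<eta>: "\<And>A. A \<in> sets borel \<Longrightarrow> \<eta> A = (LINT x:A|\<nu>. h x)"
  shows "pos_part \<eta> = density \<nu> (\<lambda>x. ennreal (h x))"
proof -
  have [simp]: "space \<nu> = UNIV" using sets_eq_imp_space_eq[OF assms(1)] by simp
  note [measurable_cong] = assms(1)
  have [measurable]: "h \<in> borel_measurable borel" using borel_measurable_integrable[OF h] by measurable
  have uv: "upper_var \<eta> A = emeasure (density \<nu> (\<lambda>x. ennreal (h x))) A" if A[measurable]: "A \<in> sets borel" for A
  proof -
    have *: "ennreal (\<eta> B) \<le> emeasure (density \<nu> (\<lambda>x. ennreal (h x))) B" if [measurable]: "B \<in> sets borel" for B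
    proof -
      have "\<eta> B \<le> (LINT x|\<nu>. max 0 (h x) * indicator B x)"
        unfolding \<eta>[OF that] set_lebesgue_integral_def
        using h by (intro integral_mono_AE) (auto split: split_indicator intro!: integrable_indicator_times integrable_real_mult_indicator)
      then have "ennreal (\<eta> B) \<le> ennreal (LINT x|\<nu>. max 0 (h x) * indicator B x)" by (rule ennreal_leI)
      also have "\<dots> = (\<integral>\<^sup>+x. ennreal (max 0 (h x) * indicator B x) \<partial>\<nu>)"
        using h by (intro nn_integral_eq_integral[symmetric] integrable_real_mult_indicator) auto
      also have "\<dots> = (\<integral>\<^sup>+x. ennreal (h x) * indicator B x \<partial>\<nu>)"
        by (intro nn_integral_cong) (auto split: split_indicator simp: max_def ennreal_neg)
      also have "\<dots> = emeasure (density \<nu> (\<lambda>x. ennreal (h x))) B"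
        by (rule emeasure_density[symmetric]) (use assms in measurable)
      finally show ?thesis .
    qed
    show ?thesis
    proof (rule antisym)
      show "upper_var \<eta> A \<le> emeasure (density \<nu> (\<lambda>x. ennreal (h x))) A"
        unfolding upper_var_def
      proof (rule SUP_least)
        fix B assume "B \<in> {B \<in> sets borel. B \<subseteq> A}"
        then show "ennreal (\<eta> B) \<le> emeasure (density \<nu> (\<lambda>x. ennreal (h x))) A"
          using *[of B] emeasure_mono[of B A "density \<nu> (\<lambda>x. ennreal (h x))"] A assms(1) by auto
      qed
      let ?B = "A \<inter> {x. 0 \<le> h x}"
      have [measurable]: "?B \<in> sets borel" by measurable
      have "emeasure (density \<nu> (\<lambda>x. ennreal (h x))) A = (\<integral>\<^sup>+x. ennreal (h x) * indicator A x \<partial>\<nu>)"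
        by (rule emeasure_density) (use assms in measurable)
      also have "\<dots> = (\<integral>\<^sup>+x. ennreal (indicator ?B x * h x) \<partial>\<nu>)"
        by (intro nn_integral_cong) (auto split: split_indicator simp: ennreal_neg)
      also have "\<dots> = ennreal (\<eta> ?B)"
        unfolding \<eta>[OF \<open>?B \<in> sets borel\<close>] set_lebesgue_integral_def
        using h by (subst nn_integral_eq_integral) (auto split: split_indicator intro!: integrable_indicator_times)
      also have "\<dots> \<le> upper_var \<eta> A" by (rule upper_var_upper) auto
      finally show "emeasure (density \<nu> (\<lambda>x. ennreal (h x))) A \<le> upper_var \<eta> A" .
    qed
  qed
  have "pos_part \<eta> = measure_of UNIV (sets borel) (emeasure (density \<nu> (\<lambda>x. ennreal (h x))))"
    unfolding pos_part_eq by (rule measure_of_eq) (auto simp: sets.sigma_sets_eq[of borel, simplified] uv)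
  also have "\<dots> = density \<nu> (\<lambda>x. ennreal (h x))"
    using measure_of_of_measure[of "density \<nu> (\<lambda>x. ennreal (h x))"] assms(1) by simp
  finally show ?thesis .
qed

text \<open>\<open>signed_integral\<close> is a difference of two integrals, each 0 by convention
  when it does not exist. Integrability of \<open>h x * g x\<close> gives integrability of
  \<open>g\<close> against both Jordan parts, so the difference recombines.\<close>

lemma signed_integral_eq:
  assumes "sets \<nu> = sets borel" and h: "integrable \<nu> h" and \<eta>: "\<And>A. A \<in> sets borel \<Longrightarrow> \<eta> A = (LINT x:A|\<nu>. h x)"
    and g[measurable]: "g \<in> borel_measurable borel" and pairing: "integrable \<nu> (\<lambda>x. h x * g x)"
  shows "signed_integral \<eta> g = (LINT x|\<nu>. h x * g x)"
proof -
  note [measurable_cong] = assms(1)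
  have [measurable]: "h \<in> borel_measurable borel" using borel_measurable_integrable[OF h] by measurable
  have "(LINT x|pos_part \<eta>. g x) = (LINT x|density \<nu> (\<lambda>x. ennreal (max 0 (h x))). g x)"
    by (subst pos_part_density[OF assms(1-3)]) (auto simp: ennreal_max_0)
  also have "\<dots> = (LINT x|\<nu>. max 0 (h x) * g x)"
    by (subst integral_density) auto
  finally have p: "(LINT x|pos_part \<eta>. g x) = (LINT x|\<nu>. max 0 (h x) * g x)" .
  have \<eta>': "- \<eta> A = (LINT x:A|\<nu>. - h x)" if "A \<in> sets borel" for A
  proof -
    have "integrable \<nu> (\<lambda>x. indicator A x * h x)" using assms(1) that h by (intro integrable_indicator_times) auto
    then show ?thesis unfolding \<eta>[OF that] set_lebesgue_integral_def by simp
  qed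
  have "(LINT x|neg_part \<eta>. g x) = (LINT x|density \<nu> (\<lambda>x. ennreal (max 0 (- h x))). g x)"
    unfolding neg_part_def
    using pos_part_density[OF assms(1) _ \<eta>'] h by (simp add: ennreal_max_0)
  also have "\<dots> = (LINT x|\<nu>. max 0 (- h x) * g x)"
    by (subst integral_density) auto
  finally have n: "(LINT x|neg_part \<eta>. g x) = (LINT x|\<nu>. max 0 (- h x) * g x)" .
  have "integrable \<nu> (\<lambda>x. max 0 (h x) * g x)" "integrable \<nu> (\<lambda>x. max 0 (- h x) * g x)"
    by (rule Bochner_Integration.integrable_bound[OF pairing]; auto simp: abs_mult intro!: mult_right_mono)+
  then have "signed_integral \<eta> g = (LINT x|\<nu>. max 0 (h x) * g x - max 0 (- h x) * g x)"
    by (simp add: signed_integral_def p n)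
  also have "\<dots> = (LINT x|\<nu>. h x * g x)"
    by (intro Bochner_Integration.integral_cong) (auto simp: max_def)
  finally show ?thesis .
qed

lemma density_in_Mb0:
  assumes "real_distribution \<nu>" and h: "integrable \<nu> h" and z: "(LINT x|\<nu>. h x) = 0"
  shows "(\<lambda>A. LINT x:A|\<nu>. h x) \<in> Mb0 \<nu>"
proof -
  interpret real_distribution \<nu> by fact
  have "(\<lambda>i. LINT x:A i|\<nu>. h x) sums (LINT x:(\<Union>i. A i)|\<nu>. h x)"
    if "range A \<subseteq> sets borel" "disjoint_family A" for A :: "nat \<Rightarrow> real set"
  proof -
    have Ai[measurable]: "A i \<in> sets borel" for i using that by auto
    have "(\<Sum>i<n. LINT x:A i|\<nu>. h x) = (LINT x|\<nu>. indicator (\<Union>i<n. A i) x * h x)" for n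
    proof -
      have "(\<Sum>i<n. LINT x:A i|\<nu>. h x) = (LINT x|\<nu>. (\<Sum>i<n. indicator (A i) x * h x))"
        unfolding set_lebesgue_integral_def using h Ai
        by (subst Bochner_Integration.integral_sum) (auto intro!: integrable_indicator_times)
      also have "(\<lambda>x. \<Sum>i<n. indicator (A i) x * h x) = (\<lambda>x. indicator (\<Union>i<n. A i) x * h x)"
        using that(2) by (auto simp: sum_distrib_right[symmetric] disjoint_family_on_def indicator_UN_disjoint)
      finally show ?thesis .
    qed
    moreover have "(\<lambda>n. LINT x|\<nu>. indicator (\<Union>i<n. A i) x * h x) \<longlonglongrightarrow> (LINT x|\<nu>. indicator (\<Union>i. A i) x * h x)"
    proof (rule integral_dominated_convergence)
      show "integrable \<nu> (\<lambda>x. \<bar>h x\<bar>)" using h by simp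
      show "AE x in \<nu>. (\<lambda>n. indicator (\<Union>i<n. A i) x * h x) \<longlonglongrightarrow> indicator (\<Union>i. A i) x * h x"
        by (intro AE_I2 tendsto_mult LIMSEQ_indicator_UN tendsto_const)
    qed (use h in \<open>auto split: split_indicator\<close>)
    ultimately show ?thesis by (simp add: sums_def set_lebesgue_integral_def)
  qed
  moreover have "total_variation (\<lambda>A. LINT x:A|\<nu>. h x) \<le> ennreal (LINT x|\<nu>. \<bar>h x\<bar>)"
    unfolding total_variation_def
  proof (rule SUP_least, clarify)
    fix \<P> :: "real set set" assume P: "finite \<P>" "disjoint \<P>" "\<P> \<subseteq> sets borel"
    have PS[measurable]: "A \<in> sets \<nu>" if "A \<in> \<P>" for A using P that by auto
    have "(\<Sum>A\<in>\<P>. \<bar>LINT x:A|\<nu>. h x\<bar>) \<le> (\<Sum>A\<in>\<P>. LINT x|\<nu>. indicator A x * \<bar>h x\<bar>)"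
    proof (rule sum_mono)
      fix A assume "A \<in> \<P>"
      have "\<bar>LINT x:A|\<nu>. h x\<bar> \<le> (LINT x|\<nu>. \<bar>indicator A x * h x\<bar>)"
        unfolding set_lebesgue_integral_def by (simp add: integral_abs_bound)
      then show "\<bar>LINT x:A|\<nu>. h x\<bar> \<le> (LINT x|\<nu>. indicator A x * \<bar>h x\<bar>)" by (simp add: abs_mult)
    qed
    also have "\<dots> = (LINT x|\<nu>. (\<Sum>A\<in>\<P>. indicator A x * \<bar>h x\<bar>))"
      using h PS by (subst Bochner_Integration.integral_sum) (auto intro!: integrable_indicator_times)
    also have "(\<lambda>x. \<Sum>A\<in>\<P>. indicator A x * \<bar>h x\<bar>) = (\<lambda>x. indicator (\<Union>A\<in>\<P>. A) x * \<bar>h x\<bar>)"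
      using P(1,2) by (subst indicator_UN_disjoint) (auto simp: sum_distrib_right[symmetric] disjoint_family_on_def disjoint_def)
    also have "(LINT x|\<nu>. indicator (\<Union>A\<in>\<P>. A) x * \<bar>h x\<bar>) \<le> (LINT x|\<nu>. \<bar>h x\<bar>)"
      using h P by (intro integral_mono integrable_indicator_times sets.finite_UN) (auto split: split_indicator)
    finally show "(\<Sum>A\<in>\<P>. ennreal \<bar>LINT x:A|\<nu>. h x\<bar>) \<le> ennreal (LINT x|\<nu>. \<bar>h x\<bar>)"
      by (simp add: ennreal_leI)
  qed
  moreover have "(LINT x:A|\<nu>. h x) = 0" if "A \<in> null_sets \<nu>" for A
    unfolding set_lebesgue_integral_def using AE_not_in[OF that]
    by (intro integral_eq_zero_AE) (auto elim!: eventually_mono)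
  ultimately show ?thesis
    using z unfolding Mb0_def Mb_def by (auto simp: le_less_trans set_lebesgue_integral_def)
qed

section \<open>The Freidlin--Wentzell form of the large deviation principle\<close>

lemma elog_mono: "x \<le> y \<Longrightarrow> elog x \<le> elog y"
proof (cases "x = 0 \<or> y = \<infinity>")
  case False
  assume "x \<le> y"
  with False have "x \<noteq> \<infinity>" "y \<noteq> \<infinity>" "x \<noteq> 0" "y \<noteq> 0" by (auto simp: top_unique)
  then show ?thesis
    using \<open>x \<le> y\<close> by (simp add: elog_def enn2real_mono less_top enn2real_positive_iff zero_less_iff_neq_zero)
qed (auto simp: elog_def)

lemma elog_exp: "elog (ennreal (exp t)) = ereal t"
  by (simp add: elog_def)

text \<open>Lower semicontinuity comes with compactness: in a Hausdorff space the compact sublevel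
  sets are closed.\<close>

lemma good_rate_functionI:
  assumes nn: "\<And>a. compactin (mtopology_of m) {x \<in> mspace m. I x \<le> ennreal a}"
  shows "good_rate_function m I"
proof -
  interpret Metric_space "mspace m" "mdist m" by (rule Metric_space_mspace_mdist)
  have comp: "compactin (mtopology_of m) {x \<in> mspace m. I x \<le> a}" if "a < \<infinity>" for a
    using nn[of "enn2real a"] that by simp
  have "openin (mtopology_of m) {x \<in> mspace m. a < I x}" for a
  proof (cases "a = \<infinity>")
    case False
    then have "closedin (mtopology_of m) {x \<in> mspace m. I x \<le> a}"
      using comp[of a] Hausdorff_space_mtopology
      by (intro compactin_imp_closedin) (auto simp: mtopology_of_def less_top)
    then have "openin (mtopology_of m) (topspace (mtopology_of m) - {x \<in> mspace m. I x \<le> a})"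
      by (simp add: closedin_def)
    also have "topspace (mtopology_of m) - {x \<in> mspace m. I x \<le> a} = {x \<in> mspace m. a < I x}"
      by (auto simp: mtopology_of_def)
    finally show ?thesis .
  qed simp
  with comp show ?thesis by (simp add: good_rate_function_def)
qed

text \<open>The Freidlin--Wentzell criterion. A level set below the infimum over the closure of
  \<open>A\<close> is compact and misses that closure, hence stays at a positive distance from it,
  and closeness to the level set excludes \<open>A\<close>. Conversely, a small ball around a point
  of the interior lies in \<open>A\<close>. The measurable events bound the outer and inner
  probabilities of sets that may be non-measurable.\<close>

lemma satisfies_LDPI:
  fixes P :: "nat \<Rightarrow> 'a measure" and Y :: "nat \<Rightarrow> 'a \<Rightarrow> 'b" and I :: "'b \<Rightarrow> ennreal"
  assumes ps: "\<And>n. n \<ge> 1 \<Longrightarrow> prob_space (P n)" and Y: "\<And>n. n \<ge> 1 \<Longrightarrow> Y n \<in> space (P n) \<rightarrow> mspace m"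
    and c: "\<And>n. n \<ge> 1 \<Longrightarrow> 0 < c n" "filterlim c at_top sequentially"
    and compact: "\<And>a. compactin (mtopology_of m) {x \<in> mspace m. I x \<le> ennreal a}"
    and upper: "\<And>a r e. 0 \<le> a \<Longrightarrow> 0 < r \<Longrightarrow> 0 < e \<Longrightarrow> \<forall>\<^sub>F n in sequentially. \<exists>E\<in>sets (P n).
        measure (P n) E \<le> exp (- (a - e) * c n) \<and>
        (\<forall>\<omega>\<in>space (P n) - E. \<exists>G\<in>mspace m. I G \<le> ennreal a \<and> mdist m (Y n \<omega>) G < r)"
    and lower: "\<And>G r e. G \<in> mspace m \<Longrightarrow> I G < \<infinity> \<Longrightarrow> 0 < r \<Longrightarrow> 0 < e \<Longrightarrow> \<forall>\<^sub>F n in sequentially. \<exists>E\<in>sets (P n).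
        exp (- (enn2real (I G) + e) * c n) \<le> measure (P n) E \<and>
        (\<forall>\<omega>\<in>E. mdist m (Y n \<omega>) G < r)"
  shows "satisfies_LDP P Y m c I"
proof -
  interpret Metric_space "mspace m" "mdist m" by (rule Metric_space_mspace_mdist)
  have top: "mtopology_of m = mtopology" by (simp add: mtopology_of_def)
  have lb: "- enn2ereal (INF x \<in> mtopology interior_of A. I x)
          \<le> liminf (\<lambda>n. ereal (1 / c n) * elog (inner_measure_of (P n) {\<omega> \<in> space (P n). Y n \<omega> \<in> A}))" (is "?a \<le> ?L") for A
  proof (rule ccontr)
    assume "\<not> ?a \<le> ?L"
    then have "?L < ?a" by simp
    then have less: "enn2ereal (INF x \<in> mtopology interior_of A. I x) < - ?L"
      by (subst (asm) ereal_less_uminus_reorder)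
    then have L0: "0 < - ?L" by (meson enn2ereal_nonneg order_le_less_trans)
    then have eL: "enn2ereal (e2ennreal (- ?L)) = - ?L" by (simp add: enn2ereal_e2ennreal)
    have "(INF x \<in> mtopology interior_of A. I x) < e2ennreal (- ?L)"
      unfolding less_ennreal.rep_eq eL by (rule less)
    then obtain G where G: "G \<in> mtopology interior_of A" "I G < e2ennreal (- ?L)"
      by (auto simp: INF_less_iff)
    have IG: "I G < \<infinity>" using G(2) by (rule order.strict_trans2) simp
    have "enn2ereal (I G) < - ?L" using G(2) unfolding less_ennreal.rep_eq eL .
    moreover have "enn2ereal (I G) = ereal (enn2real (I G))"
      using IG by (cases "I G") (auto simp: enn2ereal_ennreal)
    ultimately have "ereal (enn2real (I G)) < - ?L" by simp
    then have "?L < ereal (- enn2real (I G))"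
      by (subst (asm) ereal_less_uminus_reorder) simp
    \<comment> \<open>\<open>t\<close> lies strictly between the assumed liminf and
      \<open>- I G\<close>; its gap to \<open>- I G\<close> serves as the error \<open>e\<close> in
      \<open>lower\<close>.\<close>
    then obtain t where t: "?L < ereal t" "ereal t < ereal (- enn2real (I G))"
      using ereal_dense2 by blast
    then have e: "0 < - enn2real (I G) - t" by simp
    have e_eq: "- (enn2real (I G) + (- enn2real (I G) - t)) = t" by simp
    have GM: "G \<in> mspace m" using G(1) interior_of_subset_topspace[of mtopology A] by auto
    have "openin mtopology (mtopology interior_of A)" by simp
    then obtain r where r: "0 < r" "mball G r \<subseteq> mtopology interior_of A"
      using G(1) unfolding openin_mtopology by blast
    have sub: "mball G r \<subseteq> A" using r(2) interior_of_subset by (rule subset_trans)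
    have "ereal t \<le> ?L"
    proof (rule Liminf_bounded)
      show "\<forall>\<^sub>F n in sequentially. ereal t \<le> ereal (1 / c n) * elog (inner_measure_of (P n) {\<omega> \<in> space (P n). Y n \<omega> \<in> A})"
        using lower[OF GM IG r(1) e] eventually_ge_at_top[of 1]
      proof eventually_elim
        case (elim n)
        then obtain E where E: "E \<in> sets (P n)" "exp (t * c n) \<le> measure (P n) E" "\<And>\<omega>. \<omega> \<in> E \<Longrightarrow> mdist m (Y n \<omega>) G < r"
          unfolding e_eq by blast
        interpret prob_space "P n" using ps elim by simp
        have cn: "0 < c n" using c elim by simp
        have "E \<subseteq> {\<omega> \<in> space (P n). Y n \<omega> \<in> A}"
        proof
          fix \<omega> assume "\<omega> \<in> E"
          then have "\<omega> \<in> space (P n)" using sets.sets_into_space[OF E(1)] by auto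
          then have "Y n \<omega> \<in> mball G r" using E(3)[OF \<open>\<omega> \<in> E\<close>] Y elim GM by (auto simp: commute)
          then show "\<omega> \<in> {\<omega> \<in> space (P n). Y n \<omega> \<in> A}" using sub \<open>\<omega> \<in> space (P n)\<close> by auto
        qed
        then have "emeasure (P n) E \<le> inner_measure_of (P n) {\<omega> \<in> space (P n). Y n \<omega> \<in> A}"
          unfolding inner_measure_of_def using E(1) by (intro SUP_upper) auto
        moreover have "ennreal (exp (t * c n)) \<le> emeasure (P n) E"
          using E(2) by (simp add: emeasure_eq_measure)
        ultimately have "ereal (t * c n) \<le> elog (inner_measure_of (P n) {\<omega> \<in> space (P n). Y n \<omega> \<in> A})"
          unfolding elog_exp[symmetric] by (intro elog_mono) (rule order_trans)
        then have "ereal (1 / c n) * ereal (t * c n) \<le> ereal (1 / c n) * elog (inner_measure_of (P n) {\<omega> \<in> space (P n). Y n \<omega> \<in> A})"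
          using cn by (intro ereal_mult_left_mono) auto
        then show ?case using cn by simp
      qed
    qed
    with t show False by simp
  qed
  have ub: "limsup (\<lambda>n. ereal (1 / c n) * elog (outer_measure_of (P n) {\<omega> \<in> space (P n). Y n \<omega> \<in> A}))
          \<le> - enn2ereal (INF x \<in> mtopology closure_of A. I x)" (is "?L \<le> - enn2ereal ?a")
    if AM: "A \<subseteq> mspace m" for A
  proof (rule ccontr)
    assume "\<not> ?L \<le> - enn2ereal ?a"
    then have "- enn2ereal ?a < ?L" by simp
    then obtain t where t: "- enn2ereal ?a < ereal t" "ereal t < ?L" using ereal_dense2 by blast
    show False
    proof (cases "0 \<le> t")
      case True
      \<comment> \<open>For a nonnegative threshold the bound 1 on probabilities suffices; level
        sets are used only for negative \<open>t\<close>.\<close>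
      have "?L \<le> ereal 0"
      proof (rule Limsup_bounded)
        show "\<forall>\<^sub>F n in sequentially. ereal (1 / c n) * elog (outer_measure_of (P n) {\<omega> \<in> space (P n). Y n \<omega> \<in> A}) \<le> ereal 0"
          using eventually_ge_at_top[of 1]
        proof eventually_elim
          case (elim n)
          interpret prob_space "P n" using ps elim by simp
          have "outer_measure_of (P n) {\<omega> \<in> space (P n). Y n \<omega> \<in> A} \<le> ennreal (exp 0)"
            unfolding outer_measure_of_def by (rule INF_lower2[of "space (P n)"]) (auto simp: emeasure_space_1)
          then have "elog (outer_measure_of (P n) {\<omega> \<in> space (P n). Y n \<omega> \<in> A}) \<le> ereal 0"
            unfolding elog_exp[symmetric] by (rule elog_mono)
          moreover have "0 \<le> ereal (1 / c n)" using c elim by (simp add: less_imp_le)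
          ultimately show ?case
            by (metis ereal_mult_left_mono ereal_zero_times mult.commute zero_ereal_def)
        qed
      qed
      then have "?L \<le> ereal t" using True by (meson ereal_less_eq(3) order_trans)
      with t show False by simp
    next
      case False
      \<comment> \<open>A second intermediate number: \<open>a = - s\<close> is still below the
        infimum, and the gap \<open>t - s\<close> is the loss allowed in \<open>upper\<close>, so
        that the resulting exponent is exactly \<open>t\<close>.\<close>
      obtain s where s: "- enn2ereal ?a < ereal s" "ereal s < ereal t" using t(1) ereal_dense2 by blast
      define a where "a = - s"
      have t_eq: "- (a - (t - s)) = t" by (simp add: a_def)
      have a: "0 \<le> a" "0 < t - s" using False s by (auto simp: a_def)
      have lt: "ennreal a < ?a"
      proof -
        have "- ereal s < enn2ereal ?a" using s(1) by (subst ereal_uminus_less_reorder)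
        then have "ereal a < enn2ereal ?a" by (simp add: a_def)
        then show ?thesis unfolding less_ennreal.rep_eq enn2ereal_ennreal[OF a(1)] .
      qed
      let ?K = "{x \<in> mspace m. I x \<le> ennreal a}"
      have "openin mtopology (mspace m - mtopology closure_of A)"
        using closedin_closure_of[of mtopology A] by (simp add: closedin_def)
      moreover have "?K \<subseteq> \<Union>{mspace m - mtopology closure_of A}"
      proof clarsimp
        fix x assume "x \<in> mspace m" "I x \<le> ennreal a" "x \<in> mtopology closure_of A"
        then show False using lt by (metis INF_lower leD order_trans)
      qed
      \<comment> \<open>A Lebesgue number for the cover of the compact level set by a single open
        set is a uniform distance to the closure of \<open>A\<close>.\<close>
      ultimately obtain r where r: "0 < r" "\<And>x. x \<in> ?K \<Longrightarrow> mball x r \<subseteq> mspace m - mtopology closure_of A"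
        using lebesgue_number[of ?K "{mspace m - mtopology closure_of A}"] compact[of a] top by auto
      have "?L \<le> ereal t"
      proof (rule Limsup_bounded)
        show "\<forall>\<^sub>F n in sequentially. ereal (1 / c n) * elog (outer_measure_of (P n) {\<omega> \<in> space (P n). Y n \<omega> \<in> A}) \<le> ereal t"
          using upper[OF a(1) r(1) a(2)] eventually_ge_at_top[of 1]
        proof eventually_elim
          case (elim n)
          then obtain E where E: "E \<in> sets (P n)" "measure (P n) E \<le> exp (t * c n)"
            "\<And>\<omega>. \<omega> \<in> space (P n) - E \<Longrightarrow> \<exists>G\<in>mspace m. I G \<le> ennreal a \<and> mdist m (Y n \<omega>) G < r"
            unfolding t_eq by blast
          interpret prob_space "P n" using ps elim by simp
          have cn: "0 < c n" using c elim by simp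
          have "{\<omega> \<in> space (P n). Y n \<omega> \<in> A} \<subseteq> E"
          proof (rule ccontr)
            assume "\<not> ?thesis"
            then obtain \<omega> where \<omega>: "\<omega> \<in> space (P n) - E" "Y n \<omega> \<in> A" by auto
            then obtain G where G: "G \<in> ?K" "mdist m (Y n \<omega>) G < r" using E(3) by blast
            then have "Y n \<omega> \<in> mball G r" using \<omega> AM by (auto simp: commute)
            then have "Y n \<omega> \<notin> mtopology closure_of A" using r(2)[OF G(1)] by auto
            moreover have "A \<subseteq> mtopology closure_of A" using AM by (intro closure_of_subset) simp
            ultimately show False using \<omega> by auto
          qed
          then have "outer_measure_of (P n) {\<omega> \<in> space (P n). Y n \<omega> \<in> A} \<le> emeasure (P n) E"
            unfolding outer_measure_of_def using E(1) by (intro INF_lower) auto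
          also have "\<dots> \<le> ennreal (exp (t * c n))"
            using E(2) by (simp add: emeasure_eq_measure ennreal_leI)
          finally have "elog (outer_measure_of (P n) {\<omega> \<in> space (P n). Y n \<omega> \<in> A}) \<le> ereal (t * c n)"
            unfolding elog_exp[symmetric] by (rule elog_mono)
          then have "ereal (1 / c n) * elog (outer_measure_of (P n) {\<omega> \<in> space (P n). Y n \<omega> \<in> A}) \<le> ereal (1 / c n) * ereal (t * c n)"
            using cn by (intro ereal_mult_left_mono) auto
          then show ?case using cn by simp
        qed
      qed
      with t show False by simp
    qed
  qed
  have "A \<subseteq> mspace m" if "A \<in> borel_sets_of m" for A
  proof -
    have "U \<subseteq> mspace m" if "openin mtopology U" for U using openin_subset[OF that] by simp
    then have "{U. openin (mtopology_of m) U} \<subseteq> Pow (mspace m)" by (auto simp: top)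
    from sigma_sets_into_sp[OF this] that show ?thesis by (auto simp: borel_sets_of_def)
  qed
  then show ?thesis
    unfolding satisfies_LDP_def using ps Y c good_rate_functionI[OF compact] lb ub top by auto
qed

section \<open>Exponential moments of weighted sums\<close>

text \<open>This bound and the next are Taylor's formula with Lagrange remainder. The factor
  \<open>exp \<bar>x\<bar>\<close> is affordable because \<open>w\<close> has all exponential
  moments.\<close>

lemma exp_le_quadratic: "exp x \<le> 1 + x + x\<^sup>2 * exp \<bar>x\<bar>" for x :: real
proof -
  obtain t where t: "\<bar>t\<bar> \<le> \<bar>x\<bar>" "exp x = (\<Sum>m<2. x ^ m / fact m) + exp t / fact 2 * x\<^sup>2"
    using Maclaurin_exp_le[of x 2] by blast
  have "exp t \<le> exp \<bar>x\<bar>" using t(1) by simp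
  then have "exp t / 2 \<le> exp \<bar>x\<bar>" using exp_gt_zero[of t] by linarith
  then have "exp t / 2 * x\<^sup>2 \<le> exp \<bar>x\<bar> * x\<^sup>2" by (intro mult_right_mono) auto
  then show ?thesis using t(2) by (simp add: numeral_2_eq_2 lessThan_Suc algebra_simps)
qed

lemma exp_Taylor2: "\<bar>exp x - 1 - x - x\<^sup>2 / 2\<bar> \<le> \<bar>x\<bar> ^ 3 * exp \<bar>x\<bar>" for x :: real
proof -
  obtain t where t: "\<bar>t\<bar> \<le> \<bar>x\<bar>" "exp x = (\<Sum>m<3. x ^ m / fact m) + exp t / fact 3 * x ^ 3"
    using Maclaurin_exp_le[of x 3] by blast
  have "exp t \<le> exp \<bar>x\<bar>" using t(1) by simp
  then have "exp t / 6 \<le> exp \<bar>x\<bar>" using exp_gt_zero[of t] by linarith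
  then have "exp t / 6 * \<bar>x\<bar> ^ 3 \<le> exp \<bar>x\<bar> * \<bar>x\<bar> ^ 3" by (intro mult_right_mono) auto
  moreover have "exp x - 1 - x - x\<^sup>2 / 2 = exp t / 6 * x ^ 3"
    using t(2) by (simp add: numeral_3_eq_3 lessThan_Suc power2_eq_square)
  moreover have "\<bar>exp t / 6 * x ^ 3\<bar> = exp t / 6 * \<bar>x\<bar> ^ 3" by (simp add: abs_mult power_abs)
  ultimately show ?thesis by (metis mult.commute)
qed

text \<open>The analysis of the tail process depends only on \<open>\<nu>\<close> and the weight;
  \<open>\<mu>\<close> and its density \<open>f\<close> appear in
  \<open>quantile_sample\<close>.\<close>

locale weighted_sample = prob_space M + nu: real_distribution \<nu> for M :: "'a measure" and \<nu> +
  fixes w :: "real \<Rightarrow> real" and X :: "nat \<Rightarrow> 'a \<Rightarrow> real" and lam :: "nat \<Rightarrow> real"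
  assumes w_measurable [measurable]: "w \<in> borel_measurable borel" and w_nonneg: "0 \<le> w x"
    and indep_X: "indep_vars (\<lambda>_. borel) X {1..}"
    and distr_X: "i \<ge> 1 \<Longrightarrow> distr M borel (X i) = \<nu>"
    and lam_pos: "n \<ge> 1 \<Longrightarrow> 0 < lam n"
    and lam_at_top: "filterlim lam at_top sequentially"
    and lam_smallo: "lam \<in> o(\<lambda>n. sqrt (real n))"
    and exp_w: "0 < c \<Longrightarrow> integrable \<nu> (\<lambda>x. exp (c * w x))"
begin

text \<open>A vector space of test functions with all exponential moments, containing the constants,
  the bounded Borel functions and the restrictions of \<open>w\<close> to Borel sets.\<close>

definition lin_growth :: "(real \<Rightarrow> real) \<Rightarrow> bool" where
  "lin_growth \<psi> \<longleftrightarrow> \<psi> \<in> borel_measurable borel \<and> (\<exists>C\<ge>0. \<forall>x. \<bar>\<psi> x\<bar> \<le> C * (1 + w x))"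

definition mean :: "(real \<Rightarrow> real) \<Rightarrow> real" where "mean \<psi> = (LINT x|\<nu>. \<psi> x)"

definition var :: "(real \<Rightarrow> real) \<Rightarrow> real" where "var \<psi> = (LINT x|\<nu>. (\<psi> x - mean \<psi>)\<^sup>2)"

definition S :: "nat \<Rightarrow> (real \<Rightarrow> real) \<Rightarrow> 'a \<Rightarrow> real" where
  "S n \<psi> \<omega> = (\<Sum>i=1..n. \<psi> (X i \<omega>) - mean \<psi>) / (sqrt n * lam n)"

text \<open>The tilt per observation: \<open>(lam n)\<^sup>2 * S n \<psi>\<close> is
  \<open>\<theta> n\<close> times a sum of centred terms. Since \<open>\<theta> n\<close> tends to
  0, only variances enter the rate.\<close>

definition \<theta> :: "nat \<Rightarrow> real" where "\<theta> n = lam n / sqrt n"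

lemma theta_pos: "n \<ge> 1 \<Longrightarrow> 0 < \<theta> n" using lam_pos by (simp add: \<theta>_def)

lemma theta_lim: "\<theta> \<longlonglongrightarrow> 0"
  using smalloD_tendsto[OF lam_smallo] by (simp add: \<theta>_def[abs_def])

lemma n_theta_sq: "n \<ge> 1 \<Longrightarrow> n * (\<theta> n)\<^sup>2 = (lam n)\<^sup>2"
  by (simp add: \<theta>_def power_divide)

lemma lam_sq_S: "n \<ge> 1 \<Longrightarrow> (lam n)\<^sup>2 * S n \<psi> \<omega> = \<theta> n * (\<Sum>i=1..n. \<psi> (X i \<omega>) - mean \<psi>)"
  using lam_pos[of n] by (simp add: S_def \<theta>_def power2_eq_square field_simps)

lemma X_measurable [measurable]: "i \<ge> 1 \<Longrightarrow> X i \<in> borel_measurable M"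
  using indep_X by (auto simp: indep_vars_def)

lemma lin_growth_measurable: "lin_growth \<psi> \<Longrightarrow> \<psi> \<in> borel_measurable borel"
  by (simp add: lin_growth_def)

lemma S_measurable [measurable]: "\<psi> \<in> borel_measurable borel \<Longrightarrow> S n \<psi> \<in> borel_measurable M"
proof -
  assume [measurable]: "\<psi> \<in> borel_measurable borel"
  have "(\<lambda>\<omega>. \<psi> (X i \<omega>) - mean \<psi>) \<in> borel_measurable M" if "i \<in> {1..n}" for i
    using that by (intro borel_measurable_diff measurable_compose[OF X_measurable]) auto
  then show ?thesis unfolding S_def[abs_def] by (intro borel_measurable_divide borel_measurable_sum) auto
qed

lemma integrable_exp_dominated:
  assumes [measurable]: "g \<in> borel_measurable borel" and "0 < c" "\<And>x. \<bar>g x\<bar> \<le> K * exp (c * w x)"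
  shows "integrable \<nu> g"
  by (rule Bochner_Integration.integrable_bound[OF integrable_mult_right[OF exp_w[OF \<open>0 < c\<close>], of K]])
    (use assms in \<open>auto intro!: AE_I2 order_trans[OF assms(3)]\<close>)

lemma lin_growth_integrable_exp:
  assumes "lin_growth \<psi>"
  shows "integrable \<nu> (\<lambda>x. \<bar>\<psi> x\<bar> ^ k * exp (c * \<bar>\<psi> x\<bar>))"
proof -
  obtain C where C: "0 \<le> C" "\<And>x. \<bar>\<psi> x\<bar> \<le> C * (1 + w x)" and [measurable]: "\<psi> \<in> borel_measurable borel"
    using assms by (auto simp: lin_growth_def)
  have *: "\<bar>\<psi> x\<bar> \<le> C * exp (w x)" for x
    using C(2)[of x] exp_ge_add_one_self[of "w x"] C(1) by (meson mult_left_mono order_trans)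
  show ?thesis
  proof (rule integrable_exp_dominated)
    \<comment> \<open>The summand 1 keeps the exponent positive when \<open>k\<close> and
      \<open>c\<close> are both 0.\<close>
    show "0 < k + \<bar>c\<bar> * C + 1" using C by (simp add: add_nonneg_pos)
    fix x
    have "c * \<bar>\<psi> x\<bar> \<le> \<bar>c\<bar> * (C * (1 + w x))"
      using C(2)[of x] by (intro mult_mono) auto
    then have "\<bar>\<psi> x\<bar> ^ k * exp (c * \<bar>\<psi> x\<bar>) \<le> (C * exp (w x)) ^ k * exp (\<bar>c\<bar> * (C * (1 + w x)))"
      using C(2)[of x] *[of x] C(1) by (intro mult_mono power_mono) (auto intro!: mult_left_mono)
    also have "\<dots> = C ^ k * exp (\<bar>c\<bar> * C) * exp ((k + \<bar>c\<bar> * C) * w x)"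
      by (simp add: power_mult_distrib exp_of_nat_mult[symmetric] algebra_simps exp_add[symmetric])
    also have "\<dots> \<le> C ^ k * exp (\<bar>c\<bar> * C) * exp ((k + \<bar>c\<bar> * C + 1) * w x)"
      using C w_nonneg[of x] by (intro mult_left_mono) (auto simp: algebra_simps)
    finally show "\<bar>\<bar>\<psi> x\<bar> ^ k * exp (c * \<bar>\<psi> x\<bar>)\<bar> \<le> C ^ k * exp (\<bar>c\<bar> * C) * exp ((k + \<bar>c\<bar> * C + 1) * w x)"
      by simp
  qed measurable
qed

lemma lin_growth_integrable: "lin_growth \<psi> \<Longrightarrow> integrable \<nu> \<psi>"
  using lin_growth_integrable_exp[of \<psi> 1 0] by (subst integrable_abs_iff[symmetric]) (auto simp: lin_growth_def)

lemma lin_growth_integrable_sq: "lin_growth \<psi> \<Longrightarrow> integrable \<nu> (\<lambda>x. (\<psi> x)\<^sup>2)"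
  using lin_growth_integrable_exp[of \<psi> 2 0] by simp

lemma lin_growth_lincomb:
  assumes "lin_growth \<psi>" "lin_growth \<phi>"
  shows "lin_growth (\<lambda>x. a * \<psi> x + b * \<phi> x)"
proof -
  obtain C D where C: "0 \<le> C" "\<And>x. \<bar>\<psi> x\<bar> \<le> C * (1 + w x)" and D: "0 \<le> D" "\<And>x. \<bar>\<phi> x\<bar> \<le> D * (1 + w x)"
    and [measurable]: "\<psi> \<in> borel_measurable borel" "\<phi> \<in> borel_measurable borel"
    using assms by (auto simp: lin_growth_def)
  have "\<bar>a * \<psi> x + b * \<phi> x\<bar> \<le> (\<bar>a\<bar> * C + \<bar>b\<bar> * D) * (1 + w x)" for x
  proof -
    have "\<bar>a * \<psi> x + b * \<phi> x\<bar> \<le> \<bar>a\<bar> * \<bar>\<psi> x\<bar> + \<bar>b\<bar> * \<bar>\<phi> x\<bar>"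
      by (metis abs_mult abs_triangle_ineq)
    also have "\<dots> \<le> \<bar>a\<bar> * (C * (1 + w x)) + \<bar>b\<bar> * (D * (1 + w x))"
      using C D by (intro add_mono mult_left_mono) auto
    finally show ?thesis by (simp add: algebra_simps)
  qed
  then show ?thesis using C D
    unfolding lin_growth_def by (intro conjI exI[of _ "\<bar>a\<bar> * C + \<bar>b\<bar> * D"]) auto
qed

lemma lin_growth_const: "lin_growth (\<lambda>_. c)"
  unfolding lin_growth_def using w_nonneg
  by (intro conjI exI[of _ "\<bar>c\<bar>"]) (auto simp: mult_le_cancel_left1)

lemma lin_growth_w: "A \<in> sets borel \<Longrightarrow> lin_growth (\<lambda>x. w x * indicator A x)"
  unfolding lin_growth_def using w_nonneg
  by (intro conjI exI[of _ 1]) (auto split: split_indicator)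

lemma lin_growth_bounded:
  assumes "\<psi> \<in> borel_measurable borel" "\<And>x. \<bar>\<psi> x\<bar> \<le> C"
  shows "lin_growth \<psi>"
proof -
  have "0 \<le> C" using assms(2)[of 0] by linarith
  moreover have "C \<le> C * (1 + w x)" for x using \<open>0 \<le> C\<close> w_nonneg[of x] by (simp add: algebra_simps)
  ultimately show ?thesis using assms unfolding lin_growth_def by (meson order_trans)
qed

lemma lin_growth_sum: "(\<And>i. i \<in> I \<Longrightarrow> lin_growth (\<psi> i)) \<Longrightarrow> lin_growth (\<lambda>x. \<Sum>i\<in>I. c i * \<psi> i x)"
proof (induction I rule: infinite_finite_induct)
  case (insert i I)
  then show ?case using lin_growth_lincomb[of "\<psi> i" "\<lambda>x. \<Sum>i\<in>I. c i * \<psi> i x" "c i" 1] by simp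
qed (use lin_growth_const[of 0] in auto)

lemma S_lincomb:
  assumes "integrable \<nu> \<psi>" "integrable \<nu> \<phi>"
  shows "S n (\<lambda>x. a * \<psi> x + b * \<phi> x) \<omega> = a * S n \<psi> \<omega> + b * S n \<phi> \<omega>"
proof -
  have "mean (\<lambda>x. a * \<psi> x + b * \<phi> x) = a * mean \<psi> + b * mean \<phi>"
    using assms by (simp add: mean_def)
  then show ?thesis
    by (simp add: S_def sum_subtractf sum.distrib sum_distrib_left[symmetric] add_divide_distrib diff_divide_distrib algebra_simps)
qed

lemma S_const: "S n (\<lambda>_. c) \<omega> = 0"
  by (simp add: S_def mean_def nu.prob_space[simplified])

lemma S_sum:
  assumes "\<And>i. i \<in> I \<Longrightarrow> integrable \<nu> (\<psi> i)"
  shows "S n (\<lambda>x. \<Sum>i\<in>I. c i * \<psi> i x) \<omega> = (\<Sum>i\<in>I. c i * S n (\<psi> i) \<omega>)"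
  using assms
proof (induction I rule: infinite_finite_induct)
  case (insert i I)
  then show ?case using S_lincomb[of "\<psi> i" "\<lambda>x. \<Sum>i\<in>I. c i * \<psi> i x" n "c i" 1 \<omega>] by simp
qed (use S_const[of n 0] in auto)

lemma exp_sum_iid:
  fixes \<phi> :: "real \<Rightarrow> real"
  assumes [measurable]: "\<phi> \<in> borel_measurable borel" and int: "integrable \<nu> (\<lambda>x. exp (\<phi> x))"
  shows "integrable M (\<lambda>\<omega>. exp (\<Sum>i=1..n. \<phi> (X i \<omega>)))"
    and "expectation (\<lambda>\<omega>. exp (\<Sum>i=1..n. \<phi> (X i \<omega>))) = (LINT x|\<nu>. exp (\<phi> x)) ^ n"
proof -
  have ind: "indep_vars (\<lambda>_. borel) (\<lambda>i \<omega>. exp (\<phi> (X i \<omega>))) {1..n}"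
    by (rule indep_vars_compose2[where X = X and Y = "\<lambda>_ x. exp (\<phi> x)", OF indep_vars_subset[OF indep_X]])
      (auto intro!: borel_measurable_exp assms(1))
  have int_i: "integrable M (\<lambda>\<omega>. exp (\<phi> (X i \<omega>)))"
    and eq: "expectation (\<lambda>\<omega>. exp (\<phi> (X i \<omega>))) = (LINT x|\<nu>. exp (\<phi> x))" if "i \<in> {1..n}" for i
  proof -
    have [measurable]: "X i \<in> borel_measurable M" using that by auto
    have d: "distr M borel (X i) = \<nu>" using distr_X that by auto
    show "integrable M (\<lambda>\<omega>. exp (\<phi> (X i \<omega>)))"
      using int unfolding d[symmetric] by (subst (asm) integrable_distr_eq) auto
    show "expectation (\<lambda>\<omega>. exp (\<phi> (X i \<omega>))) = (LINT x|\<nu>. exp (\<phi> x))"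
      unfolding d[symmetric] by (subst integral_distr) auto
  qed
  have e: "exp (\<Sum>i=1..n. \<phi> (X i \<omega>)) = (\<Prod>i=1..n. exp (\<phi> (X i \<omega>)))" for \<omega> by (simp add: exp_sum)
  show "integrable M (\<lambda>\<omega>. exp (\<Sum>i=1..n. \<phi> (X i \<omega>)))"
    unfolding e using ind int_i by (intro indep_vars_integrable) auto
  show "expectation (\<lambda>\<omega>. exp (\<Sum>i=1..n. \<phi> (X i \<omega>))) = (LINT x|\<nu>. exp (\<phi> x)) ^ n"
    unfolding e using ind int_i by (subst indep_vars_lebesgue_integral) (auto simp: eq)
qed

lemma lin_growth_center: "lin_growth \<psi> \<Longrightarrow> lin_growth (\<lambda>x. \<psi> x - mean \<psi>)"
  using lin_growth_lincomb[of \<psi> "\<lambda>_. mean \<psi>" 1 "-1"] lin_growth_const by simp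

lemma lin_growth_exp: "lin_growth \<psi> \<Longrightarrow> integrable \<nu> (\<lambda>x. exp (\<psi> x))"
  by (rule Bochner_Integration.integrable_bound[OF lin_growth_integrable_exp[of \<psi> 0 1]]) (auto simp: lin_growth_def)

lemma exp_S:
  assumes "lin_growth \<psi>" "n \<ge> 1"
  shows "integrable M (\<lambda>\<omega>. exp ((lam n)\<^sup>2 * S n \<psi> \<omega>))"
    and "expectation (\<lambda>\<omega>. exp ((lam n)\<^sup>2 * S n \<psi> \<omega>)) = (LINT x|\<nu>. exp (\<theta> n * (\<psi> x - mean \<psi>))) ^ n"
proof -
  have m: "(\<lambda>x. \<theta> n * (\<psi> x - mean \<psi>)) \<in> borel_measurable borel"
    using assms by (auto simp: lin_growth_def)
  have i: "integrable \<nu> (\<lambda>x. exp (\<theta> n * (\<psi> x - mean \<psi>)))"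
    using lin_growth_exp[OF lin_growth_lincomb[OF lin_growth_center[OF assms(1)] lin_growth_const, of "\<theta> n" 0]] by simp
  note * = exp_sum_iid[OF m i, of n]
  show "integrable M (\<lambda>\<omega>. exp ((lam n)\<^sup>2 * S n \<psi> \<omega>))"
    "expectation (\<lambda>\<omega>. exp ((lam n)\<^sup>2 * S n \<psi> \<omega>)) = (LINT x|\<nu>. exp (\<theta> n * (\<psi> x - mean \<psi>))) ^ n"
    using * by (simp_all add: lam_sq_S[OF assms(2)] sum_distrib_left)
qed

lemma mean_center: "integrable \<nu> \<psi> \<Longrightarrow> (LINT x|\<nu>. \<psi> x - mean \<psi>) = 0"
  by (simp add: mean_def nu.prob_space[simplified])

text \<open>Let \<open>m n\<close> be the exponential moment of one centred term. It is
  \<open>1 + (\<theta> n)\<^sup>2 * var \<psi> / 2\<close> up to order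
  \<open>(\<theta> n) ^ 3\<close>, so \<open>ln (m n) / (\<theta> n)\<^sup>2\<close> tends to
  \<open>var \<psi> / 2\<close>, and the \<open>n\<close>-th power turns
  \<open>n * (\<theta> n)\<^sup>2\<close> into \<open>(lam n)\<^sup>2\<close>.\<close>

lemma exp_S_asymp:
  assumes \<psi>: "lin_growth \<psi>" and e: "0 < e"
  shows "\<forall>\<^sub>F n in sequentially. exp ((lam n)\<^sup>2 * (var \<psi> / 2 - e)) \<le> expectation (\<lambda>\<omega>. exp ((lam n)\<^sup>2 * S n \<psi> \<omega>))
     \<and> expectation (\<lambda>\<omega>. exp ((lam n)\<^sup>2 * S n \<psi> \<omega>)) \<le> exp ((lam n)\<^sup>2 * (var \<psi> / 2 + e))"
proof -
  define g where "g x = \<psi> x - mean \<psi>" for x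
  have g: "lin_growth g" unfolding g_def using \<psi> by (rule lin_growth_center)
  have mg: "(LINT x|\<nu>. g x) = 0" unfolding g_def using \<psi> by (intro mean_center lin_growth_integrable)
  define K where "K = (LINT x|\<nu>. \<bar>g x\<bar> ^ 3 * exp (1 * \<bar>g x\<bar>))"
  define m where "m n = (LINT x|\<nu>. exp (\<theta> n * g x))" for n
  have gexp: "integrable \<nu> (\<lambda>x. exp (t * g x))" for t
    using lin_growth_exp[OF lin_growth_lincomb[OF g lin_growth_const, of t 0]] by simp
  have K: "\<bar>m n - 1 - (\<theta> n)\<^sup>2 * (var \<psi> / 2)\<bar> \<le> (\<theta> n) ^ 3 * K" if n: "n \<ge> 1" "\<theta> n \<le> 1" for n
  proof -
    have th: "0 < \<theta> n" using theta_pos n by simp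
    have "m n - 1 - (\<theta> n)\<^sup>2 * (var \<psi> / 2) = (LINT x|\<nu>. exp (\<theta> n * g x) - 1 - \<theta> n * g x - (\<theta> n * g x)\<^sup>2 / 2)"
      using lin_growth_integrable[OF g] lin_growth_integrable_sq[OF g] gexp[of "\<theta> n"]
      by (simp add: m_def mg var_def g_def[symmetric] power_mult_distrib nu.prob_space[simplified])
    also have "\<bar>\<dots>\<bar> \<le> (LINT x|\<nu>. (\<theta> n) ^ 3 * (\<bar>g x\<bar> ^ 3 * exp (1 * \<bar>g x\<bar>)))"
    proof (rule order_trans[OF integral_abs_bound], rule integral_mono)
      show "integrable \<nu> (\<lambda>x. \<bar>exp (\<theta> n * g x) - 1 - \<theta> n * g x - (\<theta> n * g x)\<^sup>2 / 2\<bar>)"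
        using lin_growth_integrable[OF g] lin_growth_integrable_sq[OF g] gexp[of "\<theta> n"]
        by (simp add: power_mult_distrib)
      show "integrable \<nu> (\<lambda>x. (\<theta> n) ^ 3 * (\<bar>g x\<bar> ^ 3 * exp (1 * \<bar>g x\<bar>)))"
        using lin_growth_integrable_exp[OF g, of 3 1] by simp
      fix x
      have "\<bar>\<theta> n * g x\<bar> ^ 3 * exp \<bar>\<theta> n * g x\<bar> \<le> \<bar>\<theta> n * g x\<bar> ^ 3 * exp (1 * \<bar>g x\<bar>)"
        using th n by (intro mult_left_mono) (auto simp: abs_mult intro!: mult_left_le_one_le)
      also have "\<dots> = (\<theta> n) ^ 3 * (\<bar>g x\<bar> ^ 3 * exp (1 * \<bar>g x\<bar>))"
        using th by (simp add: abs_mult power_mult_distrib)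
      finally show "\<bar>exp (\<theta> n * g x) - 1 - \<theta> n * g x - (\<theta> n * g x)\<^sup>2 / 2\<bar> \<le> (\<theta> n) ^ 3 * (\<bar>g x\<bar> ^ 3 * exp (1 * \<bar>g x\<bar>))"
        using exp_Taylor2[of "\<theta> n * g x"] by linarith
    qed
    also have "\<dots> = (\<theta> n) ^ 3 * K" by (simp add: K_def)
    finally show ?thesis .
  qed
  have evn: "\<forall>\<^sub>F n in sequentially. n \<ge> 1 \<and> \<theta> n \<le> 1"
    using eventually_ge_at_top[of 1] order_tendstoD(2)[OF theta_lim zero_less_one]
    by eventually_elim auto
  have lim1: "(\<lambda>n. (m n - 1) / (\<theta> n)\<^sup>2) \<longlonglongrightarrow> var \<psi> / 2"
  proof (rule LIM_zero_cancel, rule Lim_null_comparison)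
    show "\<forall>\<^sub>F n in sequentially. norm ((m n - 1) / (\<theta> n)\<^sup>2 - var \<psi> / 2) \<le> \<theta> n * K"
      using evn
    proof eventually_elim
      case (elim n)
      then have th: "0 < \<theta> n" using theta_pos by simp
      have "norm ((m n - 1) / (\<theta> n)\<^sup>2 - var \<psi> / 2) = \<bar>m n - 1 - (\<theta> n)\<^sup>2 * (var \<psi> / 2)\<bar> / (\<theta> n)\<^sup>2"
      proof -
        have "(m n - 1) / (\<theta> n)\<^sup>2 - var \<psi> / 2 = (m n - 1 - (\<theta> n)\<^sup>2 * (var \<psi> / 2)) / (\<theta> n)\<^sup>2"
          using th by (simp add: field_simps)
        then show ?thesis by (simp add: abs_divide)
      qed
      also have "\<dots> \<le> (\<theta> n) ^ 3 * K / (\<theta> n)\<^sup>2" using K[of n] elim by (intro divide_right_mono) auto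
      also have "\<dots> = \<theta> n * K" using th by (simp add: power2_eq_square power3_eq_cube)
      finally show ?case .
    qed
    show "(\<lambda>n. \<theta> n * K) \<longlonglongrightarrow> 0" using tendsto_mult_left_zero[OF theta_lim] by simp
  qed
  have lim2: "(\<lambda>n. m n - 1) \<longlonglongrightarrow> 0"
  proof -
    have "(\<lambda>n. (m n - 1) / (\<theta> n)\<^sup>2 * (\<theta> n)\<^sup>2) \<longlonglongrightarrow> var \<psi> / 2 * 0\<^sup>2"
      by (intro tendsto_intros lim1 theta_lim)
    then have "(\<lambda>n. (m n - 1) / (\<theta> n)\<^sup>2 * (\<theta> n)\<^sup>2) \<longlonglongrightarrow> 0" by simp
    then show ?thesis
    proof (rule Lim_transform_eventually)
      show "\<forall>\<^sub>F n in sequentially. (m n - 1) / (\<theta> n)\<^sup>2 * (\<theta> n)\<^sup>2 = m n - 1"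
        using evn by eventually_elim (use theta_pos in \<open>auto simp: less_imp_neq[symmetric]\<close>)
    qed
  qed
  have lim3: "(\<lambda>n. ln (m n) / (\<theta> n)\<^sup>2) \<longlonglongrightarrow> var \<psi> / 2"
  proof -
    \<comment> \<open>From \<open>\<bar>ln (1 + x) - x\<bar> \<le> 2 * x\<^sup>2\<close> with
      \<open>x = m n - 1\<close>: after division by \<open>(\<theta> n)\<^sup>2\<close> one factor
      \<open>x\<close> converges and the other tends to 0.\<close>
    have "(\<lambda>n. ln (m n) / (\<theta> n)\<^sup>2 - (m n - 1) / (\<theta> n)\<^sup>2) \<longlonglongrightarrow> 0"
    proof (rule Lim_null_comparison)
      have "\<forall>\<^sub>F n in sequentially. \<bar>m n - 1\<bar> < 1/2"
        using order_tendstoD(2)[OF tendsto_rabs_zero[OF lim2], of "1/2"] by simp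
      with evn show "\<forall>\<^sub>F n in sequentially. norm (ln (m n) / (\<theta> n)\<^sup>2 - (m n - 1) / (\<theta> n)\<^sup>2) \<le> 2 * ((m n - 1) / (\<theta> n)\<^sup>2 * (m n - 1))"
      proof eventually_elim
        case (elim n)
        have "\<bar>ln (1 + (m n - 1)) - (m n - 1)\<bar> \<le> 2 * (m n - 1)\<^sup>2"
          using elim by (intro abs_ln_one_plus_x_minus_x_bound) auto
        then have "\<bar>ln (m n) - (m n - 1)\<bar> / (\<theta> n)\<^sup>2 \<le> 2 * (m n - 1)\<^sup>2 / (\<theta> n)\<^sup>2"
          by (intro divide_right_mono) auto
        then show ?case by (simp add: diff_divide_distrib[symmetric] power2_eq_square)
      qed
      show "(\<lambda>n. 2 * ((m n - 1) / (\<theta> n)\<^sup>2 * (m n - 1))) \<longlonglongrightarrow> 0"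
        using tendsto_mult[OF tendsto_const[of 2] tendsto_mult[OF lim1 lim2]] by simp
    qed
    from tendsto_add[OF this lim1] show ?thesis by simp
  qed
  have "\<forall>\<^sub>F n in sequentially. \<bar>m n - 1\<bar> < 1/2"
    using order_tendstoD(2)[OF tendsto_rabs_zero[OF lim2], of "1/2"] by simp
  moreover have "\<forall>\<^sub>F n in sequentially. var \<psi> / 2 - e < ln (m n) / (\<theta> n)\<^sup>2"
    using e by (intro order_tendstoD(1)[OF lim3]) simp
  moreover have "\<forall>\<^sub>F n in sequentially. ln (m n) / (\<theta> n)\<^sup>2 < var \<psi> / 2 + e"
    using e by (intro order_tendstoD(2)[OF lim3]) simp
  ultimately show ?thesis
    using evn
  proof eventually_elim
    case (elim n)
    then have n: "n \<ge> 1" and mp: "0 < m n" and th: "0 < \<theta> n" using theta_pos by (auto simp: abs_if split: if_splits)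
    have "expectation (\<lambda>\<omega>. exp ((lam n)\<^sup>2 * S n \<psi> \<omega>)) = m n ^ n"
      using exp_S(2)[OF \<psi> n] by (simp add: m_def g_def)
    also have "\<dots> = exp ((lam n)\<^sup>2 * (ln (m n) / (\<theta> n)\<^sup>2))"
      using mp th by (simp add: n_theta_sq[OF n, symmetric] exp_of_nat_mult)
    finally have eq: "expectation (\<lambda>\<omega>. exp ((lam n)\<^sup>2 * S n \<psi> \<omega>)) = exp ((lam n)\<^sup>2 * (ln (m n) / (\<theta> n)\<^sup>2))" .
    show ?case unfolding eq exp_le_cancel_iff using elim by (intro conjI mult_left_mono) auto
  qed
qed

text \<open>A Bernstein-type bound for each single \<open>n\<close>, as chaining requires, because
  the number of its levels grows with \<open>n\<close>. For \<open>\<bar>t\<bar> \<le> 1\<close> the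
  quadratic bound on \<open>exp\<close> gives a centred moment of at most
  \<open>exp (t\<^sup>2 * V)\<close>; the condition \<open>\<kappa> * \<theta> n \<le> 1\<close> is
  this restriction for the tilt of one summand. The factor 2 accounts for the two signs.\<close>

lemma S_tail_bound:
  assumes A: "A \<in> sets borel" and V: "(LINT x|\<nu>. (w x)\<^sup>2 * exp (w x) * indicator A x) \<le> V"
    and n: "n \<ge> 1" and \<kappa>: "0 < \<kappa>" "\<kappa> * \<theta> n \<le> 1"
  shows "prob {\<omega>\<in>space M. x \<le> \<bar>S n (\<lambda>x. w x * indicator A x) \<omega>\<bar>} \<le> 2 * exp (- (lam n)\<^sup>2 * (\<kappa> * x - \<kappa>\<^sup>2 * V))"
proof -
  define g where "g x = w x * indicator A x" for x
  have g: "lin_growth g" unfolding g_def using A by (rule lin_growth_w)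
  note [measurable] = lin_growth_measurable[OF g]
  have th: "0 < \<theta> n" using theta_pos n by simp
  have g0: "0 \<le> g x" for x using w_nonneg by (simp add: g_def)
  have gV: "(LINT x|\<nu>. (g x)\<^sup>2 * exp (g x)) \<le> V"
  proof -
    have "(LINT x|\<nu>. (g x)\<^sup>2 * exp (g x)) = (LINT x|\<nu>. (w x)\<^sup>2 * exp (w x) * indicator A x)"
      by (intro Bochner_Integration.integral_cong) (auto simp: g_def split: split_indicator)
    with V show ?thesis by simp
  qed
  have ig: "integrable \<nu> (\<lambda>x. (g x)\<^sup>2 * exp (g x))"
    using lin_growth_integrable_exp[OF g, of 2 1] g0 by simp
  have mgf: "(LINT x|\<nu>. exp (t * (g x - mean g))) \<le> exp (t\<^sup>2 * V)" if t: "\<bar>t\<bar> \<le> 1" for t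
  proof -
    have ge: "integrable \<nu> (\<lambda>x. exp (t * g x))"
      using lin_growth_exp[OF lin_growth_lincomb[OF g lin_growth_const, of t 0]] by simp
    have "(LINT x|\<nu>. exp (t * g x)) \<le> (LINT x|\<nu>. 1 + t * g x + t\<^sup>2 * ((g x)\<^sup>2 * exp (g x)))"
    proof (rule integral_mono[OF ge])
      show "integrable \<nu> (\<lambda>x. 1 + t * g x + t\<^sup>2 * ((g x)\<^sup>2 * exp (g x)))"
        using lin_growth_integrable[OF g] ig by simp
      fix x
      have "exp (t * g x) \<le> 1 + t * g x + (t * g x)\<^sup>2 * exp \<bar>t * g x\<bar>" by (rule exp_le_quadratic)
      also have "\<dots> \<le> 1 + t * g x + (t * g x)\<^sup>2 * exp (g x)"
        using t g0[of x] by (intro add_left_mono mult_left_mono) (auto simp: abs_mult intro!: mult_left_le_one_le)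
      finally show "exp (t * g x) \<le> 1 + t * g x + t\<^sup>2 * ((g x)\<^sup>2 * exp (g x))"
        by (simp add: power_mult_distrib)
    qed
    also have "\<dots> = 1 + (t * mean g + t\<^sup>2 * (LINT x|\<nu>. (g x)\<^sup>2 * exp (g x)))"
      using lin_growth_integrable[OF g] ig by (simp add: mean_def nu.prob_space[simplified])
    also have "\<dots> \<le> 1 + (t * mean g + t\<^sup>2 * V)" using gV by (intro add_left_mono mult_left_mono) auto
    also have "\<dots> \<le> exp (t * mean g + t\<^sup>2 * V)" by (rule exp_ge_add_one_self)
    finally have "(LINT x|\<nu>. exp (t * g x)) * exp (- t * mean g) \<le> exp (t * mean g + t\<^sup>2 * V) * exp (- t * mean g)"
      by (intro mult_right_mono) auto
    also have "(LINT x|\<nu>. exp (t * g x)) * exp (- t * mean g) = (LINT x|\<nu>. exp (t * g x) * exp (- t * mean g))"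
      by simp
    also have "\<dots> = (LINT x|\<nu>. exp (t * (g x - mean g)))"
      by (simp only: exp_add[symmetric]) (simp add: algebra_simps)
    finally show ?thesis by (simp add: exp_add[symmetric])
  qed
  have one: "prob {\<omega>\<in>space M. x \<le> s * S n g \<omega>} \<le> exp (- (lam n)\<^sup>2 * (\<kappa> * x - \<kappa>\<^sup>2 * V))" if s: "\<bar>s\<bar> = 1" for s
  proof -
    define h where "h x = \<kappa> * s * g x" for x
    have h: "lin_growth h" using lin_growth_lincomb[OF g lin_growth_const, of "\<kappa> * s" 0] by (simp add: h_def[abs_def])
    have Sh: "S n h \<omega> = \<kappa> * s * S n g \<omega>" for \<omega>
      using S_lincomb[of g "\<lambda>_. 0" n "\<kappa> * s" 0 \<omega>] lin_growth_integrable[OF g] by (simp add: h_def[abs_def])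
    have mh: "mean h = \<kappa> * s * mean g" by (simp add: mean_def h_def[abs_def])
    have "expectation (\<lambda>\<omega>. exp ((lam n)\<^sup>2 * S n h \<omega>)) = (LINT x|\<nu>. exp (\<theta> n * \<kappa> * s * (g x - mean g))) ^ n"
      using exp_S(2)[OF h n] unfolding mh by (simp add: h_def algebra_simps)
    also have "\<dots> \<le> exp ((\<theta> n * \<kappa> * s)\<^sup>2 * V) ^ n"
      using th \<kappa> s by (intro power_mono mgf) (auto simp: abs_mult mult.commute)
    also have "\<dots> = exp ((lam n)\<^sup>2 * (\<kappa>\<^sup>2 * V))"
    proof -
      have "s\<^sup>2 = 1" using s by (metis power2_abs power_one)
      then show ?thesis by (simp add: n_theta_sq[OF n, symmetric] exp_of_nat_mult[symmetric] power_mult_distrib)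
    qed
    finally have E: "expectation (\<lambda>\<omega>. exp ((lam n)\<^sup>2 * S n h \<omega>)) \<le> exp ((lam n)\<^sup>2 * (\<kappa>\<^sup>2 * V))" .
    have lam0: "0 < (lam n)\<^sup>2" using lam_pos[OF n] by simp
    have "{\<omega>\<in>space M. x \<le> s * S n g \<omega>} \<subseteq> {\<omega>\<in>space M. exp ((lam n)\<^sup>2 * (\<kappa> * x)) \<le> exp ((lam n)\<^sup>2 * S n h \<omega>)}"
      using lam0 \<kappa> by (auto simp: Sh mult.assoc)
    then have "prob {\<omega>\<in>space M. x \<le> s * S n g \<omega>} \<le> prob {\<omega>\<in>space M. exp ((lam n)\<^sup>2 * (\<kappa> * x)) \<le> exp ((lam n)\<^sup>2 * S n h \<omega>)}"
      using lin_growth_measurable[OF h] by (intro finite_measure_mono) auto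
    also have "\<dots> \<le> expectation (\<lambda>\<omega>. exp ((lam n)\<^sup>2 * S n h \<omega>)) / exp ((lam n)\<^sup>2 * (\<kappa> * x))"
      using exp_S(1)[OF h n] by (intro integral_Markov_inequality_measure[where A = "{}"]) auto
    also have "\<dots> \<le> exp ((lam n)\<^sup>2 * (\<kappa>\<^sup>2 * V)) / exp ((lam n)\<^sup>2 * (\<kappa> * x))"
      using E by (intro divide_right_mono) auto
    also have "\<dots> = exp (- (lam n)\<^sup>2 * (\<kappa> * x - \<kappa>\<^sup>2 * V))"
      by (simp add: exp_diff[symmetric] algebra_simps)
    finally show ?thesis .
  qed
  have "{\<omega>\<in>space M. x \<le> \<bar>S n g \<omega>\<bar>} = {\<omega>\<in>space M. x \<le> 1 * S n g \<omega>} \<union> {\<omega>\<in>space M. x \<le> (-1) * S n g \<omega>}"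
    by (auto simp: abs_if)
  then have "prob {\<omega>\<in>space M. x \<le> \<bar>S n g \<omega>\<bar>} \<le> prob {\<omega>\<in>space M. x \<le> 1 * S n g \<omega>} + prob {\<omega>\<in>space M. x \<le> (-1) * S n g \<omega>}"
    by (simp add: measure_Un_le del: mult_1 mult_minus_left)
  with one[of 1] one[of "-1"] have "prob {\<omega>\<in>space M. x \<le> \<bar>S n g \<omega>\<bar>} \<le> 2 * exp (- (lam n)\<^sup>2 * (\<kappa> * x - \<kappa>\<^sup>2 * V))"
    by simp
  then show ?thesis by (simp add: g_def[abs_def])
qed

end

section \<open>Chaining for the tail process\<close>

text \<open>By induction on the depth: an even index belongs to the coarser grid, and an odd one is
  a single finest step away from its even predecessor. Each level is used at most once.\<close>

lemma dyadic_chain: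
  fixes z :: "nat \<Rightarrow> real"
  assumes "\<And>k j. k \<le> m \<Longrightarrow> j < 2 ^ k \<Longrightarrow> \<bar>z (Suc j * 2 ^ (m - k)) - z (j * 2 ^ (m - k))\<bar> \<le> e k"
    and e: "\<And>k. 0 \<le> e k" and "i \<le> 2 ^ m"
  shows "\<bar>z i - z 0\<bar> \<le> (\<Sum>k\<le>m. e k)"
  using assms(1,3)
proof (induction m arbitrary: z i)
  case 0
  then show ?case using "0.prems"(1)[of 0 0] e[of 0] by (cases "i = 0") (auto simp: le_Suc_eq)
next
  case (Suc m)
  have even: "\<bar>z (2 * i) - z (2 * 0)\<bar> \<le> (\<Sum>k\<le>m. e k)" if "i \<le> 2 ^ m" for i
  proof (rule Suc.IH[where z = "\<lambda>i. z (2 * i)", OF _ that])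
    fix k j :: nat assume "k \<le> m" "j < 2 ^ k"
    then show "\<bar>z (2 * (Suc j * 2 ^ (m - k))) - z (2 * (j * 2 ^ (m - k)))\<bar> \<le> e k"
      using Suc.prems(1)[of k j] by (simp add: Suc_diff_le algebra_simps)
  qed
  show ?case
  proof (cases "even i")
    case True
    then obtain i' where "i = 2 * i'" by blast
    then show ?thesis using even[of i'] Suc.prems(2) e[of "Suc m"] by simp
  next
    case False
    then obtain i' where i': "i = Suc (2 * i')" using oddE by fastforce
    then have "2 * i' < 2 ^ Suc m" using Suc.prems(2) by simp
    then have "\<bar>z i - z (2 * i')\<bar> \<le> e (Suc m)"
      using Suc.prems(1)[of "Suc m" "2 * i'"] i' by simp
    moreover have "\<bar>z (2 * i') - z 0\<bar> \<le> (\<Sum>k\<le>m. e k)"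
      using even[of i'] \<open>2 * i' < 2 ^ Suc m\<close> by simp
    ultimately show ?thesis by simp
  qed
qed

text \<open>Level \<open>k\<close> contributes \<open>2 ^ k\<close> events. Bernoulli's inequality
  makes the exponents at least \<open>B + k * B / 8\<close>, and \<open>24 \<le> B\<close> gives
  \<open>exp (B / 8) \<ge> 4\<close>, so the terms are dominated by a geometric series of ratio
  1/2.\<close>

lemma sum_dyadic_exp_bound:
  fixes B :: real
  assumes "24 \<le> B"
  shows "(\<Sum>k\<le>m. 2 ^ k * (2 * exp (- B * (9/8) ^ k))) \<le> 4 * exp (- B)"
proof -
  have e: "2 * exp (- B / 8) \<le> 1 / 2"
  proof -
    have "4 \<le> exp (B / 8)" using exp_ge_add_one_self[of "B / 8"] assms by linarith
    then show ?thesis by (simp add: exp_minus field_simps)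
  qed
  have "(\<Sum>k\<le>m. 2 ^ k * (2 * exp (- B * (9/8) ^ k))) \<le> (\<Sum>k\<le>m. 2 * exp (- B) * (1/2) ^ k)"
  proof (rule sum_mono)
    fix k
    have "1 + real k * (1/8) \<le> (1 + 1/8) ^ k" by (rule Bernoulli_inequality) simp
    then have "B * (1 + real k * (1/8)) \<le> B * (9/8) ^ k" using assms by (intro mult_left_mono) auto
    then have "exp (- B * (9/8) ^ k) \<le> exp (- B + real k * (- B / 8))" by (simp add: algebra_simps)
    also have "\<dots> = exp (- B) * exp (- B / 8) ^ k" by (simp only: exp_add exp_of_nat_mult)
    finally have "2 ^ k * (2 * exp (- B * (9/8) ^ k)) \<le> 2 ^ k * (2 * (exp (- B) * exp (- B / 8) ^ k))"
      by (intro mult_left_mono) auto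
    also have "\<dots> = 2 * exp (- B) * (2 * exp (- B / 8)) ^ k" by (simp add: power_mult_distrib)
    also have "\<dots> \<le> 2 * exp (- B) * (1/2) ^ k" using e by (intro mult_left_mono power_mono) auto
    finally show "2 ^ k * (2 * exp (- B * (9/8) ^ k)) \<le> 2 * exp (- B) * (1/2) ^ k" .
  qed
  also have "\<dots> = 2 * exp (- B) * (\<Sum>k\<le>m. (1/2) ^ k)" by (simp add: sum_distrib_left)
  also have "(\<Sum>k\<le>m. (1/2 :: real) ^ k) \<le> 2"
    using sum_gp_multiplied[of 0 m "1/2 :: real"] by (simp add: atMost_atLeast0)
  finally show ?thesis by simp
qed

context weighted_sample
begin

text \<open>The exceptional set is part of the definition because \<open>P n\<close> need not be measurable.\<close>

definition likely :: "real \<Rightarrow> (nat \<Rightarrow> 'a \<Rightarrow> bool) \<Rightarrow> bool" where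
  "likely K P \<longleftrightarrow> (\<forall>\<^sub>F n in sequentially. \<exists>E\<in>events. prob E \<le> exp (- K * (lam n)\<^sup>2) \<and> (\<forall>\<omega>\<in>space M - E. P n \<omega>))"

lemma lam_sq_at_top: "filterlim (\<lambda>n. (lam n)\<^sup>2) at_top sequentially"
  using filterlim_pow_at_top[OF _ lam_at_top, of 2] by simp

lemma eventually_lam_sq_ge: "\<forall>\<^sub>F n in sequentially. c \<le> (lam n)\<^sup>2"
  using lam_sq_at_top unfolding filterlim_at_top by blast

lemma likely_mono:
  assumes "likely K P" "\<forall>\<^sub>F n in sequentially. \<forall>\<omega>\<in>space M. P n \<omega> \<longrightarrow> Q n \<omega>"
  shows "likely K Q"
  using assms unfolding likely_def by eventually_elim blast

lemma likely_mono_rate: "likely K P \<Longrightarrow> K' \<le> K \<Longrightarrow> likely K' P"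
  unfolding likely_def
  by (erule eventually_mono) (meson exp_le_cancel_iff mult_right_mono neg_le_iff_le order_trans zero_le_power2)

lemma eventually_card_le_exp:
  assumes "0 < e"
  shows "\<forall>\<^sub>F n in sequentially. real N \<le> exp (e * (lam n)\<^sup>2)"
  using eventually_lam_sq_ge[of "real N / e"]
proof eventually_elim
  case (elim n)
  then have "real N \<le> e * (lam n)\<^sup>2" using assms by (simp add: field_simps)
  then show ?case using exp_ge_add_one_self[of "e * (lam n)\<^sup>2"] by linarith
qed

text \<open>The union bound: the surplus rate \<open>e\<close> absorbs the number of events, which
  is fixed as \<open>n\<close> grows.\<close>

lemma likely_ball:
  assumes fin: "finite I" and e: "0 < e" and P: "\<And>i. i \<in> I \<Longrightarrow> likely (K + e) (P i)"
  shows "likely K (\<lambda>n \<omega>. \<forall>i\<in>I. P i n \<omega>)"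
proof -
  have "\<forall>\<^sub>F n in sequentially. \<forall>i\<in>I. \<exists>E\<in>events. prob E \<le> exp (- (K + e) * (lam n)\<^sup>2) \<and> (\<forall>\<omega>\<in>space M - E. P i n \<omega>)"
    using P fin by (intro eventually_ball_finite) (auto simp: likely_def)
  then show ?thesis
    unfolding likely_def using eventually_card_le_exp[OF e, of "card I"]
  proof eventually_elim
    case (elim n)
    then obtain E where E: "\<And>i. i \<in> I \<Longrightarrow> E i \<in> events" "\<And>i. i \<in> I \<Longrightarrow> prob (E i) \<le> exp (- (K + e) * (lam n)\<^sup>2)"
      "\<And>i \<omega>. i \<in> I \<Longrightarrow> \<omega> \<in> space M - E i \<Longrightarrow> P i n \<omega>" by metis
    show ?case
    proof (intro bexI[of _ "\<Union>i\<in>I. E i"] conjI)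
      have "prob (\<Union>i\<in>I. E i) \<le> (\<Sum>i\<in>I. prob (E i))" using E fin by (intro measure_UNION_le) auto
      also have "\<dots> \<le> card I * exp (- (K + e) * (lam n)\<^sup>2)" using E(2) sum_bounded_above[of I "\<lambda>i. prob (E i)"] by simp
      also have "\<dots> \<le> exp (e * (lam n)\<^sup>2) * exp (- (K + e) * (lam n)\<^sup>2)" using elim by (intro mult_right_mono) auto
      also have "\<dots> = exp (- K * (lam n)\<^sup>2)" by (simp add: exp_add[symmetric] algebra_simps)
      finally show "prob (\<Union>i\<in>I. E i) \<le> exp (- K * (lam n)\<^sup>2)" .
    qed (use E fin in auto)
  qed
qed

lemma likely_conj:
  assumes "0 < e" "likely (K + e) P" "likely (K + e) Q"
  shows "likely K (\<lambda>n \<omega>. P n \<omega> \<and> Q n \<omega>)"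
  using likely_ball[of "{0, 1::nat}" e K "\<lambda>i. if i = 0 then P else Q"] assms by simp

section \<open>The tail process: increments and bracketing\<close>

definition Z :: "nat \<Rightarrow> real \<Rightarrow> 'a \<Rightarrow> real" where
  "Z n t = S n (\<lambda>x. w x * indicator {t<..} x)"

definition Tw :: "real \<Rightarrow> real" where
  "Tw t = mean (\<lambda>x. w x * indicator {t<..} x)"

definition Tn :: "nat \<Rightarrow> real \<Rightarrow> 'a \<Rightarrow> real" where
  "Tn n t \<omega> = (\<Sum>i=1..n. w (X i \<omega>) * indicator {t<..} (X i \<omega>)) / n"

definition scale :: "nat \<Rightarrow> real" where "scale n = sqrt n / lam n"

lemma scale_eq: "scale n = 1 / \<theta> n" by (simp add: scale_def \<theta>_def)

lemma scale_pos: "n \<ge> 1 \<Longrightarrow> 0 < scale n" using theta_pos by (simp add: scale_eq)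

lemma scale_at_top: "filterlim scale at_top sequentially"
proof -
  have "filterlim (\<lambda>n. inverse (\<theta> n)) at_top sequentially"
    using theta_lim by (rule filterlim_inverse_at_top) (auto intro: eventually_mono[OF eventually_ge_at_top[of 1]] theta_pos)
  then show ?thesis by (simp add: scale_eq[abs_def] inverse_eq_divide)
qed

lemma eventually_scale_ge: "\<forall>\<^sub>F n in sequentially. c \<le> scale n"
  using scale_at_top unfolding filterlim_at_top by blast

lemma Z_eq: "n \<ge> 1 \<Longrightarrow> Z n t \<omega> = scale n * (Tn n t \<omega> - Tw t)"
  using lam_pos[of n]
  by (simp add: Z_def S_def scale_def Tn_def Tw_def sum_subtractf field_simps power2_eq_square)
     (simp add: mult.assoc[symmetric])

lemma Tn_antimono: "s \<le> t \<Longrightarrow> Tn n t \<omega> \<le> Tn n s \<omega>"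
  unfolding Tn_def using w_nonneg
  by (intro divide_right_mono sum_mono mult_left_mono) (auto split: split_indicator)

lemma Tw_antimono: "s \<le> t \<Longrightarrow> Tw t \<le> Tw s"
  unfolding Tw_def mean_def using w_nonneg lin_growth_integrable[OF lin_growth_w]
  by (intro integral_mono) (auto split: split_indicator)

lemma Z_diff:
  assumes "s \<le> t"
  shows "Z n s \<omega> - Z n t \<omega> = S n (\<lambda>x. w x * indicator {s<..t} x) \<omega>"
proof -
  have "(\<lambda>x. w x * indicator {s<..t} x) = (\<lambda>x. 1 * (w x * indicator {s<..} x) + (-1) * (w x * indicator {t<..} x))"
    using assms by (auto split: split_indicator)
  then show ?thesis
    using S_lincomb[of "\<lambda>x. w x * indicator {s<..} x" "\<lambda>x. w x * indicator {t<..} x" n 1 "-1" \<omega>]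
    by (simp add: Z_def lin_growth_integrable lin_growth_w)
qed

text \<open>The empirical and the true tail are both non-increasing, so at every sample point the
  values of \<open>Z\<close> inside a cell are controlled by those at its ends, up to
  \<open>scale n\<close> times the drop of \<open>Tw\<close>.\<close>

lemma Z_bracket:
  assumes "n \<ge> 1" "s \<le> t" "t \<le> u"
  shows "Z n t \<omega> \<le> Z n s \<omega> + scale n * (Tw s - Tw u)" "Z n u \<omega> - scale n * (Tw s - Tw u) \<le> Z n t \<omega>"
proof -
  have "scale n * (Tn n t \<omega> - Tw t) \<le> scale n * (Tn n s \<omega> - Tw u)"
    using assms scale_pos[of n] Tn_antimono[of s t n \<omega>] Tw_antimono[of t u] by (intro mult_left_mono) auto
  then show "Z n t \<omega> \<le> Z n s \<omega> + scale n * (Tw s - Tw u)" using assms by (simp add: Z_eq algebra_simps)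
  have "scale n * (Tn n u \<omega> - Tw s) \<le> scale n * (Tn n t \<omega> - Tw t)"
    using assms scale_pos[of n] Tn_antimono[of t u n \<omega>] Tw_antimono[of s t] by (intro mult_left_mono) auto
  then show "Z n u \<omega> - scale n * (Tw s - Tw u) \<le> Z n t \<omega>" using assms by (simp add: Z_eq algebra_simps)
qed

text \<open>
  The density dominates both \<open>w\<close> and the variance proxy of the Bernstein bound, so that one measure controls the
  bracketing error and the increments.
\<close>

definition D :: "real measure" where "D = density \<nu> (\<lambda>x. ennreal (w x + (w x)\<^sup>2 * exp (w x)))"

lemma integrable_D: "integrable \<nu> (\<lambda>x. w x + (w x)\<^sup>2 * exp (w x))"
  using lin_growth_integrable[OF lin_growth_w[of UNIV]] lin_growth_integrable_exp[OF lin_growth_w[of UNIV], of 2 1] w_nonneg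
  by simp

lemma emeasure_D:
  assumes A: "A \<in> sets borel"
  shows "emeasure D A = ennreal (LINT x|\<nu>. (w x + (w x)\<^sup>2 * exp (w x)) * indicator A x)"
proof -
  have "emeasure D A = (\<integral>\<^sup>+x. ennreal ((w x + (w x)\<^sup>2 * exp (w x)) * indicator A x) \<partial>\<nu>)"
    unfolding D_def using A by (subst emeasure_density) (auto intro!: nn_integral_cong split: split_indicator)
  also have "\<dots> = ennreal (LINT x|\<nu>. (w x + (w x)\<^sup>2 * exp (w x)) * indicator A x)"
    using w_nonneg A by (intro nn_integral_eq_integral integrable_real_mult_indicator integrable_D) auto
  finally show ?thesis .
qed

lemma measure_D: "A \<in> sets borel \<Longrightarrow> measure D A = (LINT x|\<nu>. (w x + (w x)\<^sup>2 * exp (w x)) * indicator A x)"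
  using w_nonneg by (subst measure_def) (auto simp: emeasure_D intro!: enn2real_ennreal integral_nonneg_AE)

lemma finite_borel_measure_D: "finite_borel_measure D"
proof (intro finite_borel_measure.intro finite_borel_measure_axioms.intro finite_measureI)
  have "space D = UNIV" by (simp add: D_def)
  then show "emeasure D (space D) \<noteq> \<infinity>" by (simp add: emeasure_D)
qed (simp add: D_def)

text \<open>The clock of the chaining. The summand \<open>t\<close> makes it strictly increasing, so
  that points are determined by their \<open>Q\<close>-values even where \<open>D\<close> has no
  mass.\<close>

definition Q :: "real \<Rightarrow> real" where "Q t = cdf D t + t"

lemma measure_D_le: "s \<le> t \<Longrightarrow> measure D {s<..t} \<le> Q t - Q s"
  using finite_borel_measure.cdf_diff_eq[OF finite_borel_measure_D, of s t] by (cases "s = t") (auto simp: Q_def)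

lemma Q_strict_mono: "s < t \<Longrightarrow> Q s < Q t"
  using finite_borel_measure.cdf_nondecreasing[OF finite_borel_measure_D, of s t] by (simp add: Q_def)

lemma Tw_diff_le:
  assumes "s \<le> t"
  shows "Tw s - Tw t \<le> Q t - Q s"
proof -
  have "Tw s - Tw t = (LINT x|\<nu>. w x * indicator {s<..} x - w x * indicator {t<..} x)"
    unfolding Tw_def mean_def by (subst Bochner_Integration.integral_diff) (auto intro!: lin_growth_integrable lin_growth_w)
  also have "\<dots> \<le> (LINT x|\<nu>. (w x + (w x)\<^sup>2 * exp (w x)) * indicator {s<..t} x)"
    using assms w_nonneg
    by (intro integral_mono Bochner_Integration.integrable_diff lin_growth_integrable lin_growth_w integrable_real_mult_indicator integrable_D)
      (auto split: split_indicator)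
  also have "\<dots> \<le> Q t - Q s" using measure_D_le[OF assms] by (simp add: measure_D)
  finally show ?thesis .
qed

lemma variance_proxy_le:
  assumes "s \<le> t"
  shows "(LINT x|\<nu>. (w x)\<^sup>2 * exp (w x) * indicator {s<..t} x) \<le> Q t - Q s"
proof -
  have "(LINT x|\<nu>. (w x)\<^sup>2 * exp (w x) * indicator {s<..t} x) \<le> (LINT x|\<nu>. (w x + (w x)\<^sup>2 * exp (w x)) * indicator {s<..t} x)"
    using w_nonneg lin_growth_integrable_exp[OF lin_growth_w[of UNIV], of 2 1]
    by (intro integral_mono integrable_real_mult_indicator integrable_D) (auto split: split_indicator)
  also have "\<dots> \<le> Q t - Q s" using measure_D_le[OF assms] by (simp add: measure_D)
  finally show ?thesis .
qed

text \<open>Chaining along points that cut the range of \<open>Q\<close> over the cell into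
  \<open>2 ^ m\<close> equal parts. An increment of level \<open>k\<close> has variance proxy
  \<open>\<tau> / 2 ^ k\<close> and is allowed the size \<open>\<eta> / 4 * (3/4) ^ k\<close>; these
  sizes sum to at most \<open>\<eta>\<close>. Between neighbouring points of the finest level,
  bracketing costs at most another \<open>\<eta>\<close>.\<close>

lemma Z_cell_bound:
  assumes se: "s < e" and cont: "continuous_on {s..e} Q" and \<eta>: "0 < \<eta>"
    and n: "n \<ge> 1" and B: "24 \<le> \<eta>\<^sup>2 / (64 * (Q e - Q s)) * (lam n)\<^sup>2" and big: "\<eta> \<le> (Q e - Q s) * scale n"
  shows "\<exists>E\<in>events. prob E \<le> 4 * exp (- (\<eta>\<^sup>2 / (64 * (Q e - Q s)) * (lam n)\<^sup>2)) \<and>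
    (\<forall>\<omega>\<in>space M - E. \<forall>t\<in>{s..e}. \<bar>Z n t \<omega> - Z n s \<omega>\<bar> \<le> 2 * \<eta>)"
proof -
  define \<tau> where "\<tau> = Q e - Q s"
  have \<tau>: "0 < \<tau>" unfolding \<tau>_def using Q_strict_mono[OF se] by simp
  \<comment> \<open>\<open>y \<le> 2 ^ m\<close> is what makes the bracketing error
    \<open>scale n * (\<tau> / 2 ^ m)\<close> at most \<open>\<eta>\<close>;
    \<open>2 ^ m \<le> 8 * y\<close> keeps the tilts admissible.\<close>
  define y where "y = \<tau> * scale n / \<eta>"
  have y: "1 \<le> y" using big \<eta> by (simp add: y_def \<tau>_def)
  obtain m where m: "y \<le> 2 ^ m" "2 ^ m \<le> 8 * y"
  proof -
    have "\<exists>m. y \<le> 2 ^ m" using real_arch_pow[of 2 y] by (meson less_imp_le one_less_numeral_iff semiring_norm(76))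
    define m where "m = (LEAST m. y \<le> 2 ^ m)"
    have m1: "y \<le> 2 ^ m" unfolding m_def using \<open>\<exists>m. y \<le> 2 ^ m\<close> by (rule LeastI_ex)
    have "2 ^ m \<le> 8 * y"
    proof (cases m)
      case (Suc k)
      then have "\<not> y \<le> 2 ^ k" unfolding m_def by (metis lessI not_less_Least)
      then show ?thesis using Suc y by simp
    qed (use y in simp)
    with m1 that show ?thesis by blast
  qed
  have "\<exists>t. s \<le> t \<and> t \<le> e \<and> Q t = Q s + real i * \<tau> / 2 ^ m" if "i \<le> 2 ^ m" for i
  proof (rule IVT')
    have "real i \<le> 2 ^ m" using that by (metis of_nat_le_iff of_nat_numeral of_nat_power)
    then have "real i * \<tau> / 2 ^ m \<le> \<tau>" using \<tau> by (simp add: field_simps)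
    then show "Q s + real i * \<tau> / 2 ^ m \<le> Q e" by (simp add: \<tau>_def)
    show "Q s \<le> Q s + real i * \<tau> / 2 ^ m" using \<tau> by simp
  qed (use se cont in auto)
  then obtain p where p: "\<And>i. i \<le> 2 ^ m \<Longrightarrow> s \<le> p i \<and> p i \<le> e \<and> Q (p i) = Q s + real i * \<tau> / 2 ^ m"
    by metis
  have Qinj: "t = u" if "Q t = Q u" for t u using Q_strict_mono[of t u] Q_strict_mono[of u t] that by linarith
  have Qle: "t \<le> u" if "Q t \<le> Q u" for t u using Q_strict_mono[of u t] that by linarith
  have Qmono: "Q t \<le> Q u" if "t \<le> u" for t u using Q_strict_mono[of t u] that by (cases "t = u") auto
  have p0: "p 0 = s" using p[of 0] by - (rule Qinj, simp)
  \<comment> \<open>The ratio 3/4 is summable, yet \<open>2 * (3/4)\<^sup>2 = 9/8\<close> exceeds 1: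
    the exponents still grow geometrically and outweigh the \<open>2 ^ k\<close> increments of level
    \<open>k\<close>.\<close>
  define \<delta> where "\<delta> k = \<eta> / 4 * (3/4) ^ k" for k :: nat
  define E where "E k j = {\<omega>\<in>space M. \<delta> k \<le> \<bar>S n (\<lambda>x. w x * indicator {p (j * 2 ^ (m - k))<..p (Suc j * 2 ^ (m - k))} x) \<omega>\<bar>}" for k j
  define EE where "EE = (\<Union>k\<in>{..m}. \<Union>j\<in>{..<2 ^ k}. E k j)"
  have Em: "E k j \<in> events" for k j unfolding E_def by measurable
  define B where "B = \<eta>\<^sup>2 / (64 * \<tau>) * (lam n)\<^sup>2"
  have B24: "24 \<le> B" using B by (simp add: B_def \<tau>_def)
  have idx: "Suc j * 2 ^ (m - k) \<le> 2 ^ m" "j * 2 ^ (m - k) \<le> 2 ^ m" if "k \<le> m" "j < 2 ^ k" for k j :: nat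
  proof -
    have "Suc j * 2 ^ (m - k) \<le> 2 ^ k * 2 ^ (m - k)" using that by (intro mult_right_mono) auto
    also have "\<dots> = (2::nat) ^ m" using that by (simp add: power_add[symmetric])
    finally show "Suc j * 2 ^ (m - k) \<le> 2 ^ m" .
    then show "j * 2 ^ (m - k) \<le> 2 ^ m" by simp
  qed
  have pE: "prob (E k j) \<le> 2 * exp (- B * (9/8) ^ k)" if kj: "k \<le> m" "j < 2 ^ k" for k j
  proof -
    \<comment> \<open>The maximiser of
      \<open>\<kappa> * \<delta> k - \<kappa>\<^sup>2 * (\<tau> / 2 ^ k)\<close>.\<close>
    define \<kappa> where "\<kappa> = \<delta> k * 2 ^ k / (2 * \<tau>)"
    let ?s = "p (j * 2 ^ (m - k))" and ?t = "p (Suc j * 2 ^ (m - k))"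
    have Qd: "Q ?t - Q ?s = \<tau> / 2 ^ k"
    proof -
      have "Q ?t - Q ?s = (real (Suc j * 2 ^ (m - k)) - real (j * 2 ^ (m - k))) * \<tau> / 2 ^ m"
        using p[OF idx(1)[OF kj]] p[OF idx(2)[OF kj]] by (simp add: field_simps)
      also have "real (Suc j * 2 ^ (m - k)) - real (j * 2 ^ (m - k)) = 2 ^ m / 2 ^ k"
      proof -
        have "real (Suc j * 2 ^ (m - k)) - real (j * 2 ^ (m - k)) = 2 ^ (m - k)" by (simp add: algebra_simps)
        also have "\<dots> = 2 ^ m / 2 ^ k" using kj by (simp add: power_diff)
        finally show ?thesis .
      qed
      finally show ?thesis by simp
    qed
    have "0 \<le> \<tau> / 2 ^ k" using \<tau> by simp
    then have st: "?s \<le> ?t" using Qd by - (rule Qle, linarith)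
    have "prob {\<omega>\<in>space M. \<delta> k \<le> \<bar>S n (\<lambda>x. w x * indicator {?s<..?t} x) \<omega>\<bar>} \<le> 2 * exp (- (lam n)\<^sup>2 * (\<kappa> * \<delta> k - \<kappa>\<^sup>2 * (\<tau> / 2 ^ k)))"
    proof (rule S_tail_bound[OF _ _ n])
      show "(LINT x|\<nu>. (w x)\<^sup>2 * exp (w x) * indicator {?s<..?t} x) \<le> \<tau> / 2 ^ k"
        using variance_proxy_le[OF st] Qd by simp
      show "0 < \<kappa>" using \<tau> \<eta> by (simp add: \<kappa>_def \<delta>_def)
      \<comment> \<open>The optimal tilts grow with the level like
        \<open>(3/2) ^ k \<le> 2 ^ m\<close>, and \<open>2 ^ m \<le> 8 * y\<close> bounds them by
        \<open>scale n = 1 / \<theta> n\<close>.\<close>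
      have "\<kappa> = \<eta> * (3/2) ^ k / (8 * \<tau>)" by (simp add: \<kappa>_def \<delta>_def power_mult_distrib[symmetric])
      also have "\<dots> \<le> \<eta> * 2 ^ m / (8 * \<tau>)"
      proof -
        have "(3/2 :: real) ^ k \<le> 2 ^ k" by (intro power_mono) auto
        also have "\<dots> \<le> 2 ^ m" using kj by (intro power_increasing) auto
        finally show ?thesis using \<eta> \<tau> by (intro divide_right_mono mult_left_mono) auto
      qed
      also have "\<dots> \<le> \<eta> * (8 * y) / (8 * \<tau>)" using m \<eta> \<tau> by (intro divide_right_mono mult_left_mono) auto
      also have "\<dots> = scale n" using \<eta> \<tau> by (simp add: y_def)
      finally show "\<kappa> * \<theta> n \<le> 1" using theta_pos[OF n] by (simp add: scale_eq field_simps)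
    qed auto
    also have "- (lam n)\<^sup>2 * (\<kappa> * \<delta> k - \<kappa>\<^sup>2 * (\<tau> / 2 ^ k)) = - B * (9/8) ^ k"
    proof -
      have "\<kappa> * \<delta> k - \<kappa>\<^sup>2 * (\<tau> / 2 ^ k) = (\<delta> k)\<^sup>2 * 2 ^ k / (4 * \<tau>)"
        using \<tau> by (simp add: \<kappa>_def power2_eq_square field_simps)
      also have "\<dots> = \<eta>\<^sup>2 / (64 * \<tau>) * (((3/4) * (3/4) * 2) ^ k)"
        unfolding \<delta>_def power_mult_distrib by (simp add: power2_eq_square)
      finally show ?thesis by (simp add: B_def)
    qed
    finally show ?thesis by (simp add: E_def)
  qed
  have "prob EE \<le> (\<Sum>k\<le>m. prob (\<Union>j\<in>{..<2 ^ k}. E k j))"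
    unfolding EE_def using Em by (intro measure_UNION_le) auto
  also have "\<dots> \<le> (\<Sum>k\<le>m. \<Sum>j<2 ^ k. prob (E k j))"
    using Em by (intro sum_mono measure_UNION_le) auto
  also have "\<dots> \<le> (\<Sum>k\<le>m. \<Sum>j<(2::nat) ^ k. 2 * exp (- B * (9/8) ^ k))"
    using pE by (intro sum_mono) auto
  also have "\<dots> = (\<Sum>k\<le>m. 2 ^ k * (2 * exp (- B * (9/8) ^ k)))" by simp
  also have "\<dots> \<le> 4 * exp (- B)" using B24 by (rule sum_dyadic_exp_bound)
  finally have prob: "prob EE \<le> 4 * exp (- B)" .
  have good: "\<bar>Z n t \<omega> - Z n s \<omega>\<bar> \<le> 2 * \<eta>" if \<omega>: "\<omega> \<in> space M - EE" and t: "t \<in> {s..e}" for \<omega> t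
  proof -
    have chain: "\<bar>Z n (p i) \<omega> - Z n s \<omega>\<bar> \<le> \<eta>" if "i \<le> 2 ^ m" for i
    proof -
      have "\<bar>Z n (p i) \<omega> - Z n (p 0) \<omega>\<bar> \<le> (\<Sum>k\<le>m. \<delta> k)"
      proof (rule dyadic_chain[where z = "\<lambda>i. Z n (p i) \<omega>", OF _ _ that])
        fix k j :: nat assume kj: "k \<le> m" "j < 2 ^ k"
        let ?s = "p (j * 2 ^ (m - k))" and ?t = "p (Suc j * 2 ^ (m - k))"
        have "real (j * 2 ^ (m - k)) * \<tau> / 2 ^ m \<le> real (Suc j * 2 ^ (m - k)) * \<tau> / 2 ^ m"
          using \<tau> by (intro divide_right_mono mult_right_mono) auto
        then have "?s \<le> ?t" using p[OF idx(1)[OF kj]] p[OF idx(2)[OF kj]] by - (rule Qle, linarith)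
        moreover have "\<omega> \<notin> E k j" using \<omega> kj by (auto simp: EE_def)
        ultimately show "\<bar>Z n ?t \<omega> - Z n ?s \<omega>\<bar> \<le> \<delta> k"
          using \<omega> Z_diff[of ?s ?t n \<omega>] by (simp add: E_def abs_minus_commute)
      qed (use \<eta> in \<open>simp add: \<delta>_def\<close>)
      also have "(\<Sum>k\<le>m. \<delta> k) = \<eta> / 4 * (\<Sum>k\<le>m. (3/4) ^ k)" by (simp add: \<delta>_def sum_distrib_left)
      also have "\<dots> \<le> \<eta> / 4 * 4"
        using sum_gp_multiplied[of 0 m "3/4 :: real"] \<eta> by (intro mult_left_mono) (auto simp: atMost_atLeast0)
      finally show ?thesis using p0 by simp
    qed
    define i where "i = nat \<lfloor>(Q t - Q s) * 2 ^ m / \<tau>\<rfloor>"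
    have Qt: "Q s \<le> Q t" "Q t \<le> Q e" using t by (auto intro: Qmono)
    then have fl: "real i \<le> (Q t - Q s) * 2 ^ m / \<tau>" "(Q t - Q s) * 2 ^ m / \<tau> < real i + 1"
      using \<tau> by (auto simp: i_def intro!: of_nat_floor divide_nonneg_nonneg)
    have "(Q t - Q s) * 2 ^ m / \<tau> \<le> \<tau> * 2 ^ m / \<tau>"
      using Qt \<tau> by (intro divide_right_mono mult_right_mono) (auto simp: \<tau>_def)
    also have "\<dots> = 2 ^ m" using \<tau> by simp
    finally have i2: "real i \<le> 2 ^ m" using fl(1) by (rule order_trans[rotated])
    then have i2': "i \<le> 2 ^ m" by (metis of_nat_le_iff of_nat_numeral of_nat_power)
    show ?thesis
    proof (cases "i = 2 ^ m")
      \<comment> \<open>Only \<open>t = e\<close> has this index; it is itself a chaining point and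
        has no cell to its right.\<close>
      case True
      have "Q e \<le> Q t" using fl(1) \<tau> True by (simp add: \<tau>_def field_simps)
      then have "t = e" using t Qle[of e t] by auto
      moreover have "p i = e" using p[of i] True by - (rule Qinj, simp add: \<tau>_def)
      ultimately show ?thesis using chain[of i] True \<eta> by simp
    next
      case False
      then have i3: "Suc i \<le> 2 ^ m" using i2' by simp
      have "real i * \<tau> / 2 ^ m \<le> Q t - Q s" using fl(1) \<tau> by (simp add: field_simps)
      then have "p i \<le> t" using p[OF i2'] by - (rule Qle, linarith)
      moreover have "Q t - Q s \<le> real (Suc i) * \<tau> / 2 ^ m" using fl(2) \<tau> by (simp add: field_simps)
      then have "t \<le> p (Suc i)" using p[OF i3] by - (rule Qle, linarith)
      ultimately have br: "Z n t \<omega> \<le> Z n (p i) \<omega> + scale n * (Tw (p i) - Tw (p (Suc i)))"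
        "Z n (p (Suc i)) \<omega> - scale n * (Tw (p i) - Tw (p (Suc i))) \<le> Z n t \<omega>"
        using Z_bracket[OF n, of "p i" t "p (Suc i)" \<omega>] by auto
      have "Tw (p i) - Tw (p (Suc i)) \<le> Q (p (Suc i)) - Q (p i)"
        using \<open>p i \<le> t\<close> \<open>t \<le> p (Suc i)\<close> by (intro Tw_diff_le) simp
      also have "\<dots> = \<tau> / 2 ^ m" using p[OF i2'] p[OF i3] by (simp add: field_simps)
      finally have "scale n * (Tw (p i) - Tw (p (Suc i))) \<le> scale n * (\<tau> / 2 ^ m)"
        using scale_pos[OF n] by (intro mult_left_mono) auto
      also have "\<dots> = y * \<eta> / 2 ^ m" using \<eta> by (simp add: y_def)
      also have "\<dots> \<le> 2 ^ m * \<eta> / 2 ^ m" using m \<eta> by (intro divide_right_mono mult_right_mono) auto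
      finally have "scale n * (Tw (p i) - Tw (p (Suc i))) \<le> \<eta>" by simp
      then show ?thesis using br chain[OF i2'] chain[OF i3] by linarith
    qed
  qed
  show ?thesis
    using prob good Em by (intro bexI[of _ EE]) (auto simp: B_def \<tau>_def EE_def)
qed

text \<open>The cell bound has the exponent
  \<open>\<eta>\<^sup>2 / (64 * \<tau>) \<ge> K + 1\<close>; the spare unit absorbs the factor 4.
  Cells with a small increment of \<open>Q\<close> thus reach any prescribed rate.\<close>

lemma Z_cell_likely:
  assumes se: "s < e" and cont: "continuous_on {s..e} Q" and \<eta>: "0 < \<eta>"
    and K: "0 \<le> K" "(K + 1) * (64 * (Q e - Q s)) \<le> \<eta>\<^sup>2"
  shows "likely K (\<lambda>n \<omega>. \<forall>t\<in>{s..e}. \<bar>Z n t \<omega> - Z n s \<omega>\<bar> \<le> 2 * \<eta>)"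
proof -
  define \<tau> where "\<tau> = Q e - Q s"
  have \<tau>: "0 < \<tau>" unfolding \<tau>_def using Q_strict_mono[OF se] by simp
  define B where "B = \<eta>\<^sup>2 / (64 * \<tau>)"
  have B: "K + 1 \<le> B" using K(2) \<tau> by (simp add: B_def \<tau>_def[symmetric] field_simps)
  have B0: "0 < B" using B K by linarith
  show ?thesis
    unfolding likely_def
    using eventually_ge_at_top[of 1] eventually_lam_sq_ge[of "24 / B"] eventually_lam_sq_ge[of 3] eventually_scale_ge[of "\<eta> / \<tau>"]
  proof eventually_elim
    case (elim n)
    have "24 \<le> B * (lam n)\<^sup>2" using elim(2) B0 by (simp add: field_simps)
    moreover have "\<eta> \<le> \<tau> * scale n" using elim(4) \<tau> by (simp add: field_simps)
    ultimately obtain E where E: "E \<in> events" "prob E \<le> 4 * exp (- (B * (lam n)\<^sup>2))"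
      "\<forall>\<omega>\<in>space M - E. \<forall>t\<in>{s..e}. \<bar>Z n t \<omega> - Z n s \<omega>\<bar> \<le> 2 * \<eta>"
      using Z_cell_bound[OF se cont \<eta> elim(1)] by (auto simp: B_def \<tau>_def)
    have "4 \<le> exp ((lam n)\<^sup>2)" using elim(3) exp_ge_add_one_self[of "(lam n)\<^sup>2"] by linarith
    then have "4 * exp (- (B * (lam n)\<^sup>2)) \<le> exp ((lam n)\<^sup>2) * exp (- (B * (lam n)\<^sup>2))" by (intro mult_right_mono) auto
    also have "\<dots> = exp ((1 - B) * (lam n)\<^sup>2)" by (simp add: exp_add[symmetric] algebra_simps)
    also have "\<dots> \<le> exp (- K * (lam n)\<^sup>2)" using B unfolding exp_le_cancel_iff by (intro mult_right_mono) auto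
    finally show ?case using E by (intro bexI[of _ E]) auto
  qed
qed

text \<open>The tail bound with \<open>\<kappa> = 1\<close>. The variance proxy \<open>V\<close> of
  the whole line serves every \<open>t\<close>, so \<open>R = K + V + 1\<close> is uniform:
  \<open>V\<close> pays for the variance and the 1 for the factor 2.\<close>

lemma Z_point_likely:
  assumes K: "0 \<le> K"
  obtains R where "0 < R" "\<And>t. likely K (\<lambda>n \<omega>. \<bar>Z n t \<omega>\<bar> \<le> R)"
proof -
  define V where "V = (LINT x|\<nu>. (w x)\<^sup>2 * exp (w x))"
  have iV: "integrable \<nu> (\<lambda>x. (w x)\<^sup>2 * exp (w x))"
    using lin_growth_integrable_exp[OF lin_growth_w[of UNIV], of 2 1] w_nonneg by simp
  have V0: "0 \<le> V" unfolding V_def by simp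
  have "likely K (\<lambda>n \<omega>. \<bar>Z n t \<omega>\<bar> \<le> K + V + 1)" for t
    unfolding likely_def
    using eventually_ge_at_top[of 1] eventually_lam_sq_ge[of 1] order_tendstoD(2)[OF theta_lim zero_less_one]
  proof eventually_elim
    case (elim n)
    let ?E = "{\<omega>\<in>space M. K + V + 1 \<le> \<bar>S n (\<lambda>x. w x * indicator {t<..} x) \<omega>\<bar>}"
    have "prob ?E \<le> 2 * exp (- (lam n)\<^sup>2 * (1 * (K + V + 1) - 1\<^sup>2 * V))"
    proof (rule S_tail_bound)
      show "(LINT x|\<nu>. (w x)\<^sup>2 * exp (w x) * indicator {t<..} x) \<le> V"
        unfolding V_def using iV by (intro integral_mono integrable_real_mult_indicator) (auto split: split_indicator)
    qed (use elim in auto)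
    also have "\<dots> \<le> exp ((lam n)\<^sup>2) * exp (- (lam n)\<^sup>2 * (1 * (K + V + 1) - 1\<^sup>2 * V))"
    proof (rule mult_right_mono)
      show "2 \<le> exp ((lam n)\<^sup>2)" using elim(2) exp_ge_add_one_self[of "(lam n)\<^sup>2"] by linarith
    qed simp
    also have "\<dots> = exp (- K * (lam n)\<^sup>2)" by (simp add: exp_add[symmetric] algebra_simps)
    finally show ?case by (intro bexI[of _ ?E]) (auto simp: Z_def)
  qed
  then show ?thesis using K V0 by (intro that[of "K + V + 1"]) auto
qed

section \<open>Uniform control of the tail process on an interval\<close>

definition no_atoms :: "real \<Rightarrow> real \<Rightarrow> bool" where
  "no_atoms a b \<longleftrightarrow> (\<forall>t\<in>{a..b}. (LINT x|\<nu>. w x * indicator {t} x) = 0)"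

text \<open>If \<open>w\<close> times the indicator of a point vanishes almost everywhere, so does
  the whole density of \<open>D\<close> there; hence \<open>cdf D\<close> does not jump.\<close>

lemma Q_continuous:
  assumes "no_atoms a b"
  shows "continuous_on {a..b} Q"
proof -
  have "isCont Q t" if t: "t \<in> {a..b}" for t
  proof -
    have "AE x in \<nu>. w x * indicator {t} x = 0"
      using assms t w_nonneg lin_growth_integrable[OF lin_growth_w[of "{t}"]]
      by (subst integral_nonneg_eq_0_iff_AE[symmetric]) (auto simp: no_atoms_def)
    then have "(LINT x|\<nu>. (w x + (w x)\<^sup>2 * exp (w x)) * indicator {t} x) = 0"
    proof (intro integral_eq_zero_AE, elim eventually_mono)
      fix x assume "w x * indicator {t} x = 0"
      then show "(w x + (w x)\<^sup>2 * exp (w x)) * indicator {t} x = 0" by (cases "x = t") auto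
    qed
    then have "measure D {t} = 0" by (simp add: measure_D)
    then have "isCont (cdf D) t" by (simp add: finite_borel_measure.isCont_cdf[OF finite_borel_measure_D])
    then show ?thesis unfolding Q_def[abs_def] by (intro continuous_intros)
  qed
  then show ?thesis by (intro continuous_at_imp_continuous_on) auto
qed

definition grid :: "real \<Rightarrow> real \<Rightarrow> nat \<Rightarrow> nat \<Rightarrow> real" where
  "grid a b N j = a + real j * ((b - a) / real N)"

lemma grid_Suc: "grid a b N (Suc j) = grid a b N j + (b - a) / N"
  by (simp add: grid_def distrib_right add_divide_distrib)

lemma grid_in: "a < b \<Longrightarrow> 1 \<le> N \<Longrightarrow> j \<le> N \<Longrightarrow> grid a b N j \<in> {a..b}"
proof -
  assume *: "a < b" "1 \<le> N" "j \<le> N"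
  have "real j * ((b - a) / N) \<le> real N * ((b - a) / N)" using * by (intro mult_right_mono) auto
  then show ?thesis using * by (simp add: grid_def)
qed

lemma grid_cell:
  assumes "a < b" "1 \<le> N" "t \<in> {a..b}"
  obtains j where "j < N" "t \<in> {grid a b N j..grid a b N (Suc j)}"
proof (cases "t = b")
  case True
  then show ?thesis using assms by (intro that[of "N - 1"]) (auto simp: grid_def field_simps of_nat_diff)
next
  case False
  define d where "d = (b - a) / N"
  have d: "0 < d" "real N * d = b - a" using assms by (auto simp: d_def)
  define j where "j = nat \<lfloor>(t - a) / d\<rfloor>"
  have "0 \<le> (t - a) / d" using assms d by simp
  then have j: "real j \<le> (t - a) / d" "(t - a) / d < real j + 1" by (auto simp: j_def)
  have "real j * d \<le> t - a" "t - a < (real j + 1) * d" using j d by (auto simp: field_simps)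
  moreover have "j < N"
  proof -
    have "real j * d < real N * d" using \<open>real j * d \<le> t - a\<close> d(2) False assms(3) by auto
    then show ?thesis using d(1) by simp
  qed
  ultimately show ?thesis by (intro that[of j]) (auto simp: grid_def d_def[symmetric] algebra_simps)
qed

lemma Z_grid_likely:
  assumes ab: "a < b" and at: "no_atoms a b" and \<eta>: "0 < \<eta>" and K: "0 \<le> K"
  obtains N where "1 \<le> N"
    "likely K (\<lambda>n \<omega>. \<forall>j\<in>{..<N}. \<forall>t\<in>{grid a b N j..grid a b N (Suc j)}. \<bar>Z n t \<omega> - Z n (grid a b N j) \<omega>\<bar> \<le> \<eta>)"
proof -
  note cont = Q_continuous[OF at]
  \<comment> \<open>One unit of rate pays for the union over the cells and one for the constant
    factor in \<open>Z_cell_likely\<close>. That lemma bounds by twice its parameter, whence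
    \<open>\<eta> / 2\<close> below.\<close>
  define c where "c = K + 2"
  have c: "0 < c" "K + 1 + 1 = c" using K by (auto simp: c_def)
  define \<tau> where "\<tau> = (\<eta> / 2)\<^sup>2 / (64 * c)"
  have \<tau>: "0 < \<tau>" using \<eta> c by (simp add: \<tau>_def)
  obtain d where d: "0 < d" "\<And>s t. s \<in> {a..b} \<Longrightarrow> t \<in> {a..b} \<Longrightarrow> \<bar>t - s\<bar> < d \<Longrightarrow> \<bar>Q t - Q s\<bar> < \<tau>"
    using compact_uniformly_continuous[OF cont] \<tau> unfolding uniformly_continuous_on_def dist_real_def
    by (metis compact_Icc)
  obtain N where N: "(b - a) / d < real N" using reals_Archimedean2 by blast
  have N1: "1 \<le> N" using N ab d by (cases N) (auto simp: divide_less_0_iff)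
  have Nd: "(b - a) / N < d" using N N1 d by (simp add: field_simps)
  have "likely K (\<lambda>n \<omega>. \<forall>j\<in>{..<N}. \<forall>t\<in>{grid a b N j..grid a b N (Suc j)}. \<bar>Z n t \<omega> - Z n (grid a b N j) \<omega>\<bar> \<le> \<eta>)"
  proof (rule likely_ball[OF _ zero_less_one])
    fix j assume "j \<in> {..<N}"
    let ?s = "grid a b N j" and ?e = "grid a b N (Suc j)"
    have in_ab: "?s \<in> {a..b}" "?e \<in> {a..b}" using \<open>j \<in> {..<N}\<close> ab N1 by (auto intro!: grid_in simp del: atLeastAtMost_iff)
    have se: "?s < ?e" using ab N1 by (simp add: grid_Suc)
    have "\<bar>Q ?e - Q ?s\<bar> < \<tau>" using ab Nd N1 by (intro d in_ab) (simp add: grid_Suc)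
    then have "Q ?e - Q ?s \<le> \<tau>" by simp
    then have "(K + 1 + 1) * (64 * (Q ?e - Q ?s)) \<le> (K + 1 + 1) * (64 * \<tau>)" using K by (intro mult_left_mono) auto
    also have "\<dots> = (\<eta> / 2)\<^sup>2"
      unfolding c(2) \<tau>_def using c(1) by simp
    finally have "(K + 1 + 1) * (64 * (Q ?e - Q ?s)) \<le> (\<eta> / 2)\<^sup>2" .
    from Z_cell_likely[OF se _ _ _ this]
    show "likely (K + 1) (\<lambda>n \<omega>. \<forall>t\<in>{?s..?e}. \<bar>Z n t \<omega> - Z n ?s \<omega>\<bar> \<le> \<eta>)"
      using K \<eta> in_ab continuous_on_subset[OF cont, of "{?s..?e}"] by auto
  qed simp
  with N1 that show ?thesis by blast
qed

text \<open>Points closer than half the mesh lie in the same or in neighbouring cells, so at most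
  three oscillations of size \<open>\<eta> / 3\<close> add up.\<close>

lemma Z_modulus_likely:
  assumes ab: "a < b" and at: "no_atoms a b" and \<eta>: "0 < \<eta>" and K: "0 \<le> K"
  obtains d where "0 < d"
    "likely K (\<lambda>n \<omega>. \<forall>s\<in>{a..b}. \<forall>t\<in>{a..b}. \<bar>s - t\<bar> \<le> d \<longrightarrow> \<bar>Z n s \<omega> - Z n t \<omega>\<bar> \<le> \<eta>)"
proof -
  obtain N where N: "1 \<le> N" "likely K (\<lambda>n \<omega>. \<forall>j\<in>{..<N}. \<forall>t\<in>{grid a b N j..grid a b N (Suc j)}. \<bar>Z n t \<omega> - Z n (grid a b N j) \<omega>\<bar> \<le> \<eta> / 3)"
    using Z_grid_likely[OF ab at, of "\<eta> / 3" K] \<eta> K by auto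
  let ?g = "grid a b N"
  have mono: "i \<le> j \<Longrightarrow> ?g i \<le> ?g j" for i j
    using ab by (simp add: grid_def divide_right_mono mult_right_mono)
  have "\<bar>Z n s \<omega> - Z n t \<omega>\<bar> \<le> \<eta>"
    if cell: "\<forall>j\<in>{..<N}. \<forall>t\<in>{?g j..?g (Suc j)}. \<bar>Z n t \<omega> - Z n (?g j) \<omega>\<bar> \<le> \<eta> / 3"
      and st: "s \<in> {a..b}" "t \<in> {a..b}" "s \<le> t" "\<bar>s - t\<bar> \<le> (b - a) / N / 2" for n \<omega> s t
  proof -
    have w0: "0 < (b - a) / N" using ab N by simp
    obtain i where i: "i < N" "s \<in> {?g i..?g (Suc i)}" using grid_cell[OF ab N(1) st(1)] by blast
    obtain j where j: "j < N" "t \<in> {?g j..?g (Suc j)}" using grid_cell[OF ab N(1) st(2)] by blast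
    show ?thesis
    proof (cases "t \<le> ?g (Suc i)")
      case True
      then have "t \<in> {?g i..?g (Suc i)}" using st i by auto
      then have "\<bar>Z n t \<omega> - Z n (?g i) \<omega>\<bar> \<le> \<eta> / 3" "\<bar>Z n s \<omega> - Z n (?g i) \<omega>\<bar> \<le> \<eta> / 3"
        using cell i by auto
      then show ?thesis using \<eta> by linarith
    next
      case False
      have "Suc i \<noteq> N"
      proof
        assume "Suc i = N"
        then have "?g (Suc i) = b" using N by (simp add: grid_def)
        then show False using False st by simp
      qed
      then have i': "Suc i < N" using i by simp
      have "t \<le> ?g (Suc i) + (b - a) / N" using st i w0 by auto
      then have "t \<in> {?g (Suc i)..?g (Suc (Suc i))}" using False by (simp add: grid_Suc)
      then have "\<bar>Z n t \<omega> - Z n (?g (Suc i)) \<omega>\<bar> \<le> \<eta> / 3" using cell i' by blast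
      moreover have "?g (Suc i) \<in> {?g i..?g (Suc i)}" using mono by auto
      then have "\<bar>Z n (?g (Suc i)) \<omega> - Z n (?g i) \<omega>\<bar> \<le> \<eta> / 3" using cell i(1) by blast
      moreover have "\<bar>Z n s \<omega> - Z n (?g i) \<omega>\<bar> \<le> \<eta> / 3" using cell i by blast
      ultimately show ?thesis by linarith
    qed
  qed
  note sym = this
  show ?thesis
  proof (rule that)
    show "0 < (b - a) / N / 2" using ab N by simp
    show "likely K (\<lambda>n \<omega>. \<forall>s\<in>{a..b}. \<forall>t\<in>{a..b}. \<bar>s - t\<bar> \<le> (b - a) / N / 2 \<longrightarrow> \<bar>Z n s \<omega> - Z n t \<omega>\<bar> \<le> \<eta>)"
    proof (rule likely_mono[OF N(2)], rule always_eventually, intro allI ballI impI)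
      fix n \<omega> s t
      assume *: "\<forall>j\<in>{..<N}. \<forall>t\<in>{?g j..?g (Suc j)}. \<bar>Z n t \<omega> - Z n (?g j) \<omega>\<bar> \<le> \<eta> / 3"
        "s \<in> {a..b}" "t \<in> {a..b}" "\<bar>s - t\<bar> \<le> (b - a) / N / 2"
      show "\<bar>Z n s \<omega> - Z n t \<omega>\<bar> \<le> \<eta>"
      proof (cases "s \<le> t")
        case True
        show ?thesis by (rule sym[OF *(1,2,3) True *(4)])
      next
        case False
        then have "t \<le> s" "\<bar>t - s\<bar> \<le> (b - a) / N / 2" using *(4) by linarith+
        from sym[OF *(1,3,2) this] show ?thesis by linarith
      qed
    qed
  qed
qed

text \<open>Bounds at finitely many grid points, plus the oscillation within a cell.\<close>

lemma Z_bound_likely: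
  assumes ab: "a < b" and at: "no_atoms a b" and K: "0 \<le> K"
  obtains R where "0 < R" "likely K (\<lambda>n \<omega>. \<forall>t\<in>{a..b}. \<bar>Z n t \<omega>\<bar> \<le> R)"
proof -
  obtain N where N: "1 \<le> N" "likely (K + 1) (\<lambda>n \<omega>. \<forall>j\<in>{..<N}. \<forall>t\<in>{grid a b N j..grid a b N (Suc j)}. \<bar>Z n t \<omega> - Z n (grid a b N j) \<omega>\<bar> \<le> 1)"
    using Z_grid_likely[OF ab at, of 1 "K + 1"] K by auto
  obtain R where R: "0 < R" "\<And>t. likely (K + 1 + 1) (\<lambda>n \<omega>. \<bar>Z n t \<omega>\<bar> \<le> R)"
    using Z_point_likely[of "K + 1 + 1"] K by auto
  have "likely (K + 1) (\<lambda>n \<omega>. \<forall>j\<in>{..<N}. \<bar>Z n (grid a b N j) \<omega>\<bar> \<le> R)"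
    using R by (intro likely_ball[OF _ zero_less_one]) auto
  from likely_conj[OF zero_less_one N(2) this]
  have "likely K (\<lambda>n \<omega>. \<forall>t\<in>{a..b}. \<bar>Z n t \<omega>\<bar> \<le> R + 1)"
  proof (rule likely_mono, intro always_eventually allI ballI impI)
    fix n \<omega> t
    assume *: "(\<forall>j\<in>{..<N}. \<forall>t\<in>{grid a b N j..grid a b N (Suc j)}. \<bar>Z n t \<omega> - Z n (grid a b N j) \<omega>\<bar> \<le> 1) \<and>
      (\<forall>j\<in>{..<N}. \<bar>Z n (grid a b N j) \<omega>\<bar> \<le> R)" and t: "t \<in> {a..b}"
    obtain j where j: "j < N" "t \<in> {grid a b N j..grid a b N (Suc j)}" using grid_cell[OF ab N(1) t] by blast
    then have "\<bar>Z n t \<omega> - Z n (grid a b N j) \<omega>\<bar> \<le> 1" "\<bar>Z n (grid a b N j) \<omega>\<bar> \<le> R" using * by blast+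
    then show "\<bar>Z n t \<omega>\<bar> \<le> R + 1" by linarith
  qed
  then show ?thesis using R(1) by (intro that[of "R + 1"]) auto
qed

end

section \<open>Moderate deviations of the tail process\<close>

context weighted_sample
begin

section \<open>Paths of finite energy and their dual description\<close>

definition tailw :: "real \<Rightarrow> real \<Rightarrow> real" where
  "tailw t x = w x * indicator {t<..} x"

definition pairing :: "(real \<Rightarrow> real) \<Rightarrow> real \<Rightarrow> real" where
  "pairing h t = (LINT x|\<nu>. h x * tailw t x)"

text \<open>The densities of the signed measures in \<open>Mb0 \<nu>\<close> with
  \<open>I_meas\<close> at most \<open>\<alpha>\<close>; mean 0 expresses total mass 0.\<close>

definition energy_ball :: "real \<Rightarrow> (real \<Rightarrow> real) set" where
  "energy_ball \<alpha> = {h \<in> L2 \<nu>. mean h = 0 \<and> (LINT x|\<nu>. (h x)\<^sup>2) / 2 \<le> \<alpha>}"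

lemma fin_nu: "finite_measure \<nu>" by (rule nu.finite_measure_axioms)

lemma Z_tailw: "Z n t = S n (tailw t)" by (simp add: Z_def tailw_def[abs_def])

lemma lin_growth_tailw: "lin_growth (tailw t)"
  using lin_growth_w[of "{t<..}"] by (simp add: tailw_def[abs_def])

lemma lin_growth_L2: "lin_growth \<psi> \<Longrightarrow> \<psi> \<in> L2 \<nu>"
  using lin_growth_integrable_sq[of \<psi>] by (auto simp: L2_def lin_growth_def)

lemma var_eq: "lin_growth \<psi> \<Longrightarrow> var \<psi> = (LINT x|\<nu>. (\<psi> x)\<^sup>2) - (mean \<psi>)\<^sup>2"
  using L2_lincomb_sq[OF lin_growth_L2[of \<psi>] L2_const[OF fin_nu, of 1], of 1 "- mean \<psi>"]
  by (simp add: var_def mean_def nu.prob_space[simplified] power2_eq_square)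

text \<open>The variance is the least second moment about a constant. Constants can therefore be
  adjoined to the test functions without spoiling a dual inequality stated with
  \<open>var\<close>.\<close>

lemma var_le: "lin_growth \<psi> \<Longrightarrow> var \<psi> \<le> (LINT x|\<nu>. (r + \<psi> x)\<^sup>2)"
proof -
  assume \<psi>: "lin_growth \<psi>"
  have "(LINT x|\<nu>. (r + \<psi> x)\<^sup>2) = r\<^sup>2 + (LINT x|\<nu>. (\<psi> x)\<^sup>2) + 2 * r * mean \<psi>"
    using L2_lincomb_sq[OF lin_growth_L2[OF \<psi>] L2_const[OF fin_nu, of 1], of 1 r]
    by (simp add: mean_def nu.prob_space[simplified] add.commute)
  also have "\<dots> = var \<psi> + (r + mean \<psi>)\<^sup>2" using var_eq[OF \<psi>] by (simp add: power2_eq_square algebra_simps)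
  finally show ?thesis by simp
qed

definition cov :: "(real \<Rightarrow> real) \<Rightarrow> (real \<Rightarrow> real) \<Rightarrow> real" where
  "cov \<psi> \<phi> = (LINT x|\<nu>. (\<psi> x - mean \<psi>) * (\<phi> x - mean \<phi>))"

lemma var_lincomb:
  assumes "lin_growth \<psi>" "lin_growth \<phi>"
  shows "var (\<lambda>x. \<psi> x + s * \<phi> x) = var \<psi> + 2 * s * cov \<psi> \<phi> + s\<^sup>2 * var \<phi>"
proof -
  have "mean (\<lambda>x. \<psi> x + s * \<phi> x) = mean \<psi> + s * mean \<phi>"
    using assms lin_growth_integrable by (simp add: mean_def)
  then have "var (\<lambda>x. \<psi> x + s * \<phi> x) = (LINT x|\<nu>. (1 * (\<psi> x - mean \<psi>) + s * (\<phi> x - mean \<phi>))\<^sup>2)"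
    unfolding var_def by (simp add: algebra_simps)
  also have "\<dots> = var \<psi> + 2 * s * cov \<psi> \<phi> + s\<^sup>2 * var \<phi>"
    using assms by (subst L2_lincomb_sq) (auto intro!: lin_growth_L2 lin_growth_center simp: var_def cov_def)
  finally show ?thesis .
qed

lemma cov_center:
  assumes "h \<in> L2 \<nu>" "mean h = 0" "\<phi> \<in> L2 \<nu>"
  shows "cov h \<phi> = (LINT x|\<nu>. h x * \<phi> x)"
proof -
  have "cov h \<phi> = (LINT x|\<nu>. h x * \<phi> x - mean \<phi> * h x)" unfolding cov_def assms(2) by (simp add: algebra_simps)
  also have "\<dots> = (LINT x|\<nu>. h x * \<phi> x) - mean \<phi> * mean h"
    using L2_mult[OF assms(1,3)] L2_integrable[OF fin_nu assms(1)] by (simp add: mean_def)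
  finally show ?thesis using assms by simp
qed

text \<open>Extending coefficients by 0 compares sums over different finite sets: it makes the test
  functions a vector space, and it turns inequalities over subsets of \<open>F\<close> into
  inequalities over \<open>F\<close>.\<close>

lemma sum_restrict_coeff:
  fixes c g :: "'c \<Rightarrow> real"
  assumes "finite F'" "F \<subseteq> F'"
  shows "(\<Sum>t\<in>F'. (if t \<in> F then c t else 0) * g t) = (\<Sum>t\<in>F. c t * g t)"
  using assms by (intro sum.mono_neutral_cong_right) auto

text \<open>
  The half-spaces in the next two lemmas are those whose probabilities Chernoff's bound controls.
\<close>

lemma energy_ball_dual:
  assumes "h \<in> energy_ball \<alpha>" "finite F"
  shows "(\<Sum>t\<in>F. c t * pairing h t) \<le> \<alpha> + var (\<lambda>x. \<Sum>t\<in>F. c t * tailw t x) / 2"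
proof -
  let ?\<psi> = "\<lambda>x. \<Sum>t\<in>F. c t * tailw t x"
  have h: "h \<in> L2 \<nu>" "mean h = 0" "(LINT x|\<nu>. (h x)\<^sup>2) / 2 \<le> \<alpha>" using assms by (auto simp: energy_ball_def)
  have \<psi>: "lin_growth ?\<psi>" by (intro lin_growth_sum lin_growth_tailw)
  have "(\<Sum>t\<in>F. c t * pairing h t) = (LINT x|\<nu>. (\<Sum>t\<in>F. c t * (h x * tailw t x)))"
    unfolding pairing_def using L2_mult[OF h(1) lin_growth_L2[OF lin_growth_tailw]]
    by (subst Bochner_Integration.integral_sum) auto
  also have "\<dots> = (LINT x|\<nu>. h x * ?\<psi> x)" by (simp add: sum_distrib_left algebra_simps)
  also have "\<dots> = cov h ?\<psi>" by (rule cov_center[OF h(1,2) lin_growth_L2[OF \<psi>], symmetric])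
  also have "\<dots> = (LINT x|\<nu>. h x * (?\<psi> x - mean ?\<psi>))" unfolding cov_def h(2) by simp
  also have "\<dots> \<le> (LINT x|\<nu>. (h x)\<^sup>2 / 2 + (?\<psi> x - mean ?\<psi>)\<^sup>2 / 2)"
  proof (rule integral_mono)
    show "integrable \<nu> (\<lambda>x. h x * (?\<psi> x - mean ?\<psi>))"
      by (rule L2_mult[OF h(1) lin_growth_L2[OF lin_growth_center[OF \<psi>]]])
    show "integrable \<nu> (\<lambda>x. (h x)\<^sup>2 / 2 + (?\<psi> x - mean ?\<psi>)\<^sup>2 / 2)"
      using L2_sq[OF h(1)] L2_sq[OF lin_growth_L2[OF lin_growth_center[OF \<psi>]]] by auto
    fix x show "h x * (?\<psi> x - mean ?\<psi>) \<le> (h x)\<^sup>2 / 2 + (?\<psi> x - mean ?\<psi>)\<^sup>2 / 2"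
      using sum_squares_bound[of "h x" "?\<psi> x - mean ?\<psi>"] by simp
  qed
  also have "\<dots> = (LINT x|\<nu>. (h x)\<^sup>2) / 2 + var ?\<psi> / 2"
    unfolding var_def using L2_sq[OF h(1)] L2_sq[OF lin_growth_L2[OF lin_growth_center[OF \<psi>]]] by simp
  finally show ?thesis using h(3) by simp
qed

lemma energy_ball_of_dual:
  assumes "\<And>F c. finite F \<Longrightarrow> F \<subseteq> U \<Longrightarrow> (\<Sum>t\<in>F. c t * y t) \<le> \<alpha> + var (\<lambda>x. \<Sum>t\<in>F. c t * tailw t x) / 2"
  obtains h where "h \<in> energy_ball \<alpha>" "\<And>t. t \<in> U \<Longrightarrow> pairing h t = y t"
proof -
  \<comment> \<open>A test function paired with its prescribed value. Constants get the value 0, so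
    representing them forces \<open>mean h = 0\<close>. \<open>V\<close> is a relation, as different
    coefficients may give the same function; that the values agree is part of what the
    representation yields.\<close>
  define p where "p r c F = (\<lambda>x. r + (\<Sum>t\<in>F. c t * tailw t x), \<Sum>t\<in>F. c t * y t)" for r c F
  define V where "V = {p r c F | r c F. finite F \<and> F \<subseteq> U}"
  obtain h where h: "h \<in> L2 \<nu>" "(LINT x|\<nu>. (h x)\<^sup>2) / 2 \<le> \<alpha>" "\<And>p. p \<in> V \<Longrightarrow> (LINT x|\<nu>. h x * fst p x) = snd p"
  proof (rule L2_representation[OF fin_nu, of V \<alpha>])
    show "V \<noteq> {}" unfolding V_def by blast
    show "fst q \<in> L2 \<nu>" if q: "q \<in> V" for q
    proof -
      obtain r c F where *: "q = p r c F" using q unfolding V_def by blast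
      have "lin_growth (\<lambda>x. 1 * r + 1 * (\<Sum>t\<in>F. c t * tailw t x))"
        by (intro lin_growth_lincomb lin_growth_const lin_growth_sum lin_growth_tailw)
      then show ?thesis using lin_growth_L2 by (simp add: * p_def)
    qed
    show "snd q \<le> \<alpha> + (LINT x|\<nu>. (fst q x)\<^sup>2) / 2" if q: "q \<in> V" for q
    proof -
      obtain r c F where *: "q = p r c F" "finite F" "F \<subseteq> U" using q unfolding V_def by blast
      have "lin_growth (\<lambda>x. \<Sum>t\<in>F. c t * tailw t x)" by (intro lin_growth_sum lin_growth_tailw)
      then show ?thesis using var_le[of "\<lambda>x. \<Sum>t\<in>F. c t * tailw t x" r] assms[OF *(2,3), of c] by (simp add: * p_def)
    qed
    show "(\<lambda>x. a * fst q x + b * fst q' x, a * snd q + b * snd q') \<in> V" if q: "q \<in> V" "q' \<in> V" for q q' a b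
    proof -
      obtain r c F where q1: "q = p r c F" "finite F" "F \<subseteq> U" using q unfolding V_def by blast
      obtain r' c' F' where q2: "q' = p r' c' F'" "finite F'" "F' \<subseteq> U" using q unfolding V_def by blast
      define d where "d t = a * (if t \<in> F then c t else 0) + b * (if t \<in> F' then c' t else 0)" for t
      have sum: "(\<Sum>t\<in>F \<union> F'. d t * g t) = a * (\<Sum>t\<in>F. c t * g t) + b * (\<Sum>t\<in>F'. c' t * g t)" for g
      proof -
        have "(\<Sum>t\<in>F \<union> F'. d t * g t) = a * (\<Sum>t\<in>F \<union> F'. (if t \<in> F then c t else 0) * g t) + b * (\<Sum>t\<in>F \<union> F'. (if t \<in> F' then c' t else 0) * g t)"
          unfolding sum_distrib_left sum.distrib[symmetric] d_def by (intro sum.cong refl) (simp add: algebra_simps)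
        then show ?thesis using q1(2) q2(2) by (simp only: sum_restrict_coeff finite_Un Un_upper1 Un_upper2)
      qed
      have "(\<lambda>x. a * fst q x + b * fst q' x, a * snd q + b * snd q') = p (a * r + b * r') d (F \<union> F')"
        unfolding p_def sum by (auto simp: q1 q2 p_def algebra_simps)
      then show ?thesis unfolding V_def using q1 q2 by blast
    qed
  next
    fix h assume "h \<in> L2 \<nu>" "(LINT x|\<nu>. (h x)\<^sup>2) / 2 \<le> \<alpha>" "\<And>p. p \<in> V \<Longrightarrow> (LINT x|\<nu>. h x * fst p x) = snd p"
    then show thesis by (rule that)
  qed
  have "p 1 (\<lambda>_. 0) {} \<in> V" unfolding V_def by blast
  from h(3)[OF this] have "mean h = 0" by (simp add: p_def mean_def)
  then have "h \<in> energy_ball \<alpha>" using h by (simp add: energy_ball_def)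
  moreover have "pairing h t = y t" if "t \<in> U" for t
  proof -
    have "p 0 (\<lambda>_. 1) {t} \<in> V" unfolding V_def using that by blast
    from h(3)[OF this] show ?thesis by (simp add: p_def pairing_def)
  qed
  ultimately show ?thesis by (rule that)
qed

lemma tailw_diff_L2_le:
  assumes "s \<le> t"
  shows "(LINT x|\<nu>. (tailw s x - tailw t x)\<^sup>2) \<le> Q t - Q s"
proof -
  have "(LINT x|\<nu>. (tailw s x - tailw t x)\<^sup>2) \<le> (LINT x|\<nu>. (w x)\<^sup>2 * exp (w x) * indicator {s<..t} x)"
    using assms w_nonneg lin_growth_integrable_exp[OF lin_growth_w[of UNIV], of 2 1]
    by (intro integral_mono integrable_real_mult_indicator L2_sq L2_diff lin_growth_L2 lin_growth_tailw)
      (auto simp: tailw_def mult_le_cancel_left1 split: split_indicator)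
  then show ?thesis using variance_proxy_le[OF assms] by simp
qed

text \<open>Cauchy--Schwarz against \<open>w\<close> restricted to the interval between
  \<open>s\<close> and \<open>t\<close>, whose squared norm is at most the increment of
  \<open>Q\<close>. Hence energy balls are equicontinuous wherever \<open>Q\<close> is
  continuous.\<close>

lemma pairing_diff_le:
  assumes "h \<in> energy_ball \<alpha>"
  shows "(pairing h s - pairing h t)\<^sup>2 \<le> 2 * \<alpha> * \<bar>Q s - Q t\<bar>"
proof -
  have *: "(pairing h s - pairing h t)\<^sup>2 \<le> 2 * \<alpha> * \<bar>Q s - Q t\<bar>" if "s \<le> t" for s t
  proof -
    have h: "h \<in> L2 \<nu>" "(LINT x|\<nu>. (h x)\<^sup>2) \<le> 2 * \<alpha>" using assms by (auto simp: energy_ball_def)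
    have "0 \<le> (LINT x|\<nu>. (h x)\<^sup>2)" by simp
    then have \<alpha>0: "0 \<le> \<alpha>" using h(2) by linarith
    have "pairing h s - pairing h t = (LINT x|\<nu>. h x * (tailw s x - tailw t x))"
      unfolding pairing_def right_diff_distrib
      by (intro Bochner_Integration.integral_diff[symmetric] L2_mult[OF h(1) lin_growth_L2[OF lin_growth_tailw]])
    then have "(pairing h s - pairing h t)\<^sup>2 \<le> (LINT x|\<nu>. (h x)\<^sup>2) * (LINT x|\<nu>. (tailw s x - tailw t x)\<^sup>2)"
      using L2_Cauchy_Schwarz[OF h(1) L2_diff[OF lin_growth_L2 lin_growth_L2], OF lin_growth_tailw lin_growth_tailw, of s t] by simp
    also have "\<dots> \<le> (2 * \<alpha>) * (Q t - Q s)"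
      using h(2) \<alpha>0 tailw_diff_L2_le[OF that] by (intro mult_mono) auto
    also have "\<dots> \<le> 2 * \<alpha> * \<bar>Q s - Q t\<bar>"
      using \<alpha>0 by (intro mult_left_mono) auto
    finally show ?thesis .
  qed
  show ?thesis using *[of s t] *[of t s] by (cases "s \<le> t") (auto simp: power2_commute abs_minus_commute)
qed

lemma pairing_equicontinuous:
  assumes "no_atoms a b" "0 < r" "0 \<le> \<alpha>"
  obtains d where "0 < d" "\<And>h s t. h \<in> energy_ball \<alpha> \<Longrightarrow> s \<in> {a..b} \<Longrightarrow> t \<in> {a..b} \<Longrightarrow> \<bar>s - t\<bar> < d \<Longrightarrow> \<bar>pairing h s - pairing h t\<bar> < r"
proof -
  have "0 < r\<^sup>2 / (2 * \<alpha> + 1)" using assms by simp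
  then obtain d where d: "0 < d" "\<And>s t. s \<in> {a..b} \<Longrightarrow> t \<in> {a..b} \<Longrightarrow> \<bar>s - t\<bar> < d \<Longrightarrow> \<bar>Q s - Q t\<bar> < r\<^sup>2 / (2 * \<alpha> + 1)"
    using compact_uniformly_continuous[OF Q_continuous[OF assms(1)]] unfolding uniformly_continuous_on_def dist_real_def
    by (metis compact_Icc)
  show ?thesis
  proof (rule that[OF d(1)])
    fix h s t assume *: "h \<in> energy_ball \<alpha>" "s \<in> {a..b}" "t \<in> {a..b}" "\<bar>s - t\<bar> < d"
    have "(pairing h s - pairing h t)\<^sup>2 \<le> 2 * \<alpha> * \<bar>Q s - Q t\<bar>" using *(1) by (rule pairing_diff_le)
    also have "\<dots> \<le> 2 * \<alpha> * (r\<^sup>2 / (2 * \<alpha> + 1))" using d(2)[OF *(2-4)] assms by (intro mult_left_mono) auto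
    also have "\<dots> < r\<^sup>2" using assms by (simp add: field_simps)
    finally show "\<bar>pairing h s - pairing h t\<bar> < r" using power2_less_imp_less[of "\<bar>pairing h s - pairing h t\<bar>" r] assms by simp
  qed
qed

lemma L2_pairing_bound:
  assumes "h \<in> L2 \<nu>"
  shows "(pairing h t)\<^sup>2 \<le> (LINT x|\<nu>. (h x)\<^sup>2) * (LINT x|\<nu>. (w x)\<^sup>2)"
proof -
  have "(pairing h t)\<^sup>2 \<le> (LINT x|\<nu>. (h x)\<^sup>2) * (LINT x|\<nu>. (tailw t x)\<^sup>2)"
    unfolding pairing_def by (intro L2_Cauchy_Schwarz assms lin_growth_L2 lin_growth_tailw)
  also have "(LINT x|\<nu>. (tailw t x)\<^sup>2) \<le> (LINT x|\<nu>. (w x)\<^sup>2)"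
    using L2_sq[OF lin_growth_L2[OF lin_growth_tailw]] lin_growth_integrable_sq[OF lin_growth_w[of UNIV]]
    by (intro integral_mono) (auto simp: tailw_def split: split_indicator)
  finally show ?thesis by (simp add: mult_left_mono)
qed

text \<open>Markov's inequality at the level \<open>\<alpha> + var \<psi> / 2\<close>: the moment
  costs \<open>var \<psi> / 2 + e\<close>, so the rate \<open>\<alpha> - e\<close> remains whatever
  \<open>\<psi>\<close> is. This matches the form of the dual inequalities.\<close>

lemma Chernoff_likely:
  assumes \<psi>: "lin_growth \<psi>" and e: "0 < e"
  shows "likely (\<alpha> - e) (\<lambda>n \<omega>. S n \<psi> \<omega> \<le> \<alpha> + var \<psi> / 2)"
  unfolding likely_def using exp_S_asymp[OF \<psi> e] eventually_ge_at_top[of 1]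
proof eventually_elim
  case (elim n)
  let ?k = "\<alpha> + var \<psi> / 2"
  let ?E = "{\<omega>\<in>space M. exp ((lam n)\<^sup>2 * ?k) \<le> exp ((lam n)\<^sup>2 * S n \<psi> \<omega>)}"
  note [measurable] = lin_growth_measurable[OF \<psi>]
  have lam0: "0 < (lam n)\<^sup>2" using lam_pos[of n] elim by simp
  have "prob ?E \<le> expectation (\<lambda>\<omega>. exp ((lam n)\<^sup>2 * S n \<psi> \<omega>)) / exp ((lam n)\<^sup>2 * ?k)"
    using exp_S(1)[OF \<psi>] elim by (intro integral_Markov_inequality_measure[where A = "{}"]) auto
  also have "\<dots> \<le> exp ((lam n)\<^sup>2 * (var \<psi> / 2 + e)) / exp ((lam n)\<^sup>2 * ?k)"
    using elim by (intro divide_right_mono) auto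
  also have "\<dots> = exp (- (\<alpha> - e) * (lam n)\<^sup>2)" by (simp add: exp_diff[symmetric] algebra_simps)
  finally have "prob ?E \<le> exp (- (\<alpha> - e) * (lam n)\<^sup>2)" .
  moreover have "?E \<in> events" by measurable
  moreover have "S n \<psi> \<omega> \<le> ?k" if "\<omega> \<in> space M - ?E" for \<omega>
    using that lam0 by (auto simp: not_le)
  ultimately show ?case by (intro bexI[of _ ?E]) auto
qed

lemma finite_net:
  assumes "a < b" "0 < d"
  obtains F where "finite F" "F \<subseteq> {a..b}" "\<And>t. t \<in> {a..b} \<Longrightarrow> \<exists>s\<in>F. \<bar>s - t\<bar> < (d::real)"
proof -
  obtain N where N: "(b - a) / d < real N" using reals_Archimedean2 by blast
  have N1: "1 \<le> N" using N assms by (cases N) (auto simp: divide_less_0_iff)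
  have Nd: "(b - a) / N < d" using N N1 assms by (simp add: field_simps)
  show ?thesis
  proof (rule that[of "grid a b N ` {..N}"])
    show "grid a b N ` {..N} \<subseteq> {a..b}" using grid_in[OF assms(1) N1] by auto
    fix t assume "t \<in> {a..b}"
    then obtain j where "j < N" "t \<in> {grid a b N j..grid a b N (Suc j)}" using grid_cell[OF assms(1) N1] by blast
    then show "\<exists>s\<in>grid a b N ` {..N}. \<bar>s - t\<bar> < d"
      using Nd by (intro bexI[of _ "grid a b N j"]) (auto simp: grid_Suc)
  qed simp
qed

text \<open>A compact box in finitely many coordinates is covered by the open neighbourhood of the
  paths together with the open half-spaces where some dual inequality fails: a point violating none
  of them is a path by \<open>energy_ball_of_dual\<close>. A finite subcover yields
  \<open>C\<close>.\<close>

lemma half_space_cover: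
  assumes F: "finite F" and r: "0 < r"
  obtains C where "finite C"
    "\<And>y. (\<And>t. t \<in> F \<Longrightarrow> \<bar>y t\<bar> \<le> R) \<Longrightarrow>
       (\<And>c. c \<in> C \<Longrightarrow> (\<Sum>t\<in>F. c t * y t) \<le> \<alpha> + var (\<lambda>x. \<Sum>t\<in>F. c t * tailw t x) / 2) \<Longrightarrow>
       \<exists>h\<in>energy_ball \<alpha>. \<forall>t\<in>F. \<bar>y t - pairing h t\<bar> < r"
proof -
  let ?X = "product_topology (\<lambda>_. euclideanreal) F"
  define v where "v c = \<alpha> + var (\<lambda>x. \<Sum>t\<in>F. c t * tailw t x) / 2" for c
  define Uh where "Uh h = PiE F (\<lambda>t. ball (pairing h t) r)" for h
  define Uc where "Uc c = {y \<in> topspace ?X. (\<Sum>t\<in>F. c t * y t) \<in> {v c<..}}" for c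
  define U0 where "U0 = (\<Union>h\<in>energy_ball \<alpha>. Uh h)"
  have "openin ?X (Uh h)" for h unfolding Uh_def using F by (subst openin_PiE) auto
  then have o0: "openin ?X U0" unfolding U0_def by blast
  have oc: "openin ?X (Uc c)" for c
    unfolding Uc_def
    by (rule openin_continuous_map_preimage[where Y = euclideanreal])
      (auto intro!: continuous_map_sum continuous_map_real_mult F continuous_map_product_projection)
  have K: "compactin ?X (PiE F (\<lambda>_. {-R..R}))" by (subst compactin_PiE) auto
  have cover: "PiE F (\<lambda>_. {-R..R}) \<subseteq> \<Union>(insert U0 (range Uc))"
  proof
    fix y assume y: "y \<in> PiE F (\<lambda>_. {-R..R})"
    then have top: "y \<in> topspace ?X" by (auto simp: PiE_def)
    show "y \<in> \<Union>(insert U0 (range Uc))"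
    proof (cases "\<exists>c. v c < (\<Sum>t\<in>F. c t * y t)")
      case True
      then show ?thesis using top by (auto simp: Uc_def)
    next
      case False
      have "\<exists>h\<in>energy_ball \<alpha>. \<forall>t\<in>F. pairing h t = y t"
      proof -
        have *: "(\<Sum>t\<in>F'. c t * y t) \<le> \<alpha> + var (\<lambda>x. \<Sum>t\<in>F'. c t * tailw t x) / 2" if "finite F'" "F' \<subseteq> F" for F' c
        proof -
          have "(\<Sum>t\<in>F. (if t \<in> F' then c t else 0) * y t) \<le> v (\<lambda>t. if t \<in> F' then c t else 0)"
            using False by (simp add: not_less)
          then show ?thesis unfolding v_def by (simp only: sum_restrict_coeff[OF F that(2)])
        qed
        show ?thesis by (rule energy_ball_of_dual[of F y \<alpha>, OF *]) auto
      qed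
      then obtain h where h: "h \<in> energy_ball \<alpha>" "\<forall>t\<in>F. pairing h t = y t" by blast
      then have "y \<in> Uh h" unfolding Uh_def using y r by (auto simp: PiE_iff)
      then show ?thesis using h by (auto simp: U0_def)
    qed
  qed
  obtain \<F> where \<F>: "finite \<F>" "\<F> \<subseteq> insert U0 (range Uc)" "PiE F (\<lambda>_. {-R..R}) \<subseteq> \<Union>\<F>"
  proof -
    have "openin ?X U" if "U \<in> insert U0 (range Uc)" for U using that o0 oc by auto
    from compactinD[OF K this cover] show ?thesis using that by blast
  qed
  have "finite (\<F> - {U0})" "\<F> - {U0} \<subseteq> Uc ` UNIV" using \<F> by auto
  then obtain C where C: "finite C" "\<F> - {U0} = Uc ` C" using finite_subset_image[of "\<F> - {U0}" Uc UNIV] by auto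
  show ?thesis
  proof (rule that[OF C(1)])
    fix y :: "real \<Rightarrow> real"
    assume R: "\<And>t. t \<in> F \<Longrightarrow> \<bar>y t\<bar> \<le> R"
      and hs: "\<And>c. c \<in> C \<Longrightarrow> (\<Sum>t\<in>F. c t * y t) \<le> \<alpha> + var (\<lambda>x. \<Sum>t\<in>F. c t * tailw t x) / 2"
    let ?y = "restrict y F"
    have "?y \<in> PiE F (\<lambda>_. {-R..R})" using R by (auto simp: abs_le_iff) (metis minus_le_iff)
    then have "?y \<in> \<Union>\<F>" using \<F>(3) by blast
    moreover have "?y \<notin> Uc c" if "c \<in> C" for c
      using hs[OF that] by (simp add: Uc_def v_def)
    ultimately have "?y \<in> U0" using C(2) by blast
    then obtain h where "h \<in> energy_ball \<alpha>" "?y \<in> Uh h" by (auto simp: U0_def)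
    then show "\<exists>h\<in>energy_ball \<alpha>. \<forall>t\<in>F. \<bar>y t - pairing h t\<bar> < r"
      by (intro bexI[of _ h]) (auto simp: Uh_def dist_real_def abs_minus_commute PiE_iff)
  qed
qed

section \<open>Upper bound for the tail process\<close>

text \<open>A net on which \<open>Z\<close> and all the paths oscillate by at most
  \<open>r / 3\<close> reduces the uniform distance to \<open>half_space_cover\<close>. The loss
  \<open>e\<close> is spent in quarters: one in the Chernoff bounds and three in unions of
  exceptional events.\<close>

lemma Z_upper:
  assumes ab: "a < b" and at: "no_atoms a b" and r: "0 < r" and \<alpha>: "0 \<le> \<alpha>" and e: "0 < e"
  shows "likely (\<alpha> - e) (\<lambda>n \<omega>. \<exists>h\<in>energy_ball \<alpha>. \<forall>t\<in>{a..b}. \<bar>Z n t \<omega> - pairing h t\<bar> < r)"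
proof -
  obtain d where d: "0 < d" "likely \<alpha> (\<lambda>n \<omega>. \<forall>s\<in>{a..b}. \<forall>t\<in>{a..b}. \<bar>s - t\<bar> \<le> d \<longrightarrow> \<bar>Z n s \<omega> - Z n t \<omega>\<bar> \<le> r / 3)"
    using Z_modulus_likely[OF ab at, of "r/3" \<alpha>] r \<alpha> by auto
  obtain d' where d': "0 < d'" "\<And>h s t. h \<in> energy_ball \<alpha> \<Longrightarrow> s \<in> {a..b} \<Longrightarrow> t \<in> {a..b} \<Longrightarrow> \<bar>s - t\<bar> < d' \<Longrightarrow> \<bar>pairing h s - pairing h t\<bar> < r / 3"
    using pairing_equicontinuous[OF at, of "r/3" \<alpha>] r \<alpha> by auto
  obtain R where R: "0 < R" "likely \<alpha> (\<lambda>n \<omega>. \<forall>t\<in>{a..b}. \<bar>Z n t \<omega>\<bar> \<le> R)"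
    using Z_bound_likely[OF ab at \<alpha>] by blast
  obtain F where F: "finite F" "F \<subseteq> {a..b}" "\<And>t. t \<in> {a..b} \<Longrightarrow> \<exists>s\<in>F. \<bar>s - t\<bar> < min d d'"
    using finite_net[OF ab, of "min d d'"] d d' by auto
  have r3: "0 < r / 3" using r by simp
  obtain C where C: "finite C" "\<And>y. (\<And>t. t \<in> F \<Longrightarrow> \<bar>y t\<bar> \<le> R) \<Longrightarrow>
       (\<And>c. c \<in> C \<Longrightarrow> (\<Sum>t\<in>F. c t * y t) \<le> \<alpha> + var (\<lambda>x. \<Sum>t\<in>F. c t * tailw t x) / 2) \<Longrightarrow>
       \<exists>h\<in>energy_ball \<alpha>. \<forall>t\<in>F. \<bar>y t - pairing h t\<bar> < r / 3"
    by (rule half_space_cover[OF F(1) r3, where R = R and \<alpha> = \<alpha>]) blast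
  have e4: "0 < e / 4" using e by simp
  have "likely (\<alpha> - e/4 - e/4) (\<lambda>n \<omega>. \<forall>c\<in>C. (\<Sum>t\<in>F. c t * Z n t \<omega>) \<le> \<alpha> + var (\<lambda>x. \<Sum>t\<in>F. c t * tailw t x) / 2)"
  proof (rule likely_ball[OF C(1) e4])
    fix c
    have "S n (\<lambda>x. \<Sum>t\<in>F. c t * tailw t x) \<omega> = (\<Sum>t\<in>F. c t * Z n t \<omega>)" for n \<omega>
      unfolding Z_tailw by (intro S_sum lin_growth_integrable lin_growth_tailw)
    moreover have lg: "lin_growth (\<lambda>x. \<Sum>t\<in>F. c t * tailw t x)" by (intro lin_growth_sum lin_growth_tailw)
    ultimately show "likely (\<alpha> - e/4 - e/4 + e/4) (\<lambda>n \<omega>. (\<Sum>t\<in>F. c t * Z n t \<omega>) \<le> \<alpha> + var (\<lambda>x. \<Sum>t\<in>F. c t * tailw t x) / 2)"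
      using Chernoff_likely[OF lg e4, of \<alpha>] by simp
  qed
  moreover have "\<alpha> - e/4 - e/4 = \<alpha> - e + e/4 + e/4" by (simp add: field_simps)
  ultimately have 1: "likely (\<alpha> - e + e/4 + e/4) (\<lambda>n \<omega>. \<forall>c\<in>C. (\<Sum>t\<in>F. c t * Z n t \<omega>) \<le> \<alpha> + var (\<lambda>x. \<Sum>t\<in>F. c t * tailw t x) / 2)"
    by (simp only:)
  have 2: "likely (\<alpha> - e + e/4 + e/4) (\<lambda>n \<omega>. \<forall>s\<in>{a..b}. \<forall>t\<in>{a..b}. \<bar>s - t\<bar> \<le> d \<longrightarrow> \<bar>Z n s \<omega> - Z n t \<omega>\<bar> \<le> r / 3)"
    using e by (intro likely_mono_rate[OF d(2)]) simp
  have 3: "likely (\<alpha> - e + e/4) (\<lambda>n \<omega>. \<forall>t\<in>{a..b}. \<bar>Z n t \<omega>\<bar> \<le> R)"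
    using e by (intro likely_mono_rate[OF R(2)]) simp
  show ?thesis
  proof (rule likely_mono[OF likely_conj[OF e4 likely_conj[OF e4 1 2] 3]], intro always_eventually allI ballI impI, elim conjE)
    fix n \<omega>
    assume hs: "\<forall>c\<in>C. (\<Sum>t\<in>F. c t * Z n t \<omega>) \<le> \<alpha> + var (\<lambda>x. \<Sum>t\<in>F. c t * tailw t x) / 2"
      and md: "\<forall>s\<in>{a..b}. \<forall>t\<in>{a..b}. \<bar>s - t\<bar> \<le> d \<longrightarrow> \<bar>Z n s \<omega> - Z n t \<omega>\<bar> \<le> r / 3"
      and bd: "\<forall>t\<in>{a..b}. \<bar>Z n t \<omega>\<bar> \<le> R"
    obtain h where h: "h \<in> energy_ball \<alpha>" "\<forall>t\<in>F. \<bar>Z n t \<omega> - pairing h t\<bar> < r / 3"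
      using C(2)[of "\<lambda>t. Z n t \<omega>"] hs bd F(2) by blast
    have "\<bar>Z n t \<omega> - pairing h t\<bar> < r" if t: "t \<in> {a..b}" for t
    proof -
      obtain s where s: "s \<in> F" "\<bar>s - t\<bar> < min d d'" using F(3)[OF t] by blast
      then have "s \<in> {a..b}" using F by blast
      then have "\<bar>Z n s \<omega> - Z n t \<omega>\<bar> \<le> r / 3" "\<bar>pairing h s - pairing h t\<bar> < r / 3"
        using md t s d'(2)[OF h(1) \<open>s \<in> {a..b}\<close> t] by auto
      moreover have "\<bar>Z n s \<omega> - pairing h s\<bar> < r / 3" using h s by blast
      ultimately show ?thesis by linarith
    qed
    then show "\<exists>h\<in>energy_ball \<alpha>. \<forall>t\<in>{a..b}. \<bar>Z n t \<omega> - pairing h t\<bar> < r" using h by blast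
  qed
qed

section \<open>Lower bound by exponential tilting\<close>

lemma S_add_scaled:
  assumes "lin_growth h" "lin_growth \<phi>"
  shows "S n (\<lambda>x. h x + s * \<phi> x) \<omega> = S n h \<omega> + s * S n \<phi> \<omega>"
  using S_lincomb[of h \<phi> n 1 s \<omega>] assms lin_growth_integrable by simp

text \<open>Tilting by \<open>h\<close> moves \<open>S n \<phi>\<close> to about
  \<open>cov h \<phi>\<close>. Chernoff's bound under the tilt, with the additional tilt
  \<open>s * \<phi> x\<close>, makes an excess \<open>x\<close> lower the exponent by
  \<open>x\<^sup>2 / (2 * (A + 1))\<close> relative to \<open>var h / 2\<close>, the exponent of the
  normalising constant, up to \<open>e\<close>.\<close>

lemma tilted_tail:
  assumes h: "lin_growth h" and \<phi>: "lin_growth \<phi>" and A: "var \<phi> \<le> A" and x: "0 < x" and e: "0 < e"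
  shows "\<forall>\<^sub>F n in sequentially. expectation (\<lambda>\<omega>. exp ((lam n)\<^sup>2 * S n h \<omega>) * indicator {\<omega>\<in>space M. cov h \<phi> + x \<le> S n \<phi> \<omega>} \<omega>)
    \<le> exp ((lam n)\<^sup>2 * (var h / 2 - x\<^sup>2 / (2 * (A + 1)) + e))"
proof -
  have "0 \<le> var \<phi>" unfolding var_def by simp
  then have A0: "0 < A + 1" using A by linarith
  \<comment> \<open>The optimal additional tilt for the variance \<open>A + 1\<close>; the 1 keeps
    the denominator positive when \<open>A\<close> is 0.\<close>
  define s where "s = x / (A + 1)"
  have s: "0 < s" using x A0 by (simp add: s_def)
  let ?g = "\<lambda>y. h y + s * \<phi> y"
  have g: "lin_growth ?g" using lin_growth_lincomb[OF h \<phi>, of 1 s] by simp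
  note [measurable] = lin_growth_measurable[OF h] lin_growth_measurable[OF \<phi>] lin_growth_measurable[OF g]
  have vg: "var ?g / 2 - s * (cov h \<phi> + x) \<le> var h / 2 - x\<^sup>2 / (2 * (A + 1))"
  proof -
    have "s\<^sup>2 * var \<phi> \<le> s\<^sup>2 * (A + 1)" using A by (intro mult_left_mono) auto
    also have "\<dots> = s * x" using A0 by (simp add: s_def power2_eq_square)
    finally have "var ?g / 2 - s * (cov h \<phi> + x) \<le> var h / 2 - s * x / 2"
      unfolding var_lincomb[OF h \<phi>] by (simp add: field_simps)
    also have "s * x / 2 = x\<^sup>2 / (2 * (A + 1))" by (simp add: s_def power2_eq_square)
    finally show ?thesis .
  qed
  show ?thesis
    using exp_S_asymp[OF g e] eventually_ge_at_top[of 1]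
  proof eventually_elim
    case (elim n)
    let ?c = "exp (- ((lam n)\<^sup>2 * (s * (cov h \<phi> + x))))"
    have "expectation (\<lambda>\<omega>. exp ((lam n)\<^sup>2 * S n h \<omega>) * indicator {\<omega>\<in>space M. cov h \<phi> + x \<le> S n \<phi> \<omega>} \<omega>)
      \<le> expectation (\<lambda>\<omega>. exp ((lam n)\<^sup>2 * S n ?g \<omega>) * ?c)"
    proof (rule integral_mono)
      show "integrable M (\<lambda>\<omega>. exp ((lam n)\<^sup>2 * S n h \<omega>) * indicator {\<omega>\<in>space M. cov h \<phi> + x \<le> S n \<phi> \<omega>} \<omega>)"
        using exp_S(1)[OF h elim(2)] by (intro integrable_real_mult_indicator) measurable
      show "integrable M (\<lambda>\<omega>. exp ((lam n)\<^sup>2 * S n ?g \<omega>) * ?c)"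
        using exp_S(1)[OF g elim(2)] by simp
      fix \<omega> assume "\<omega> \<in> space M"
      show "exp ((lam n)\<^sup>2 * S n h \<omega>) * indicator {\<omega>\<in>space M. cov h \<phi> + x \<le> S n \<phi> \<omega>} \<omega> \<le> exp ((lam n)\<^sup>2 * S n ?g \<omega>) * ?c"
      proof (cases "cov h \<phi> + x \<le> S n \<phi> \<omega>")
        case True
        then have "S n h \<omega> \<le> S n ?g \<omega> - s * (cov h \<phi> + x)"
          unfolding S_add_scaled[OF h \<phi>] using s by simp
        then have "(lam n)\<^sup>2 * S n h \<omega> \<le> (lam n)\<^sup>2 * (S n ?g \<omega> - s * (cov h \<phi> + x))" by (intro mult_left_mono) auto
        then have "exp ((lam n)\<^sup>2 * S n h \<omega>) \<le> exp ((lam n)\<^sup>2 * S n ?g \<omega> + - ((lam n)\<^sup>2 * (s * (cov h \<phi> + x))))"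
          unfolding exp_le_cancel_iff by (simp add: algebra_simps)
        also have "\<dots> = exp ((lam n)\<^sup>2 * S n ?g \<omega>) * ?c" by (rule exp_add)
        finally show ?thesis using True by (simp add: indicator_def)
      qed simp
    qed
    also have "\<dots> = expectation (\<lambda>\<omega>. exp ((lam n)\<^sup>2 * S n ?g \<omega>)) * ?c" by simp
    also have "\<dots> \<le> exp ((lam n)\<^sup>2 * (var ?g / 2 + e)) * ?c" using elim by (intro mult_right_mono) auto
    also have "\<dots> = exp ((lam n)\<^sup>2 * (var ?g / 2 - s * (cov h \<phi> + x) + e))"
      by (simp add: exp_add[symmetric] algebra_simps)
    also have "\<dots> \<le> exp ((lam n)\<^sup>2 * (var h / 2 - x\<^sup>2 / (2 * (A + 1)) + e))"
      unfolding exp_le_cancel_iff using vg by (intro mult_left_mono) auto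
    finally show ?case .
  qed
qed

text \<open>The density \<open>L\<close> is integrated over the \<open>B i\<close>, over
  \<open>E\<close> and over the rest. Off the \<open>B i\<close> it is at most \<open>u\<close>, so
  the rest must carry what is left of the expectation; this bounds an untilted probability from
  below.\<close>

lemma finite_sets_prob_lower:
  fixes k u :: real
  assumes fin: "finite I" and L: "integrable M L" "\<And>\<omega>. 0 \<le> L \<omega>" and B: "\<And>i. i \<in> I \<Longrightarrow> B i \<in> events"
    and E: "E \<in> events" "\<And>\<omega>. \<omega> \<in> space M \<Longrightarrow> \<omega> \<notin> (\<Union>i\<in>I. B i) \<Longrightarrow> L \<omega> \<le> u" and u: "0 \<le> u"
    and k: "\<And>i. i \<in> I \<Longrightarrow> expectation (\<lambda>\<omega>. L \<omega> * indicator (B i) \<omega>) \<le> k" and kE: "u * prob E \<le> k"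
  shows "expectation L - real (card I + 1) * k \<le> u * prob (space M - E - (\<Union>i\<in>I. B i))"
proof -
  let ?G = "space M - E - (\<Union>i\<in>I. B i)"
  have G: "?G \<in> events" using fin B E by auto
  have "expectation L \<le> expectation (\<lambda>\<omega>. u * indicator ?G \<omega> + u * indicator E \<omega> + (\<Sum>i\<in>I. L \<omega> * indicator (B i) \<omega>))"
  proof (rule integral_mono[OF L(1)])
    show "integrable M (\<lambda>\<omega>. u * indicator ?G \<omega> + u * indicator E \<omega> + (\<Sum>i\<in>I. L \<omega> * indicator (B i) \<omega>))"
      using G E B L fin by (intro Bochner_Integration.integrable_add integrable_mult_right Bochner_Integration.integrable_sum integrable_real_mult_indicator integrable_real_indicator) (auto simp: emeasure_eq_measure)
    fix \<omega> assume \<omega>: "\<omega> \<in> space M"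
    show "L \<omega> \<le> u * indicator ?G \<omega> + u * indicator E \<omega> + (\<Sum>i\<in>I. L \<omega> * indicator (B i) \<omega>)"
    proof (cases "\<exists>i\<in>I. \<omega> \<in> B i")
      case True
      then obtain i where i: "i \<in> I" "\<omega> \<in> B i" by blast
      have "L \<omega> * indicator (B i) \<omega> \<le> (\<Sum>i\<in>I. L \<omega> * indicator (B i) \<omega>)"
        using L fin i by (intro member_le_sum) auto
      moreover have "0 \<le> u * indicator ?G \<omega>" "0 \<le> u * indicator E \<omega>" using u by auto
      moreover have "indicator (B i) \<omega> = (1::real)" using i by simp
      ultimately show ?thesis by (simp only: mult_1_right)
    next
      case False
      then have "L \<omega> \<le> u" using E(2)[OF \<omega>] by blast
      moreover have "(\<Sum>i\<in>I. L \<omega> * indicator (B i) \<omega>) = 0" using False by (intro sum.neutral) auto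
      moreover have "u * indicator ?G \<omega> + u * indicator E \<omega> = u"
        using \<omega> False by (cases "\<omega> \<in> E") auto
      ultimately show ?thesis by linarith
    qed
  qed
  also have "\<dots> = u * prob ?G + u * prob E + (\<Sum>i\<in>I. expectation (\<lambda>\<omega>. L \<omega> * indicator (B i) \<omega>))"
  proof -
    have 1: "integrable M (\<lambda>\<omega>. u * indicator ?G \<omega>)" "integrable M (\<lambda>\<omega>. u * indicator E \<omega>)"
      using G E by (auto intro!: integrable_mult_right integrable_real_indicator simp: emeasure_eq_measure)
    have 2: "integrable M (\<lambda>\<omega>. L \<omega> * indicator (B i) \<omega>)" if "i \<in> I" for i
      using L B that by (intro integrable_real_mult_indicator)
    have 3: "integrable M (\<lambda>\<omega>. \<Sum>i\<in>I. L \<omega> * indicator (B i) \<omega>)" using 2 by (intro Bochner_Integration.integrable_sum)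
    have 4: "expectation (\<lambda>\<omega>. \<Sum>i\<in>I. L \<omega> * indicator (B i) \<omega>) = (\<Sum>i\<in>I. expectation (\<lambda>\<omega>. L \<omega> * indicator (B i) \<omega>))"
      using 2 by (intro Bochner_Integration.integral_sum)
    have 5: "expectation (\<lambda>\<omega>. u * indicator S \<omega>) = u * prob S" if "S \<in> events" for S
      using sets.sets_into_space[OF that] by (simp add: Int_absorb2)
    show ?thesis
      by (subst Bochner_Integration.integral_add[OF Bochner_Integration.integrable_add[OF 1] 3], subst Bochner_Integration.integral_add[OF 1]) (simp only: 4 5[OF G] 5[OF E(1)])
  qed
  also have "(\<Sum>i\<in>I. expectation (\<lambda>\<omega>. L \<omega> * indicator (B i) \<omega>)) \<le> card I * k"
    using sum_bounded_above[of I "\<lambda>i. expectation (\<lambda>\<omega>. L \<omega> * indicator (B i) \<omega>)" k] k by simp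
  finally show ?thesis using kE by (simp add: algebra_simps)
qed

lemma var_tailw_le: "var (tailw t) \<le> (LINT x|\<nu>. (w x)\<^sup>2)"
proof -
  have "var (tailw t) \<le> (LINT x|\<nu>. (0 + tailw t x)\<^sup>2)" by (rule var_le[OF lin_growth_tailw])
  also have "\<dots> \<le> (LINT x|\<nu>. (w x)\<^sup>2)"
    using L2_sq[OF lin_growth_L2[OF lin_growth_tailw]] lin_growth_integrable_sq[OF lin_growth_w[of UNIV]]
    by (intro integral_mono) (auto simp: tailw_def split: split_indicator)
  finally show ?thesis .
qed

text \<open>Under the tilt by \<open>h\<close>, \<open>Z n t\<close> concentrates at
  \<open>cov h (tailw t)\<close>, which is \<open>pairing h t\<close>. Points of a finite net are
  handled by \<open>tilted_tail\<close>, the others by the modulus of continuity. The exceptional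
  event of the latter is small under the original measure, and its rate must survive multiplication
  by the tilting density.\<close>

lemma Z_lower_lin_growth:
  assumes ab: "a < b" and at: "no_atoms a b" and h: "lin_growth h" "mean h = 0" and r: "0 < r" and e: "0 < e"
  shows "\<forall>\<^sub>F n in sequentially. \<exists>E\<in>events. exp (- (var h / 2 + e) * (lam n)\<^sup>2) \<le> prob E \<and>
    (\<forall>\<omega>\<in>E. \<forall>t\<in>{a..b}. \<bar>Z n t \<omega> - pairing h t\<bar> < r)"
proof -
  define v where "v = var h"
  have v0: "0 \<le> v" by (simp add: v_def var_def)
  have vh: "v = (LINT x|\<nu>. (h x)\<^sup>2)" using var_eq[OF h(1)] h(2) by (simp add: v_def)
  have hL2: "h \<in> L2 \<nu>" by (rule lin_growth_L2[OF h(1)])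
  have hball: "h \<in> energy_ball (v / 2)" using hL2 h vh by (simp add: energy_ball_def)
  \<comment> \<open>\<open>x \<le> e / 2\<close> pays for bounding the density by
    \<open>exp ((lam n)\<^sup>2 * (v + x))\<close>; \<open>x \<le> r / 3\<close> is the tolerance at
    the net points.\<close>
  define x where "x = min (e / 2) (r / 3)"
  have x: "0 < x" "x \<le> e / 2" "x \<le> r / 3" using e r by (auto simp: x_def)
  define A where "A = max v (LINT x|\<nu>. (w x)\<^sup>2)"
  have A: "v \<le> A" "var (tailw t) \<le> A" for t using var_tailw_le[of t] by (auto simp: A_def)
  define \<kappa> where "\<kappa> = x\<^sup>2 / (2 * (A + 1))"
  have \<kappa>: "0 < \<kappa>" using x A(1) v0 by (simp add: \<kappa>_def)
  \<comment> \<open>\<open>3 * e' \<le> \<kappa>\<close> brings the exponent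
    \<open>v / 2 - \<kappa> + e'\<close> of the bad sets down to \<open>v / 2 - 2 * e'\<close>,
    below the exponent \<open>v / 2 - e'\<close> guaranteed for the total mass of the tilt.\<close>
  define e' where "e' = min (\<kappa> / 3) (e / 4)"
  have e': "0 < e'" "e' \<le> \<kappa> / 3" "e' \<le> e / 4" using \<kappa> e by (auto simp: e'_def)
  \<comment> \<open>With this rate, the exceptional event has mass at most
    \<open>exp (- 2 * e' * (lam n)\<^sup>2)\<close> even after multiplication by the density bound
    \<open>u\<close>.\<close>
  define K where "K = v + x + 2 * e'"
  have K0: "0 \<le> K" using v0 x e' by (simp add: K_def)
  obtain d where d: "0 < d" "likely K (\<lambda>n \<omega>. \<forall>s\<in>{a..b}. \<forall>t\<in>{a..b}. \<bar>s - t\<bar> \<le> d \<longrightarrow> \<bar>Z n s \<omega> - Z n t \<omega>\<bar> \<le> r / 6)"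
    using Z_modulus_likely[OF ab at, of "r/6" K] r K0 by auto
  obtain d' where d': "0 < d'" "\<And>h' s t. h' \<in> energy_ball (v / 2) \<Longrightarrow> s \<in> {a..b} \<Longrightarrow> t \<in> {a..b} \<Longrightarrow> \<bar>s - t\<bar> < d' \<Longrightarrow> \<bar>pairing h' s - pairing h' t\<bar> < r / 3"
    using pairing_equicontinuous[OF at, of "r/3" "v / 2"] r v0 by auto
  obtain F where F: "finite F" "F \<subseteq> {a..b}" "\<And>t. t \<in> {a..b} \<Longrightarrow> \<exists>s\<in>F. \<bar>s - t\<bar> < min d d'"
    using finite_net[OF ab, of "min d d'"] d d' by auto
  \<comment> \<open>\<open>h\<close> itself is included because the upper bound on
    \<open>S n h\<close> is what bounds the density. Both signs of \<open>tailw t\<close> give the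
    two-sided estimate of \<open>Z\<close>.\<close>
  define \<Phi> where "\<Phi> = insert h (tailw ` F \<union> (\<lambda>t x. 0 + (-1) * tailw t x) ` F)"
  have fin: "finite \<Phi>" using F by (simp add: \<Phi>_def)
  have lgm: "lin_growth (\<lambda>x. 0 + (-1) * tailw t x)" for t
    using lin_growth_lincomb[OF lin_growth_const[of 0] lin_growth_tailw, of 1 "-1" t] by simp
  have vm: "var (\<lambda>x. 0 + (-1) * tailw t x) = var (tailw t)" for t
    unfolding var_lincomb[OF lin_growth_const lin_growth_tailw] by (simp add: var_def cov_def mean_def nu.prob_space[simplified])
  have \<Phi>: "lin_growth \<phi> \<and> var \<phi> \<le> A" if "\<phi> \<in> \<Phi>" for \<phi>
    using that h(1) A lin_growth_tailw lgm unfolding \<Phi>_def by (auto simp: vm[simplified] v_def)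
  define B where "B n \<phi> = {\<omega>\<in>space M. cov h \<phi> + x \<le> S n \<phi> \<omega>}" for n \<phi>
  have Bm: "B n \<phi> \<in> events" if "\<phi> \<in> \<Phi>" for n \<phi>
  proof -
    have [measurable]: "\<phi> \<in> borel_measurable borel" using \<Phi>[OF that] lin_growth_measurable by blast
    show ?thesis unfolding B_def by measurable
  qed
  have ev: "\<forall>\<^sub>F n in sequentially. \<forall>\<phi>\<in>\<Phi>. expectation (\<lambda>\<omega>. exp ((lam n)\<^sup>2 * S n h \<omega>) * indicator (B n \<phi>) \<omega>)
      \<le> exp ((lam n)\<^sup>2 * (v / 2 - \<kappa> + e'))"
    unfolding B_def v_def \<kappa>_def using \<Phi> e' x fin h(1) by (intro eventually_ball_finite ballI tilted_tail) auto
  show ?thesis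
    using ev d(2)[unfolded likely_def] exp_S_asymp[OF h(1) e'(1)] eventually_ge_at_top[of 1]
      eventually_card_le_exp[OF e'(1), of "2 * (card \<Phi> + 1)"] eventually_card_le_exp[OF e'(1), of 2]
  proof eventually_elim
    case (elim n)
    define L where "L \<omega> = exp ((lam n)\<^sup>2 * S n h \<omega>)" for \<omega>
    define u where "u = exp ((lam n)\<^sup>2 * (v + x))"
    define k where "k = exp ((lam n)\<^sup>2 * (v / 2 - 2 * e'))"
    obtain E where E: "E \<in> events" "prob E \<le> exp (- K * (lam n)\<^sup>2)"
      "\<forall>\<omega>\<in>space M - E. \<forall>s\<in>{a..b}. \<forall>t\<in>{a..b}. \<bar>s - t\<bar> \<le> d \<longrightarrow> \<bar>Z n s \<omega> - Z n t \<omega>\<bar> \<le> r / 6"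
      using elim(2) by blast
    let ?G = "space M - E - (\<Union>\<phi>\<in>\<Phi>. B n \<phi>)"
    have chh: "cov h h = v" unfolding v_def cov_def var_def by (simp add: power2_eq_square)
    have "expectation L - (card \<Phi> + 1) * k \<le> u * prob ?G"
    proof (rule finite_sets_prob_lower[OF fin])
      show "integrable M L" unfolding L_def[abs_def] using exp_S(1)[OF h(1) elim(4)] .
      show "B n i \<in> events" if "i \<in> \<Phi>" for i by (rule Bm[OF that])
      show "L \<omega> \<le> u" if "\<omega> \<in> space M" "\<omega> \<notin> (\<Union>i\<in>\<Phi>. B n i)" for \<omega>
      proof -
        have "h \<in> \<Phi>" by (simp add: \<Phi>_def)
        then have "S n h \<omega> \<le> v + x" using that by (auto simp: B_def chh)
        then show ?thesis unfolding L_def u_def exp_le_cancel_iff by (intro mult_left_mono) auto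
      qed
      show "expectation (\<lambda>\<omega>. L \<omega> * indicator (B n i) \<omega>) \<le> k" if "i \<in> \<Phi>" for i
      proof -
        have "expectation (\<lambda>\<omega>. L \<omega> * indicator (B n i) \<omega>) \<le> exp ((lam n)\<^sup>2 * (v / 2 - \<kappa> + e'))"
          using elim(1) that by (simp add: L_def)
        also have "\<dots> \<le> k" unfolding k_def exp_le_cancel_iff using e' by (intro mult_left_mono) auto
        finally show ?thesis .
      qed
      have "u * prob E \<le> u * exp (- K * (lam n)\<^sup>2)" using E(2) by (intro mult_left_mono) (auto simp: u_def)
      also have "\<dots> = exp ((lam n)\<^sup>2 * (v + x - K))" by (simp add: u_def exp_add[symmetric] algebra_simps)
      also have "\<dots> \<le> k" unfolding k_def exp_le_cancel_iff using v0 by (intro mult_left_mono) (auto simp: K_def)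
      finally show "u * prob E \<le> k" .
    qed (use E in \<open>auto simp: L_def u_def\<close>)
    moreover have "exp ((lam n)\<^sup>2 * (v / 2 - e')) \<le> expectation L"
      using elim(3) by (simp add: L_def[abs_def] v_def)
    moreover have "(card \<Phi> + 1) * k \<le> exp ((lam n)\<^sup>2 * (v / 2 - e')) / 2"
    proof -
      have "real (2 * (card \<Phi> + 1)) * k \<le> exp (e' * (lam n)\<^sup>2) * k" using elim(5) by (intro mult_right_mono) (auto simp: k_def)
      also have "\<dots> = exp ((lam n)\<^sup>2 * (v / 2 - e'))" by (simp add: k_def exp_add[symmetric] algebra_simps)
      finally show ?thesis by (simp add: algebra_simps)
    qed
    ultimately have "exp ((lam n)\<^sup>2 * (v / 2 - e')) / 2 \<le> u * prob ?G" by linarith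
    moreover have "exp ((lam n)\<^sup>2 * (v / 2 - 2 * e')) \<le> exp ((lam n)\<^sup>2 * (v / 2 - e')) / 2"
    proof -
      have "2 * exp ((lam n)\<^sup>2 * (v / 2 - 2 * e')) \<le> exp (e' * (lam n)\<^sup>2) * exp ((lam n)\<^sup>2 * (v / 2 - 2 * e'))"
        using elim(6) by (intro mult_right_mono) auto
      also have "\<dots> = exp ((lam n)\<^sup>2 * (v / 2 - e'))" by (simp add: exp_add[symmetric] algebra_simps)
      finally show ?thesis by simp
    qed
    ultimately have "exp ((lam n)\<^sup>2 * (v / 2 - 2 * e')) \<le> u * prob ?G" by linarith
    then have "exp ((lam n)\<^sup>2 * (v / 2 - 2 * e')) * exp (- ((lam n)\<^sup>2 * (v + x))) \<le> u * prob ?G * exp (- ((lam n)\<^sup>2 * (v + x)))"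
      by (intro mult_right_mono) auto
    also have "u * prob ?G * exp (- ((lam n)\<^sup>2 * (v + x))) = prob ?G"
      by (simp add: u_def exp_minus)
    also have "exp ((lam n)\<^sup>2 * (v / 2 - 2 * e')) * exp (- ((lam n)\<^sup>2 * (v + x))) = exp ((lam n)\<^sup>2 * (- v / 2 - 2 * e' - x))"
      by (simp add: exp_add[symmetric] algebra_simps)
    finally have "exp ((lam n)\<^sup>2 * (- v / 2 - 2 * e' - x)) \<le> prob ?G" .
    moreover have "exp (- (var h / 2 + e) * (lam n)\<^sup>2) \<le> exp ((lam n)\<^sup>2 * (- v / 2 - 2 * e' - x))"
    proof -
      have "(lam n)\<^sup>2 * (- (v / 2 + e)) \<le> (lam n)\<^sup>2 * (- v / 2 - 2 * e' - x)" using x e' by (intro mult_left_mono) auto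
      then show ?thesis unfolding exp_le_cancel_iff by (simp add: v_def mult.commute)
    qed
    ultimately have pG: "exp (- (var h / 2 + e) * (lam n)\<^sup>2) \<le> prob ?G" by linarith
    have good: "\<bar>Z n t \<omega> - pairing h t\<bar> < r" if \<omega>: "\<omega> \<in> ?G" and t: "t \<in> {a..b}" for \<omega> t
    proof -
      obtain s where s: "s \<in> F" "\<bar>s - t\<bar> < min d d'" using F(3)[OF t] by blast
      then have sab: "s \<in> {a..b}" using F by blast
      have "\<bar>Z n s \<omega> - Z n t \<omega>\<bar> \<le> r / 6" using E(3) \<omega> s sab t by auto
      moreover have "\<bar>pairing h s - pairing h t\<bar> < r / 3" using s d'(2)[OF hball sab t] by auto
      moreover have cs: "cov h (tailw s) = pairing h s"
        unfolding pairing_def by (rule cov_center[OF hL2 h(2) lin_growth_L2[OF lin_growth_tailw]])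
      have "tailw s \<in> \<Phi>" using s by (auto simp: \<Phi>_def)
      then have "\<omega> \<notin> B n (tailw s)" using \<omega> by blast
      then have "Z n s \<omega> < pairing h s + x" using \<omega> by (simp add: B_def cs Z_tailw)
      moreover have "- Z n s \<omega> < - pairing h s + x"
      proof -
        let ?m = "\<lambda>x. 0 + (-1) * tailw s x"
        have "?m \<in> \<Phi>" using s by (auto simp: \<Phi>_def)
        then have "\<omega> \<notin> B n ?m" using \<omega> by blast
        moreover have "S n ?m \<omega> = - Z n s \<omega>"
          using S_add_scaled[OF lin_growth_const lin_growth_tailw, of n 0 "-1" s \<omega>] by (simp add: S_const Z_tailw)
        moreover have "cov h ?m = - pairing h s"
          using cov_center[OF hL2 h(2) lin_growth_L2[OF lgm], of s] by (simp add: pairing_def)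
        ultimately show ?thesis using \<omega> by (simp add: B_def)
      qed
      ultimately show ?thesis using x r by linarith
    qed
    show ?case
    proof (intro bexI[of _ ?G] conjI pG ballI)
      show "?G \<in> events" by (intro sets.Diff sets.top E(1) sets.finite_UN fin Bm)
    qed (use good in auto)
  qed
qed

text \<open>Truncations converge by dominated convergence. Recentring only brings them closer to
  \<open>h\<close>, which has mean 0, and the variance of a truncation is at most its second moment,
  hence at most that of \<open>h\<close>: the approximation costs no energy.\<close>

lemma bounded_approx:
  assumes h: "h \<in> L2 \<nu>" "mean h = 0" and e: "0 < e"
  obtains g where "lin_growth g" "mean g = 0" "(LINT x|\<nu>. (h x - g x)\<^sup>2) \<le> e" "var g \<le> (LINT x|\<nu>. (h x)\<^sup>2)"
proof -
  have [measurable]: "h \<in> borel_measurable borel" using L2_measurable[OF h(1)] by simp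
  define k where "k n x = (if \<bar>h x\<bar> \<le> real n then h x else 0)" for n x
  have [measurable]: "k n \<in> borel_measurable borel" for n unfolding k_def by measurable
  have lg: "lin_growth (k n)" for n by (rule lin_growth_bounded[of _ "real n"]) (auto simp: k_def)
  have "(\<lambda>n. LINT x|\<nu>. (h x - k n x)\<^sup>2) \<longlonglongrightarrow> (LINT x|\<nu>. 0)"
  proof (rule integral_dominated_convergence[where w = "\<lambda>x. (h x)\<^sup>2"])
    show "AE x in \<nu>. (\<lambda>n. (h x - k n x)\<^sup>2) \<longlonglongrightarrow> 0"
    proof (rule AE_I2)
      fix x
      obtain N where "\<bar>h x\<bar> \<le> real N" using real_arch_simple by blast
      then have "\<forall>\<^sub>F n in sequentially. (h x - k n x)\<^sup>2 = 0"
        by (intro eventually_sequentiallyI[of N]) (auto simp: k_def)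
      then show "(\<lambda>n. (h x - k n x)\<^sup>2) \<longlonglongrightarrow> 0" by (rule tendsto_eventually)
    qed
    show "AE x in \<nu>. norm ((h x - k n x)\<^sup>2) \<le> (h x)\<^sup>2" for n by (auto simp: k_def)
  qed (use L2_sq[OF h(1)] in measurable)
  then have "(\<lambda>n. LINT x|\<nu>. (h x - k n x)\<^sup>2) \<longlonglongrightarrow> 0" by simp
  from order_tendstoD(2)[OF this e] obtain n where n: "(LINT x|\<nu>. (h x - k n x)\<^sup>2) < e"
    by (auto simp: eventually_sequentially)
  define m where "m = mean (k n)"
  have kL2: "k n \<in> L2 \<nu>" by (rule lin_growth_L2[OF lg])
  have ih: "integrable \<nu> h" "integrable \<nu> (k n)" using L2_integrable[OF fin_nu] h kL2 by auto
  show ?thesis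
  proof (rule that[of "\<lambda>x. k n x - m"])
    show "lin_growth (\<lambda>x. k n x - m)" unfolding m_def by (rule lin_growth_center[OF lg])
    show "mean (\<lambda>x. k n x - m) = 0" using mean_center[OF ih(2)] by (simp add: m_def mean_def)
    have "(LINT x|\<nu>. (h x - (k n x - m))\<^sup>2) = (LINT x|\<nu>. (1 * (h x - k n x) + 1 * m)\<^sup>2)"
      by (simp add: algebra_simps)
    also have "\<dots> = (LINT x|\<nu>. (h x - k n x)\<^sup>2) + m\<^sup>2 + 2 * (LINT x|\<nu>. (h x - k n x) * m)"
      by (subst L2_lincomb_sq[OF L2_diff[OF h(1) kL2] L2_const[OF fin_nu]]) (simp add: nu.prob_space[simplified])
    also have "(LINT x|\<nu>. (h x - k n x) * m) = - m\<^sup>2"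
      using ih h(2) by (simp add: mean_def m_def power2_eq_square)
    finally show "(LINT x|\<nu>. (h x - (k n x - m))\<^sup>2) \<le> e" using n by (smt (verit) zero_le_power2)
    have "var (\<lambda>x. k n x - m) = var (k n)"
      unfolding var_def using mean_center[OF ih(2)] by (simp add: m_def mean_def[of "\<lambda>x. k n x - _"])
    also have "\<dots> \<le> (LINT x|\<nu>. (0 + k n x)\<^sup>2)" by (rule var_le[OF lg])
    also have "\<dots> \<le> (LINT x|\<nu>. (h x)\<^sup>2)"
      using L2_sq[OF kL2] L2_sq[OF h(1)] by (intro integral_mono) (auto simp: k_def)
    finally show "var (\<lambda>x. k n x - m) \<le> (LINT x|\<nu>. (h x)\<^sup>2)" .
  qed
qed

text \<open>Approximation by bounded functions: \<open>L2_pairing_bound\<close> makes the change of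
  the path uniform in \<open>t\<close>, and the energy does not increase, so \<open>\<alpha>\<close>
  is kept.\<close>

lemma Z_lower:
  assumes ab: "a < b" and at: "no_atoms a b" and h: "h \<in> energy_ball \<alpha>" and r: "0 < r" and e: "0 < e"
  shows "\<forall>\<^sub>F n in sequentially. \<exists>E\<in>events. exp (- (\<alpha> + e) * (lam n)\<^sup>2) \<le> prob E \<and>
    (\<forall>\<omega>\<in>E. \<forall>t\<in>{a..b}. \<bar>Z n t \<omega> - pairing h t\<bar> < r)"
proof -
  have h': "h \<in> L2 \<nu>" "mean h = 0" "(LINT x|\<nu>. (h x)\<^sup>2) / 2 \<le> \<alpha>" using h by (auto simp: energy_ball_def)
  define W where "W = (LINT x|\<nu>. (w x)\<^sup>2)"
  have W: "0 \<le> W" by (simp add: W_def)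
  define \<eta> where "\<eta> = (r / 2)\<^sup>2 / (W + 1)"
  have \<eta>: "0 < \<eta>" using W r by (simp add: \<eta>_def)
  obtain g where g: "lin_growth g" "mean g = 0" "(LINT x|\<nu>. (h x - g x)\<^sup>2) \<le> \<eta>" "var g \<le> (LINT x|\<nu>. (h x)\<^sup>2)"
    using bounded_approx[OF h'(1,2) \<eta>] by blast
  have gL2: "g \<in> L2 \<nu>" by (rule lin_growth_L2[OF g(1)])
  have close: "\<bar>pairing g t - pairing h t\<bar> \<le> r / 2" for t
  proof -
    have "pairing (\<lambda>x. h x - g x) t = pairing h t - pairing g t"
      unfolding pairing_def left_diff_distrib
      by (intro Bochner_Integration.integral_diff L2_mult[OF h'(1) lin_growth_L2[OF lin_growth_tailw]] L2_mult[OF gL2 lin_growth_L2[OF lin_growth_tailw]])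
    then have "(pairing h t - pairing g t)\<^sup>2 \<le> (LINT x|\<nu>. (h x - g x)\<^sup>2) * W"
      using L2_pairing_bound[OF L2_diff[OF h'(1) gL2], of t] by (simp add: W_def)
    also have "\<dots> \<le> \<eta> * W" using g(3) W by (intro mult_right_mono) auto
    also have "\<dots> \<le> (r / 2)\<^sup>2"
    proof -
      have "\<eta> * W \<le> \<eta> * (W + 1)" using \<eta> by (intro mult_left_mono) auto
      also have "\<dots> = (r / 2)\<^sup>2" using W by (simp add: \<eta>_def)
      finally show ?thesis .
    qed
    finally show ?thesis using r abs_le_square_iff[of "pairing h t - pairing g t" "r / 2"] by (simp add: abs_minus_commute)
  qed
  have "r / 2 > 0" using r by simp
  from Z_lower_lin_growth[OF ab at g(1,2) this e] show ?thesis
  proof (rule eventually_mono, elim bexE conjE)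
    fix n E assume E: "E \<in> events" "exp (- (var g / 2 + e) * (lam n)\<^sup>2) \<le> prob E" "\<forall>\<omega>\<in>E. \<forall>t\<in>{a..b}. \<bar>Z n t \<omega> - pairing g t\<bar> < r / 2"
    have "var g / 2 \<le> \<alpha>" using g(4) h'(3) by simp
    then have "exp (- (\<alpha> + e) * (lam n)\<^sup>2) \<le> exp (- (var g / 2 + e) * (lam n)\<^sup>2)"
      unfolding exp_le_cancel_iff by (intro mult_right_mono) auto
    then have "exp (- (\<alpha> + e) * (lam n)\<^sup>2) \<le> prob E" using E(2) by linarith
    moreover have "\<bar>Z n t \<omega> - pairing h t\<bar> < r" if "\<omega> \<in> E" "t \<in> {a..b}" for \<omega> t
    proof -
      have "\<bar>Z n t \<omega> - pairing g t\<bar> < r / 2" using E(3) that by blast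
      then show ?thesis using close[of t] by linarith
    qed
    ultimately show "\<exists>E\<in>events. exp (- (\<alpha> + e) * (lam n)\<^sup>2) \<le> prob E \<and> (\<forall>\<omega>\<in>E. \<forall>t\<in>{a..b}. \<bar>Z n t \<omega> - pairing h t\<bar> < r)"
      using E(1) by blast
  qed
qed

end

section \<open>The quantile process\<close>

lemma metric_space_euclidean: "Metric_space (UNIV :: real set) dist"
  using Metric_space_mspace_mdist[of "euclidean_metric :: real metric"] by simp

lemma l_infty_mem:
  assumes "g \<in> extensional {q..p}" "\<And>u. u \<in> {q..p} \<Longrightarrow> \<bar>g u\<bar> \<le> B"
  shows "g \<in> mspace (l_infty q p)"
proof -
  have "Metric_space.mbounded UNIV dist (g ` {q..p})"
    unfolding Metric_space.mbounded_def[OF metric_space_euclidean] Metric_space.mcball_def[OF metric_space_euclidean]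
    using assms(2) by (intro exI[of _ 0] exI[of _ B]) auto
  then show ?thesis using assms(1) by (simp add: l_infty_def Metric_space.fspace_def[OF metric_space_euclidean])
qed

lemma l_infty_dist_le:
  assumes "g \<in> mspace (l_infty q p)" "g' \<in> mspace (l_infty q p)" "q \<le> p"
    and "\<And>u. u \<in> {q..p} \<Longrightarrow> \<bar>g u - g' u\<bar> \<le> r"
  shows "mdist (l_infty q p) g g' \<le> r"
proof -
  have "(SUP u\<in>{q..p}. dist (g u) (g' u)) \<le> r"
    using assms by (intro cSUP_least) (auto simp: dist_real_def)
  then show ?thesis using assms by (simp add: l_infty_def Metric_space.fdist_def[OF metric_space_euclidean])
qed

lemma l_infty_extensional: "g \<in> mspace (l_infty q p) \<Longrightarrow> g \<in> extensional {q..p}"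
  unfolding l_infty_def by (rule funspace_imp_extensional)

text \<open>That \<open>\<mu>\<close> has density \<open>w\<close> with respect to
  \<open>\<nu>\<close> enters as the equality of tails \<open>tail_eq\<close>.\<close>

locale quantile_sample = weighted_sample M \<nu> w X lam + mu: real_distribution \<mu>
  for M :: "'a measure" and \<nu> w X lam and \<mu> :: "real measure" +
  fixes f :: "real \<Rightarrow> real" and q p \<epsilon> :: real
  assumes tail_eq: "tail \<mu> t = Tw t"
    and q: "0 < q" and qp: "q < p" and p: "p < 1" and eps: "0 < \<epsilon>"
    and f_cont: "continuous_on {ginv (tail \<mu>) p - \<epsilon> .. ginv (tail \<mu>) q + \<epsilon>} f"
    and f_pos: "t \<in> {ginv (tail \<mu>) p - \<epsilon> .. ginv (tail \<mu>) q + \<epsilon>} \<Longrightarrow> 0 < f t"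
    and f_density: "ginv (tail \<mu>) p - \<epsilon> \<le> s \<Longrightarrow> s \<le> t \<Longrightarrow> t \<le> ginv (tail \<mu>) q + \<epsilon> \<Longrightarrow>
           cdf \<mu> t - cdf \<mu> s = (LBINT x:{s..t}. f x)"
begin

section \<open>The true quantile function\<close>

definition tq :: "real \<Rightarrow> real" where "tq = ginv (tail \<mu>)"

lemma tail_fun: "tail \<mu> = Tw" using tail_eq by auto

lemma tq_eq: "tq u = Inf {t. Tw t \<le> u}" by (simp add: tq_def ginv_def tail_fun)

lemma f_bounds:
  obtains m C where "0 < m" "\<And>t. t \<in> {tq p - \<epsilon>..tq q + \<epsilon>} \<Longrightarrow> m \<le> f t \<and> f t \<le> C"
proof (cases "{tq p - \<epsilon>..tq q + \<epsilon>} = {}")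
  case False
  have c: "continuous_on {tq p - \<epsilon>..tq q + \<epsilon>} f" using f_cont by (simp add: tq_def)
  obtain x where x: "x \<in> {tq p - \<epsilon>..tq q + \<epsilon>}" "\<And>t. t \<in> {tq p - \<epsilon>..tq q + \<epsilon>} \<Longrightarrow> f x \<le> f t"
    using continuous_attains_inf[OF _ False c] by (metis compact_Icc)
  obtain y where y: "\<And>t. t \<in> {tq p - \<epsilon>..tq q + \<epsilon>} \<Longrightarrow> f t \<le> f y"
    using continuous_attains_sup[OF _ False c] by (metis compact_Icc)
  show ?thesis using x y f_pos[of x] by (intro that[of "f x" "f y"]) (auto simp: tq_def)
\<comment> \<open>The interval has not been shown to be nonempty at this point; if it is empty, any
  constants do.\<close>
qed (use that[of 1 1] in auto)

lemma Tw_diff_bounds: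
  assumes "tq p - \<epsilon> \<le> s" "s \<le> t" "t \<le> tq q + \<epsilon>" and c: "\<And>x. x \<in> {s..t} \<Longrightarrow> c \<le> f x \<and> f x \<le> c'"
  shows "c * (t - s) \<le> Tw s - Tw t" "Tw s - Tw t \<le> c' * (t - s)"
proof -
  have "Tw s - Tw t = cdf \<mu> t - cdf \<mu> s" using tail_eq[of s] tail_eq[of t] by (simp add: tail_def)
  also have "\<dots> = (LBINT x:{s..t}. f x)" using assms by (intro f_density) (auto simp: tq_def)
  finally have eq: "Tw s - Tw t = (LBINT x:{s..t}. f x)" .
  have cont: "continuous_on {s..t} f"
    by (rule continuous_on_subset[OF f_cont]) (use assms in \<open>auto simp: tq_def\<close>)
  have f: "set_integrable lborel {s..t} f" by (rule borel_integrable_atLeastAtMost'[OF cont])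
  have k: "set_integrable lborel {s..t} (\<lambda>_. k)" for k :: real by (rule borel_integrable_atLeastAtMost') simp
  have kk: "(LBINT x:{s..t}. k) = k * (t - s)" for k :: real
    using assms by (simp add: set_lebesgue_integral_def mult.commute)
  show "c * (t - s) \<le> Tw s - Tw t"
    unfolding eq kk[symmetric] using c by (intro set_integral_mono k f) auto
  show "Tw s - Tw t \<le> c' * (t - s)"
    unfolding eq kk[symmetric] using c by (intro set_integral_mono k f) auto
qed

lemma Tw_lim: "(Tw \<longlongrightarrow> 0) at_top" "(Tw \<longlongrightarrow> 1) at_bot"
proof -
  have T: "Tw = (\<lambda>t. 1 - cdf \<mu> t)" using tail_eq by (auto simp: tail_def)
  show "(Tw \<longlongrightarrow> 0) at_top" "(Tw \<longlongrightarrow> 1) at_bot"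
    unfolding T using tendsto_diff[OF tendsto_const mu.cdf_lim_at_top_prob, of 1] tendsto_diff[OF tendsto_const mu.cdf_lim_at_bot, of 1]
    by auto
qed

lemma level_set:
  assumes "u \<in> {q..p}"
  shows "{t. Tw t \<le> u} \<noteq> {}" "bdd_below {t. Tw t \<le> u}"
proof -
  have "0 < u" "u < 1" using assms q p by auto
  obtain t where "Tw t < u" using order_tendstoD(2)[OF Tw_lim(1) \<open>0 < u\<close>] by (auto dest: eventually_happens)
  then show "{t. Tw t \<le> u} \<noteq> {}" by (auto intro: less_imp_le)
  obtain s where s: "u < Tw s" using order_tendstoD(1)[OF Tw_lim(2) \<open>u < 1\<close>] by (auto dest: eventually_happens)
  have "s \<le> t" if "Tw t \<le> u" for t using Tw_antimono[of t s] s that by linarith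
  then show "bdd_below {t. Tw t \<le> u}" by (intro bdd_belowI[of _ s]) auto
qed

lemma Tw_less_tq: "u \<in> {q..p} \<Longrightarrow> t < tq u \<Longrightarrow> u < Tw t"
  using cInf_lower[OF _ level_set(2), of t u] unfolding tq_eq by (force simp: not_le[symmetric])

lemma Tw_ge_tq: "u \<in> {q..p} \<Longrightarrow> tq u < t \<Longrightarrow> Tw t \<le> u"
proof -
  assume "u \<in> {q..p}" "tq u < t"
  then obtain s where "Tw s \<le> u" "s < t" unfolding tq_eq using level_set[of u] by (auto simp: cInf_less_iff)
  then show "Tw t \<le> u" using Tw_antimono[of s t] by linarith
qed

lemma tq_antimono: "u \<in> {q..p} \<Longrightarrow> v \<in> {q..p} \<Longrightarrow> u \<le> v \<Longrightarrow> tq v \<le> tq u"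
  unfolding tq_eq by (intro cInf_superset_mono level_set) auto

lemma tq_range: "u \<in> {q..p} \<Longrightarrow> tq u \<in> {tq p..tq q}"
  using tq_antimono[of u p] tq_antimono[of q u] qp by auto

text \<open>\<open>f\<close> is bounded around \<open>tq u\<close>, so \<open>Tw\<close> is
  Lipschitz there. It exceeds \<open>u\<close> on the left of \<open>tq u\<close> and is at most
  \<open>u\<close> on the right, which squeezes its value at \<open>tq u\<close>.\<close>

lemma Tw_tq:
  assumes u: "u \<in> {q..p}"
  shows "Tw (tq u) = u"
proof -
  obtain m C where C: "0 < m" "\<And>t. t \<in> {tq p - \<epsilon>..tq q + \<epsilon>} \<Longrightarrow> m \<le> f t \<and> f t \<le> C" using f_bounds by metis
  have r: "tq p \<le> tq u" "tq u \<le> tq q" using tq_range[OF u] by auto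
  have C0: "0 < C" using C(1) C(2)[of "tq u"] r eps by auto
  show ?thesis
  proof (rule antisym; rule field_le_epsilon)
    fix e :: real assume e: "0 < e"
    define d where "d = min (e / C) \<epsilon>"
    have d: "0 < d" "d \<le> \<epsilon>" "C * d \<le> e" using e eps C0 by (auto simp: d_def min_def field_simps)
    have "Tw (tq u) - Tw (tq u + d) \<le> C * (tq u + d - tq u)"
      using r d C(2) by (intro Tw_diff_bounds(2)[where c = m]) auto
    moreover have "Tw (tq u + d) \<le> u" using d by (intro Tw_ge_tq u) simp
    ultimately show "Tw (tq u) \<le> u + e" using d by simp
    have "Tw (tq u - d) - Tw (tq u) \<le> C * (tq u - (tq u - d))"
      using r d C(2) by (intro Tw_diff_bounds(2)[where c = m]) auto
    moreover have "u < Tw (tq u - d)" using d by (intro Tw_less_tq u) simp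
    ultimately show "u \<le> Tw (tq u) + e" using d by simp
  qed
qed

lemma tq_p_less: "tq p < tq q"
proof -
  have "tq p \<noteq> tq q" using Tw_tq[of p] Tw_tq[of q] qp by auto
  then show ?thesis using tq_range[of p] qp by auto
qed

text \<open>Half of the margin is kept: \<open>{lo..hi}\<close> contains neighbourhoods of all the
  quantiles \<open>tq u\<close>, and its own points still have neighbourhoods on which the density
  \<open>f\<close> is available.\<close>

definition lo :: real where "lo = tq p - \<epsilon> / 2"

definition hi :: real where "hi = tq q + \<epsilon> / 2"

lemma lo_hi: "lo < hi" "tq p - \<epsilon> < lo" "lo < tq p" "tq q < hi" "hi < tq q + \<epsilon>"
  using tq_p_less eps by (auto simp: lo_def hi_def)

text \<open>The mass of a point is at most \<open>Tw (t - d) - Tw t \<le> C * d\<close> for every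
  small \<open>d\<close>.\<close>

lemma no_atoms_lo_hi: "no_atoms lo hi"
  unfolding no_atoms_def
proof (intro ballI antisym)
  fix t assume t: "t \<in> {lo..hi}"
  obtain m C where C: "0 < m" "\<And>t. t \<in> {tq p - \<epsilon>..tq q + \<epsilon>} \<Longrightarrow> m \<le> f t \<and> f t \<le> C" using f_bounds by metis
  have C0: "0 < C" using C(1) C(2)[of t] t lo_hi by auto
  show "(LINT x|\<nu>. w x * indicator {t} x) \<le> 0"
  proof (rule field_le_epsilon)
    fix e :: real assume e: "0 < e"
    define d where "d = min (e / C) (\<epsilon> / 2)"
    have d: "0 < d" "d \<le> \<epsilon> / 2" "C * d \<le> e" using e eps C0 by (auto simp: d_def min_def field_simps)
    have "(LINT x|\<nu>. w x * indicator {t} x) \<le> (LINT x|\<nu>. w x * indicator {t - d<..} x - w x * indicator {t<..} x)"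
      using w_nonneg d by (intro integral_mono Bochner_Integration.integrable_diff lin_growth_integrable lin_growth_w) (auto split: split_indicator)
    also have "\<dots> = Tw (t - d) - Tw t"
      unfolding Tw_def mean_def by (intro Bochner_Integration.integral_diff lin_growth_integrable lin_growth_w) auto
    also have "\<dots> \<le> C * (t - (t - d))"
      using t d C(2) lo_hi by (intro Tw_diff_bounds(2)[where c = m]) (auto simp: lo_def)
    finally show "(LINT x|\<nu>. w x * indicator {t} x) \<le> 0 + e" using d by simp
  qed
  show "0 \<le> (LINT x|\<nu>. w x * indicator {t} x)" using w_nonneg by (intro integral_nonneg_AE) auto
qed

section \<open>Comparison of the quantile deviation with the tail process\<close>

definition Yd :: "nat \<Rightarrow> 'a \<Rightarrow> real \<Rightarrow> real" where
  "Yd n \<omega> u = scale n * (ginv (\<lambda>t. Tn n t \<omega>) u - tq u)"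

text \<open>
  The event \<open>ginv Tn u \<le> s\<close> is the event \<open>Tn s \<le> u\<close>; with \<open>s = tq u + y / scale n\<close> and \<open>Tw s\<close> linearised at \<open>tq u\<close>
  it compares \<open>Z\<close> at \<open>tq u\<close> with \<open>f (tq u) * y\<close>, up to the modulus of continuity of \<open>Z\<close>.
\<close>

lemma ginv_bracket:
  assumes n: "n \<ge> 1" and R: "\<bar>Z n t \<omega>\<bar> \<le> R" and m: "0 < m" "m \<le> f t" and \<eta>: "0 < \<eta>"
    and osc: "\<And>x. \<bar>x\<bar> \<le> d \<Longrightarrow> \<bar>Z n (t + x) \<omega> - Z n t \<omega>\<bar> \<le> m * \<eta> / 4"
    and lin: "\<And>x. \<bar>x\<bar> \<le> d \<Longrightarrow> \<bar>Tw (t + x) - u + f t * x\<bar> \<le> k * \<bar>x\<bar>"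
    and k: "0 \<le> k" "k * (R / m + \<eta>) \<le> m * \<eta> / 4" and big: "(R / m + \<eta>) / scale n \<le> d"
  shows "\<bar>scale n * (ginv (\<lambda>t. Tn n t \<omega>) u - t) - Z n t \<omega> / f t\<bar> \<le> \<eta>"
proof -
  define v where "v = Z n t \<omega> / f t"
  have ft: "0 < f t" using m by linarith
  have b: "0 < scale n" by (rule scale_pos[OF n])
  have fv: "f t * v = Z n t \<omega>" using ft by (simp add: v_def)
  have v: "\<bar>v\<bar> \<le> R / m"
  proof -
    have "\<bar>v\<bar> = \<bar>Z n t \<omega>\<bar> / f t" using ft by (simp add: v_def abs_divide)
    also have "\<dots> \<le> R / m" using R m ft by (intro frac_le) auto
    finally show ?thesis .
  qed
  \<comment> \<open>The two errors are \<open>m * \<eta> / 4\<close> each: the oscillation of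
    \<open>Z\<close> and the linearisation of \<open>Tw\<close>. For \<open>y = v + \<eta>\<close>
    and \<open>y = v - \<eta>\<close> the main term has size
    \<open>f t * \<eta> \<ge> m * \<eta>\<close>, so the sign of
    \<open>Tn n (t + y / scale n) \<omega> - u\<close> is determined.\<close>
  have key: "\<bar>scale n * (Tn n (t + y / scale n) \<omega> - u) - f t * (v - y)\<bar> \<le> m * \<eta> / 2" if y: "\<bar>y\<bar> \<le> R / m + \<eta>" for y
  proof -
    let ?x = "y / scale n"
    have "\<bar>?x\<bar> = \<bar>y\<bar> / scale n" using b by (simp add: abs_divide)
    also have "\<dots> \<le> (R / m + \<eta>) / scale n" using y b by (intro divide_right_mono) auto
    finally have x: "\<bar>?x\<bar> \<le> d" using big by linarith
    have "\<bar>scale n * (Tw (t + ?x) - u) + f t * y\<bar> = scale n * \<bar>Tw (t + ?x) - u + f t * ?x\<bar>"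
    proof -
      have "scale n * (Tw (t + ?x) - u) + f t * y = scale n * (Tw (t + ?x) - u + f t * ?x)" using b by (simp add: algebra_simps)
      then show ?thesis using b by (simp add: abs_mult)
    qed
    also have "\<dots> \<le> scale n * (k * \<bar>?x\<bar>)" using lin[OF x] b by (intro mult_left_mono) auto
    also have "\<dots> = k * \<bar>y\<bar>" using b by (simp add: abs_divide)
    also have "\<dots> \<le> k * (R / m + \<eta>)" using k y by (intro mult_left_mono) auto
    finally have 1: "\<bar>scale n * (Tw (t + ?x) - u) + f t * y\<bar> \<le> m * \<eta> / 4" using k by linarith
    have "scale n * (Tn n (t + ?x) \<omega> - u) = Z n (t + ?x) \<omega> + scale n * (Tw (t + ?x) - u)"
      unfolding Z_eq[OF n] by (simp add: algebra_simps)
    moreover have "\<bar>Z n (t + ?x) \<omega> - Z n t \<omega>\<bar> \<le> m * \<eta> / 4" by (rule osc[OF x])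
    moreover have "f t * (v - y) = Z n t \<omega> - f t * y" using fv by (simp add: right_diff_distrib)
    ultimately show ?thesis using 1 by linarith
  qed
  have m\<eta>: "0 < m * \<eta>" "m * \<eta> \<le> f t * \<eta>" using m \<eta> by auto
  let ?A = "{s. Tn n s \<omega> \<le> u}"
  have up: "t + (v + \<eta>) / scale n \<in> ?A"
  proof -
    have "\<bar>scale n * (Tn n (t + (v + \<eta>) / scale n) \<omega> - u) - f t * (v - (v + \<eta>))\<bar> \<le> m * \<eta> / 2"
      using v \<eta> by (intro key) linarith
    moreover have "f t * (v - (v + \<eta>)) = - (f t * \<eta>)" by simp
    ultimately have "scale n * (Tn n (t + (v + \<eta>) / scale n) \<omega> - u) \<le> 0" using m\<eta> by linarith
    then show ?thesis using b by (simp add: mult_le_0_iff)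
  qed
  have down: "t + (v - \<eta>) / scale n \<le> s" if s: "s \<in> ?A" for s
  proof (rule ccontr)
    assume "\<not> ?thesis"
    then have "Tn n (t + (v - \<eta>) / scale n) \<omega> \<le> u" using Tn_antimono[of s "t + (v - \<eta>) / scale n" n \<omega>] s by auto
    then have "scale n * (Tn n (t + (v - \<eta>) / scale n) \<omega> - u) \<le> 0" using b by (simp add: mult_le_0_iff)
    moreover have "\<bar>scale n * (Tn n (t + (v - \<eta>) / scale n) \<omega> - u) - f t * (v - (v - \<eta>))\<bar> \<le> m * \<eta> / 2"
      using v \<eta> by (intro key) linarith
    moreover have "f t * (v - (v - \<eta>)) = f t * \<eta>" by simp
    ultimately show False using m\<eta> by linarith
  qed
  \<comment> \<open>\<open>up\<close> and \<open>down\<close> make the set nonempty and bounded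
    below, so \<open>Inf\<close> is a true infimum here.\<close>
  have "ginv (\<lambda>t. Tn n t \<omega>) u \<le> t + (v + \<eta>) / scale n"
    unfolding ginv_def using up down by (intro cInf_lower bdd_belowI) auto
  moreover have "t + (v - \<eta>) / scale n \<le> ginv (\<lambda>t. Tn n t \<omega>) u"
    unfolding ginv_def using up down by (intro cInf_greatest) auto
  ultimately have "ginv (\<lambda>t. Tn n t \<omega>) u - t \<le> (v + \<eta>) / scale n" "(v - \<eta>) / scale n \<le> ginv (\<lambda>t. Tn n t \<omega>) u - t" by linarith+
  from mult_left_mono[OF this(1) less_imp_le[OF b]] mult_left_mono[OF this(2) less_imp_le[OF b]]
  have "scale n * (ginv (\<lambda>t. Tn n t \<omega>) u - t) \<le> scale n * ((v + \<eta>) / scale n)"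
    "scale n * ((v - \<eta>) / scale n) \<le> scale n * (ginv (\<lambda>t. Tn n t \<omega>) u - t)" .
  then show ?thesis using b unfolding v_def[symmetric] by (simp add: abs_le_iff)
qed

text \<open>Outside an event of rate \<open>K\<close>, \<open>Z\<close> is bounded by
  \<open>R\<close> and has a modulus of continuity. For large \<open>n\<close> the shifts
  \<open>y / scale n\<close> with \<open>\<bar>y\<bar> \<le> R / m + \<eta>\<close> are then so
  small that \<open>ginv_bracket\<close> applies to all \<open>u\<close> at once.\<close>

lemma Yd_likely:
  assumes K: "0 \<le> K" and \<eta>: "0 < \<eta>"
  shows "likely K (\<lambda>n \<omega>. \<forall>u\<in>{q..p}. \<bar>Yd n \<omega> u - Z n (tq u) \<omega> / f (tq u)\<bar> \<le> \<eta>)"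
proof -
  obtain m C where C: "0 < m" "\<And>t. t \<in> {tq p - \<epsilon>..tq q + \<epsilon>} \<Longrightarrow> m \<le> f t \<and> f t \<le> C" using f_bounds by metis
  have m\<eta>: "0 < m * \<eta> / 4" using C \<eta> by simp
  obtain d where d: "0 < d" "likely (K + 1) (\<lambda>n \<omega>. \<forall>s\<in>{lo..hi}. \<forall>t\<in>{lo..hi}. \<bar>s - t\<bar> \<le> d \<longrightarrow> \<bar>Z n s \<omega> - Z n t \<omega>\<bar> \<le> m * \<eta> / 4)"
    using Z_modulus_likely[OF lo_hi(1) no_atoms_lo_hi m\<eta>, of "K + 1"] K by auto
  obtain R where R: "0 < R" "likely (K + 1) (\<lambda>n \<omega>. \<forall>t\<in>{lo..hi}. \<bar>Z n t \<omega>\<bar> \<le> R)"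
    using Z_bound_likely[OF lo_hi(1) no_atoms_lo_hi, of "K + 1"] K by auto
  obtain k where k: "0 < k" "k * (R / m + \<eta>) \<le> m * \<eta> / 4"
  proof
    have Rm: "0 < R / m + \<eta>" using R C \<eta> by (simp add: add_pos_pos)
    have cancel: "x / P * P = x" if "0 < P" for x P :: real using that by simp
    show "0 < m * \<eta> / 4 / (R / m + \<eta>)" using m\<eta> Rm by (rule divide_pos_pos)
    show "m * \<eta> / 4 / (R / m + \<eta>) * (R / m + \<eta>) \<le> m * \<eta> / 4"
      unfolding cancel[OF Rm] ..
  qed
  obtain d2 where d2: "0 < d2" "\<And>s t. s \<in> {tq p - \<epsilon>..tq q + \<epsilon>} \<Longrightarrow> t \<in> {tq p - \<epsilon>..tq q + \<epsilon>} \<Longrightarrow> \<bar>t - s\<bar> < d2 \<Longrightarrow> \<bar>f t - f s\<bar> < k"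
    using compact_uniformly_continuous[OF f_cont] k(1) unfolding uniformly_continuous_on_def dist_real_def tq_def[symmetric]
    by (metis compact_Icc)
  \<comment> \<open>One radius for all requirements: \<open>d\<close> for the modulus of
    \<open>Z\<close>, \<open>d2\<close> for the oscillation of \<open>f\<close>,
    \<open>\<epsilon> / 2\<close> for staying inside \<open>{lo..hi}\<close>.\<close>
  define d3 where "d3 = min d (min (d2 / 2) (\<epsilon> / 2))"
  have d3: "0 < d3" "d3 \<le> d" "d3 < d2" "d3 \<le> \<epsilon> / 2" using d d2 eps by (auto simp: d3_def min_def)
  show ?thesis
  proof (rule likely_mono[OF likely_conj[OF zero_less_one d(2) R(2)]])
    show "\<forall>\<^sub>F n in sequentially. \<forall>\<omega>\<in>space M. (\<forall>s\<in>{lo..hi}. \<forall>t\<in>{lo..hi}. \<bar>s - t\<bar> \<le> d \<longrightarrow> \<bar>Z n s \<omega> - Z n t \<omega>\<bar> \<le> m * \<eta> / 4) \<and>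
        (\<forall>t\<in>{lo..hi}. \<bar>Z n t \<omega>\<bar> \<le> R) \<longrightarrow> (\<forall>u\<in>{q..p}. \<bar>Yd n \<omega> u - Z n (tq u) \<omega> / f (tq u)\<bar> \<le> \<eta>)"
      using eventually_ge_at_top[of 1] eventually_scale_ge[of "(R / m + \<eta>) / d3"]
    proof (eventually_elim, intro ballI impI, elim conjE)
      fix n \<omega> u
      assume n: "1 \<le> n" and bbn: "(R / m + \<eta>) / d3 \<le> scale n"
        and md: "\<forall>s\<in>{lo..hi}. \<forall>t\<in>{lo..hi}. \<bar>s - t\<bar> \<le> d \<longrightarrow> \<bar>Z n s \<omega> - Z n t \<omega>\<bar> \<le> m * \<eta> / 4"
        and bd: "\<forall>t\<in>{lo..hi}. \<bar>Z n t \<omega>\<bar> \<le> R" and u: "u \<in> {q..p}"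
      have t: "tq p \<le> tq u" "tq u \<le> tq q" using tq_range[OF u] by auto
      have x_in: "tq u + x \<in> {lo..hi}" if "\<bar>x\<bar> \<le> d3" for x
        using t that d3 by (auto simp: lo_def hi_def abs_le_iff)
      show "\<bar>Yd n \<omega> u - Z n (tq u) \<omega> / f (tq u)\<bar> \<le> \<eta>"
        unfolding Yd_def
      proof (rule ginv_bracket[OF n _ C(1) _ \<eta> _ _ less_imp_le[OF k(1)] k(2)])
        show "\<bar>Z n (tq u) \<omega>\<bar> \<le> R" using bd x_in[of 0] d3 by auto
        show "m \<le> f (tq u)" using C(2) t eps by auto
        show "\<bar>Z n (tq u + x) \<omega> - Z n (tq u) \<omega>\<bar> \<le> m * \<eta> / 4" if "\<bar>x\<bar> \<le> d3" for x
          using md x_in[OF that] x_in[of 0] d3 that by auto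
        show "(R / m + \<eta>) / scale n \<le> d3" using bbn scale_pos[OF n] d3 by (simp add: field_simps)
        show "\<bar>Tw (tq u + x) - u + f (tq u) * x\<bar> \<le> k * \<bar>x\<bar>" if x: "\<bar>x\<bar> \<le> d3" for x
        proof -
          have fx: "f (tq u) - k \<le> f y \<and> f y \<le> f (tq u) + k" if "\<bar>y - tq u\<bar> \<le> \<bar>x\<bar>" for y
          proof -
            have "\<bar>f y - f (tq u)\<bar> < k" using that x d3 t by (intro d2) (auto simp: abs_le_iff abs_less_iff)
            then show ?thesis by linarith
          qed
          show ?thesis
          proof (cases "0 \<le> x")
            case True
            have "f (tq u) - k \<le> f y \<and> f y \<le> f (tq u) + k" if "y \<in> {tq u..tq u + x}" for y
              using that True by (intro fx) auto
            from Tw_diff_bounds[of "tq u" "tq u + x", OF _ _ _ this]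
            have "(f (tq u) - k) * (tq u + x - tq u) \<le> Tw (tq u) - Tw (tq u + x)"
              "Tw (tq u) - Tw (tq u + x) \<le> (f (tq u) + k) * (tq u + x - tq u)"
              using True x d3 t eps by (auto simp: abs_le_iff)
            then show ?thesis using True unfolding Tw_tq[OF u] by (simp add: abs_le_iff algebra_simps)
          next
            case False
            have "f (tq u) - k \<le> f y \<and> f y \<le> f (tq u) + k" if "y \<in> {tq u + x..tq u}" for y
              using that False by (intro fx) auto
            from Tw_diff_bounds[of "tq u + x" "tq u", OF _ _ _ this]
            have "(f (tq u) - k) * (tq u - (tq u + x)) \<le> Tw (tq u + x) - Tw (tq u)"
              "Tw (tq u + x) - Tw (tq u) \<le> (f (tq u) + k) * (tq u - (tq u + x))"
              using False x d3 t eps by (auto simp: abs_le_iff)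
            then show ?thesis using False unfolding Tw_tq[OF u] by (simp add: abs_le_iff algebra_simps)
          qed
        qed
      qed
    qed
  qed
qed

lemma Yd_upper:
  assumes r: "0 < r" and \<alpha>: "0 \<le> \<alpha>" and e: "0 < e"
  shows "likely (\<alpha> - e) (\<lambda>n \<omega>. \<exists>h\<in>energy_ball \<alpha>. \<forall>u\<in>{q..p}. \<bar>Yd n \<omega> u - pairing h (tq u) / f (tq u)\<bar> \<le> r)"
proof -
  obtain m C where C: "0 < m" "\<And>t. t \<in> {tq p - \<epsilon>..tq q + \<epsilon>} \<Longrightarrow> m \<le> f t \<and> f t \<le> C" using f_bounds by metis
  have e2: "0 < e / 2" and r2: "0 < r / 2" and rm: "0 < m * r / 2" using e r C by auto
  have 1: "likely (\<alpha> - e + e / 2) (\<lambda>n \<omega>. \<exists>h\<in>energy_ball \<alpha>. \<forall>t\<in>{lo..hi}. \<bar>Z n t \<omega> - pairing h t\<bar> < m * r / 2)"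
    using Z_upper[OF lo_hi(1) no_atoms_lo_hi rm \<alpha> e2] by simp
  have 2: "likely (\<alpha> - e + e / 2) (\<lambda>n \<omega>. \<forall>u\<in>{q..p}. \<bar>Yd n \<omega> u - Z n (tq u) \<omega> / f (tq u)\<bar> \<le> r / 2)"
    using e by (intro likely_mono_rate[OF Yd_likely[OF \<alpha> r2]]) simp
  show ?thesis
  proof (rule likely_mono[OF likely_conj[OF e2 1 2]], intro always_eventually allI ballI impI, elim conjE bexE)
    fix n \<omega> h
    assume Y: "\<forall>u\<in>{q..p}. \<bar>Yd n \<omega> u - Z n (tq u) \<omega> / f (tq u)\<bar> \<le> r / 2"
      and h: "h \<in> energy_ball \<alpha>" and Z: "\<forall>t\<in>{lo..hi}. \<bar>Z n t \<omega> - pairing h t\<bar> < m * r / 2"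
    have "\<bar>Yd n \<omega> u - pairing h (tq u) / f (tq u)\<bar> \<le> r" if u: "u \<in> {q..p}" for u
    proof -
      have t: "tq u \<in> {lo..hi}" "m \<le> f (tq u)" using tq_range[OF u] lo_hi C(2) eps by auto
      have "\<bar>Z n (tq u) \<omega> / f (tq u) - pairing h (tq u) / f (tq u)\<bar> = \<bar>Z n (tq u) \<omega> - pairing h (tq u)\<bar> / f (tq u)"
        using t C by (simp add: diff_divide_distrib[symmetric] abs_divide)
      also have "\<dots> \<le> (m * r / 2) / m" using Z t C r by (intro frac_le) (auto intro: less_imp_le)
      finally have "\<bar>Z n (tq u) \<omega> / f (tq u) - pairing h (tq u) / f (tq u)\<bar> \<le> r / 2" using C by simp
      moreover have "\<bar>Yd n \<omega> u - Z n (tq u) \<omega> / f (tq u)\<bar> \<le> r / 2" using Y u by blast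
      ultimately show ?thesis by linarith
    qed
    then show "\<exists>h\<in>energy_ball \<alpha>. \<forall>u\<in>{q..p}. \<bar>Yd n \<omega> u - pairing h (tq u) / f (tq u)\<bar> \<le> r" using h by blast
  qed
qed

text \<open>The event where the comparison with \<open>Z\<close> fails has rate
  \<open>\<alpha> + e\<close>, better than the rate \<open>\<alpha> + e / 2\<close> of the event
  from \<open>Z_lower\<close>; for large \<open>n\<close> it takes away at most half of that
  probability.\<close>

lemma Yd_lower:
  assumes h: "h \<in> energy_ball \<alpha>" and \<alpha>: "0 \<le> \<alpha>" and r: "0 < r" and e: "0 < e"
  shows "\<forall>\<^sub>F n in sequentially. \<exists>E\<in>events. exp (- (\<alpha> + e) * (lam n)\<^sup>2) \<le> prob E \<and>
    (\<forall>\<omega>\<in>E. \<forall>u\<in>{q..p}. \<bar>Yd n \<omega> u - pairing h (tq u) / f (tq u)\<bar> \<le> r)"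
proof -
  obtain m C where C: "0 < m" "\<And>t. t \<in> {tq p - \<epsilon>..tq q + \<epsilon>} \<Longrightarrow> m \<le> f t \<and> f t \<le> C" using f_bounds by metis
  have e2: "0 < e / 2" and r2: "0 < r / 2" and rm: "0 < m * r / 2" and \<alpha>e: "0 \<le> \<alpha> + e" using e r C \<alpha> by auto
  show ?thesis
    using Z_lower[OF lo_hi(1) no_atoms_lo_hi h rm e2] Yd_likely[OF \<alpha>e r2, unfolded likely_def] eventually_card_le_exp[OF e2, of 2]
  proof eventually_elim
    case (elim n)
    obtain E where E: "E \<in> events" "exp (- (\<alpha> + e / 2) * (lam n)\<^sup>2) \<le> prob E"
      "\<forall>\<omega>\<in>E. \<forall>t\<in>{lo..hi}. \<bar>Z n t \<omega> - pairing h t\<bar> < m * r / 2" using elim(1) by blast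
    obtain E' where E': "E' \<in> events" "prob E' \<le> exp (- (\<alpha> + e) * (lam n)\<^sup>2)"
      "\<forall>\<omega>\<in>space M - E'. \<forall>u\<in>{q..p}. \<bar>Yd n \<omega> u - Z n (tq u) \<omega> / f (tq u)\<bar> \<le> r / 2" using elim(2) by blast
    have "2 * exp (- (\<alpha> + e) * (lam n)\<^sup>2) \<le> exp (e / 2 * (lam n)\<^sup>2) * exp (- (\<alpha> + e) * (lam n)\<^sup>2)"
      using elim(3) by (intro mult_right_mono) auto
    also have "\<dots> = exp (- (\<alpha> + e / 2) * (lam n)\<^sup>2)" by (simp add: exp_add[symmetric] algebra_simps)
    also have "\<dots> \<le> prob E" by (rule E(2))
    also have "\<dots> \<le> prob ((E - E') \<union> E')" using E E' by (intro finite_measure_mono) auto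
    also have "\<dots> \<le> prob (E - E') + prob E'" using E E' by (intro measure_Un_le) auto
    finally have p: "exp (- (\<alpha> + e) * (lam n)\<^sup>2) \<le> prob (E - E')" using E'(2) by linarith
    have "\<bar>Yd n \<omega> u - pairing h (tq u) / f (tq u)\<bar> \<le> r" if \<omega>: "\<omega> \<in> E - E'" and u: "u \<in> {q..p}" for \<omega> u
    proof -
      have sp: "\<omega> \<in> space M - E'" using \<omega> sets.sets_into_space[OF E(1)] by auto
      have t: "tq u \<in> {lo..hi}" "m \<le> f (tq u)" using tq_range[OF u] lo_hi C(2) eps by auto
      have "\<bar>Z n (tq u) \<omega> / f (tq u) - pairing h (tq u) / f (tq u)\<bar> = \<bar>Z n (tq u) \<omega> - pairing h (tq u)\<bar> / f (tq u)"
        using t C by (simp add: diff_divide_distrib[symmetric] abs_divide)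
      also have "\<dots> \<le> (m * r / 2) / m" using E(3) \<omega> t C r by (intro frac_le) (auto intro: less_imp_le)
      finally have "\<bar>Z n (tq u) \<omega> / f (tq u) - pairing h (tq u) / f (tq u)\<bar> \<le> r / 2" using C by simp
      moreover have "\<bar>Yd n \<omega> u - Z n (tq u) \<omega> / f (tq u)\<bar> \<le> r / 2" using E'(3) sp u by blast
      ultimately show ?thesis by linarith
    qed
    then show ?case using E E' p by (intro bexI[of _ "E - E'"]) auto
  qed
qed

section \<open>The rate function and its level sets\<close>

lemma nu_sets: "sets \<nu> = sets borel" by simp

lemma signed_RN_deriv_props:
  assumes "\<eta> \<in> Mb0 \<nu>"
  shows "integrable \<nu> (signed_RN_deriv \<nu> \<eta>)" "A \<in> sets borel \<Longrightarrow> \<eta> A = (LINT x:A|\<nu>. signed_RN_deriv \<nu> \<eta> x)"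
  using someI_ex[OF Mb0_density_exists[OF nu.real_distribution_axioms assms]]
  unfolding signed_RN_deriv_def[symmetric] by auto

lemma indicator_w: "(\<lambda>x. indicator {t<..} x * w x) = tailw t"
  by (auto simp: tailw_def)

text \<open>The infimum is attained. Representatives of energy \<open>\<alpha> + e\<close> exist for
  every positive \<open>e\<close>; the dual inequalities they imply hold for every \<open>e\<close>,
  hence for \<open>\<alpha>\<close> itself, and \<open>energy_ball_of_dual\<close> returns a single
  density.\<close>

lemma quantile_rate_le_imp:
  assumes \<alpha>: "0 \<le> \<alpha>" and le: "quantile_rate \<mu> \<nu> w f q p G \<le> ennreal \<alpha>"
  shows "\<exists>h\<in>energy_ball \<alpha>. \<forall>u\<in>{q..p}. pairing h (tq u) / f (tq u) = G u"
proof -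
  \<comment> \<open>The target as a function of the point \<open>t\<close> instead of the level
    \<open>u\<close>: \<open>Tw (tq u) = u\<close> by \<open>Tw_tq\<close>.\<close>
  define y where "y t = f t * G (Tw t)" for t
  have approx: "\<exists>h\<in>energy_ball (\<alpha> + e). \<forall>u\<in>{q..p}. pairing h (tq u) = y (tq u)" if e: "0 < e" for e
  proof -
    have "quantile_rate \<mu> \<nu> w f q p G < ennreal (\<alpha> + e)"
      using le by (rule order.strict_trans1) (use \<alpha> e in \<open>simp add: ennreal_less_iff\<close>)
    then obtain \<eta> where \<eta>: "\<eta> \<in> Mb0 \<nu>"
      "\<forall>u\<in>{q..p}. signed_integral \<eta> (\<lambda>x. indicator {ginv (tail \<mu>) u<..} x * w x) / f (ginv (tail \<mu>) u) = G u"
      and I: "I_meas \<nu> \<eta> < ennreal (\<alpha> + e)"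
      unfolding quantile_rate_def by (auto simp: INF_less_iff)
    define h where "h = signed_RN_deriv \<nu> \<eta>"
    have ih: "integrable \<nu> h" and h\<eta>: "\<And>A. A \<in> sets borel \<Longrightarrow> \<eta> A = (LINT x:A|\<nu>. h x)"
      using signed_RN_deriv_props[OF \<eta>(1)] by (auto simp: h_def)
    have "(\<integral>\<^sup>+x. ennreal ((h x)\<^sup>2) \<partial>\<nu>) / 2 < ennreal (\<alpha> + e)" using I \<eta>(1) by (simp add: I_meas_def h_def)
    moreover have "(\<integral>\<^sup>+x. ennreal ((h x)\<^sup>2) \<partial>\<nu>) \<noteq> \<infinity>"
    proof
      assume "(\<integral>\<^sup>+x. ennreal ((h x)\<^sup>2) \<partial>\<nu>) = \<infinity>"
      then have "(\<integral>\<^sup>+x. ennreal ((h x)\<^sup>2) \<partial>\<nu>) / 2 = \<infinity>" by (simp add: ennreal_divide_eq_top_iff)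
      with calculation show False by simp
    qed
    ultimately have fin: "(\<integral>\<^sup>+x. ennreal ((h x)\<^sup>2) \<partial>\<nu>) / 2 < ennreal (\<alpha> + e)" "(\<integral>\<^sup>+x. ennreal ((h x)\<^sup>2) \<partial>\<nu>) < \<infinity>"
      by (simp_all add: less_top)
    have hL2: "h \<in> L2 \<nu>"
      using fin(2) borel_measurable_integrable[OF ih] by (auto simp: L2_def intro!: integrableI_bounded)
    have "(\<integral>\<^sup>+x. ennreal ((h x)\<^sup>2) \<partial>\<nu>) = ennreal (LINT x|\<nu>. (h x)\<^sup>2)"
      by (rule nn_integral_eq_integral[OF L2_sq[OF hL2]]) simp
    then have "ennreal ((LINT x|\<nu>. (h x)\<^sup>2) / 2) < ennreal (\<alpha> + e)"
      using fin(1) by (simp add: divide_ennreal[symmetric])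
    then have "(LINT x|\<nu>. (h x)\<^sup>2) / 2 < \<alpha> + e" by (subst (asm) ennreal_less_iff) auto
    then have "(LINT x|\<nu>. (h x)\<^sup>2) / 2 \<le> \<alpha> + e" by (rule less_imp_le)
    moreover have "mean h = 0" using h\<eta>[of UNIV] \<eta>(1) by (simp add: mean_def Mb0_def set_lebesgue_integral_def)
    ultimately have "h \<in> energy_ball (\<alpha> + e)" using hL2 by (simp add: energy_ball_def)
    moreover have "pairing h (tq u) = y (tq u)" if u: "u \<in> {q..p}" for u
    proof -
      have "signed_integral \<eta> (tailw (tq u)) = pairing h (tq u)"
        unfolding pairing_def using lin_growth_measurable[OF lin_growth_tailw]
        by (intro signed_integral_eq[OF nu_sets ih h\<eta>] L2_mult[OF hL2 lin_growth_L2[OF lin_growth_tailw]]) auto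
      moreover have "0 < f (tq u)" using tq_range[OF u] eps by (intro f_pos) (auto simp: tq_def)
      moreover have "signed_integral \<eta> (tailw (tq u)) / f (tq u) = G u"
        using \<eta>(2) u by (simp add: indicator_w tq_def)
      ultimately show ?thesis unfolding y_def Tw_tq[OF u] by (simp add: field_simps)
    qed
    ultimately show ?thesis by blast
  qed
  have dual: "(\<Sum>t\<in>F. c t * y t) \<le> \<alpha> + var (\<lambda>x. \<Sum>t\<in>F. c t * tailw t x) / 2" if F: "finite F" "F \<subseteq> tq ` {q..p}" for F c
  proof (rule field_le_epsilon)
    fix e :: real assume "0 < e"
    then obtain h where h: "h \<in> energy_ball (\<alpha> + e)" "\<forall>u\<in>{q..p}. pairing h (tq u) = y (tq u)" using approx by blast
    have "(\<Sum>t\<in>F. c t * y t) = (\<Sum>t\<in>F. c t * pairing h t)" using h(2) F by (intro sum.cong) auto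
    also have "\<dots> \<le> (\<alpha> + e) + var (\<lambda>x. \<Sum>t\<in>F. c t * tailw t x) / 2" by (rule energy_ball_dual[OF h(1) F(1)])
    finally show "(\<Sum>t\<in>F. c t * y t) \<le> \<alpha> + var (\<lambda>x. \<Sum>t\<in>F. c t * tailw t x) / 2 + e" by simp
  qed
  obtain h where h: "h \<in> energy_ball \<alpha>" "\<And>t. t \<in> tq ` {q..p} \<Longrightarrow> pairing h t = y t"
    using energy_ball_of_dual[OF dual] by metis
  have "pairing h (tq u) / f (tq u) = G u" if u: "u \<in> {q..p}" for u
  proof -
    have "0 < f (tq u)" using tq_range[OF u] eps by (intro f_pos) (auto simp: tq_def)
    then show ?thesis using h(2)[of "tq u"] u unfolding y_def Tw_tq[OF u] by simp
  qed
  with h(1) show ?thesis by blast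
qed

lemma quantile_rate_leI:
  assumes h: "h \<in> energy_ball \<alpha>" and G: "\<And>u. u \<in> {q..p} \<Longrightarrow> pairing h (tq u) / f (tq u) = G u"
  shows "quantile_rate \<mu> \<nu> w f q p G \<le> ennreal \<alpha>"
proof -
  have h': "h \<in> L2 \<nu>" "mean h = 0" "(LINT x|\<nu>. (h x)\<^sup>2) / 2 \<le> \<alpha>" using h by (auto simp: energy_ball_def)
  have ih: "integrable \<nu> h" by (rule L2_integrable[OF fin_nu h'(1)])
  define \<eta> where "\<eta> A = (LINT x:A|\<nu>. h x)" for A
  have \<eta>0: "\<eta> \<in> Mb0 \<nu>"
    unfolding \<eta>_def[abs_def] using h'(2) by (intro density_in_Mb0[OF nu.real_distribution_axioms ih]) (simp add: mean_def)
  have "signed_integral \<eta> (\<lambda>x. indicator {ginv (tail \<mu>) u<..} x * w x) / f (ginv (tail \<mu>) u) = G u" if u: "u \<in> {q..p}" for u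
  proof -
    have "signed_integral \<eta> (tailw (tq u)) = pairing h (tq u)"
      unfolding pairing_def using lin_growth_measurable[OF lin_growth_tailw]
      by (intro signed_integral_eq[OF nu_sets ih \<eta>_def] L2_mult[OF h'(1) lin_growth_L2[OF lin_growth_tailw]]) auto
    then show ?thesis using G[OF u] by (simp add: indicator_w tq_def)
  qed
  then have "quantile_rate \<mu> \<nu> w f q p G \<le> I_meas \<nu> \<eta>"
    unfolding quantile_rate_def using \<eta>0 by (intro INF_lower) auto
  also have "I_meas \<nu> \<eta> = (\<integral>\<^sup>+x. ennreal ((h x)\<^sup>2) \<partial>\<nu>) / 2"
  proof -
    \<comment> \<open>The version chosen by \<open>SOME\<close> agrees with \<open>h\<close> almost
      everywhere, so the energies coincide.\<close>
    have "AE x in \<nu>. signed_RN_deriv \<nu> \<eta> x = h x"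
      using signed_RN_deriv_props[OF \<eta>0] ih by (intro density_unique_real) (auto simp: \<eta>_def)
    then have "(\<integral>\<^sup>+x. ennreal ((signed_RN_deriv \<nu> \<eta> x)\<^sup>2) \<partial>\<nu>) = (\<integral>\<^sup>+x. ennreal ((h x)\<^sup>2) \<partial>\<nu>)"
      by (intro nn_integral_cong_AE) (auto elim: eventually_mono)
    then show ?thesis using \<eta>0 by (simp add: I_meas_def)
  qed
  also have "(\<integral>\<^sup>+x. ennreal ((h x)\<^sup>2) \<partial>\<nu>) = ennreal (LINT x|\<nu>. (h x)\<^sup>2)"
    by (rule nn_integral_eq_integral[OF L2_sq[OF h'(1)]]) simp
  also have "ennreal (LINT x|\<nu>. (h x)\<^sup>2) / 2 = ennreal ((LINT x|\<nu>. (h x)\<^sup>2) / 2)"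
    by (simp add: divide_ennreal[symmetric])
  also have "\<dots> \<le> ennreal \<alpha>" using h'(3) by (rule ennreal_leI)
  finally show ?thesis .
qed

definition path :: "(real \<Rightarrow> real) \<Rightarrow> real \<Rightarrow> real" where
  "path h = (\<lambda>u\<in>{q..p}. pairing h (tq u) / f (tq u))"

lemma path_bound:
  obtains m where "0 < m" "\<And>u. u \<in> {q..p} \<Longrightarrow> m \<le> f (tq u)"
proof -
  obtain m C where C: "0 < m" "\<And>t. t \<in> {tq p - \<epsilon>..tq q + \<epsilon>} \<Longrightarrow> m \<le> f t \<and> f t \<le> C" using f_bounds by metis
  then show ?thesis using tq_range eps by (intro that[of m]) fastforce+
qed

lemma energy_ball_pairing_bound:
  assumes "h \<in> energy_ball \<alpha>"
  shows "\<bar>pairing h t\<bar> \<le> sqrt (2 * \<alpha> * (LINT x|\<nu>. (w x)\<^sup>2))"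
proof -
  have "(pairing h t)\<^sup>2 \<le> (LINT x|\<nu>. (h x)\<^sup>2) * (LINT x|\<nu>. (w x)\<^sup>2)"
    using assms by (intro L2_pairing_bound) (auto simp: energy_ball_def)
  also have "\<dots> \<le> 2 * \<alpha> * (LINT x|\<nu>. (w x)\<^sup>2)"
    using assms by (intro mult_right_mono) (auto simp: energy_ball_def)
  finally show ?thesis by (metis real_sqrt_abs real_sqrt_le_iff)
qed

lemma divide_in_l_infty:
  assumes "\<And>t. t \<in> {lo..hi} \<Longrightarrow> \<bar>g t\<bar> \<le> B"
  shows "(\<lambda>u\<in>{q..p}. g (tq u) / f (tq u)) \<in> mspace (l_infty q p)"
proof -
  obtain m where m: "0 < m" "\<And>u. u \<in> {q..p} \<Longrightarrow> m \<le> f (tq u)" using path_bound by metis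
  show ?thesis
  proof (rule l_infty_mem)
    fix u assume u: "u \<in> {q..p}"
    have "tq u \<in> {lo..hi}" using tq_range[OF u] lo_hi by auto
    then have b: "\<bar>g (tq u)\<bar> \<le> B" by (rule assms)
    have "\<bar>g (tq u)\<bar> / f (tq u) \<le> B / m" using b m(1) m(2)[OF u] by (intro frac_le) auto
    then show "\<bar>(\<lambda>u\<in>{q..p}. g (tq u) / f (tq u)) u\<bar> \<le> B / m" using u m(1) m(2)[OF u] by (simp add: abs_divide)
  qed simp
qed

lemma path_in_l_infty: "h \<in> energy_ball \<alpha> \<Longrightarrow> path h \<in> mspace (l_infty q p)"
  unfolding path_def by (rule divide_in_l_infty[OF energy_ball_pairing_bound])

lemma quantile_rate_path: "h \<in> energy_ball \<alpha> \<Longrightarrow> quantile_rate \<mu> \<nu> w f q p (path h) \<le> ennreal \<alpha>"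
  by (rule quantile_rate_leI) (auto simp: path_def)

lemma rate_le_obtain_path:
  assumes "0 \<le> \<alpha>" "G \<in> mspace (l_infty q p)" "quantile_rate \<mu> \<nu> w f q p G \<le> ennreal \<alpha>"
  obtains h where "h \<in> energy_ball \<alpha>" "G = path h"
proof -
  obtain h where h: "h \<in> energy_ball \<alpha>" "\<forall>u\<in>{q..p}. pairing h (tq u) / f (tq u) = G u"
    using quantile_rate_le_imp[OF assms(1,3)] by blast
  have "G = path h"
    using h(2) l_infty_extensional[OF assms(2)] by (auto simp: path_def extensional_def fun_eq_iff)
  with h that show ?thesis by blast
qed

text \<open>Arzela--Ascoli for the functions \<open>pairing (h k)\<close> on \<open>{lo..hi}\<close>
  gives a uniform limit \<open>g\<close>. The dual inequalities pass to the limit, so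
  \<open>g\<close> is again \<open>pairing h0\<close> with \<open>h0\<close> in the same ball, and
  division by \<open>f (tq u) \<ge> m\<close> keeps the convergence uniform.\<close>

lemma level_set_compact:
  "compactin (mtopology_of (l_infty q p)) {G \<in> mspace (l_infty q p). quantile_rate \<mu> \<nu> w f q p G \<le> ennreal a}"
proof -
  let ?L = "l_infty q p"
  interpret L: Metric_space "mspace ?L" "mdist ?L" by (rule Metric_space_mspace_mdist)
  \<comment> \<open>\<open>ennreal\<close> maps a negative \<open>a\<close> to 0, so nonnegative
    levels suffice.\<close>
  define \<alpha> where "\<alpha> = max 0 a"
  have \<alpha>: "0 \<le> \<alpha>" "ennreal a = ennreal \<alpha>" by (auto simp: \<alpha>_def max_def ennreal_neg)
  obtain m where m: "0 < m" "\<And>u. u \<in> {q..p} \<Longrightarrow> m \<le> f (tq u)" using path_bound by metis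
  have "\<exists>l r. l \<in> {G \<in> mspace ?L. quantile_rate \<mu> \<nu> w f q p G \<le> ennreal \<alpha>} \<and> strict_mono (r :: nat \<Rightarrow> nat) \<and> limitin L.mtopology (\<sigma> \<circ> r) l sequentially"
    if \<sigma>: "range \<sigma> \<subseteq> {G \<in> mspace ?L. quantile_rate \<mu> \<nu> w f q p G \<le> ennreal \<alpha>}" for \<sigma> :: "nat \<Rightarrow> real \<Rightarrow> real"
  proof -
    have "\<exists>h. h \<in> energy_ball \<alpha> \<and> \<sigma> k = path h" for k
      using \<sigma> rate_le_obtain_path[OF \<alpha>(1), of "\<sigma> k"] by (metis (mono_tags, lifting) mem_Collect_eq rangeI subsetD)
    then obtain h where h: "\<And>k. h k \<in> energy_ball \<alpha>" "\<And>k. \<sigma> k = path (h k)" by metis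
    obtain g r where g: "continuous_on {lo..hi} g" "strict_mono (r :: nat \<Rightarrow> nat)"
      "\<And>e. 0 < e \<Longrightarrow> \<exists>N. \<forall>n x. n \<ge> N \<and> x \<in> {lo..hi} \<longrightarrow> norm (pairing (h (r n)) x - g x) < e"
    proof (rule Arzela_Ascoli[of "{lo..hi}" "\<lambda>k. pairing (h k)"])
      show "compact {lo..hi}" by simp
      show "norm (pairing (h n) x) \<le> sqrt (2 * \<alpha> * (LINT x|\<nu>. (w x)\<^sup>2))" for n x
        using energy_ball_pairing_bound[OF h(1)] by simp
      fix x e :: real assume x: "x \<in> {lo..hi}" "0 < e"
      obtain d where d: "0 < d" "\<And>h s t. h \<in> energy_ball \<alpha> \<Longrightarrow> s \<in> {lo..hi} \<Longrightarrow> t \<in> {lo..hi} \<Longrightarrow> \<bar>s - t\<bar> < d \<Longrightarrow> \<bar>pairing h s - pairing h t\<bar> < e"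
        using pairing_equicontinuous[OF no_atoms_lo_hi x(2) \<alpha>(1)] by metis
      then show "\<exists>d>0. \<forall>n y. y \<in> {lo..hi} \<and> norm (x - y) < d \<longrightarrow> norm (pairing (h n) x - pairing (h n) y) < e"
        using x h(1) by (intro exI[of _ d]) auto
    next
      fix g k assume "continuous_on {lo..hi} g" "strict_mono (k :: nat \<Rightarrow> nat)"
        "\<And>e. 0 < e \<Longrightarrow> \<exists>N. \<forall>n x. n \<ge> N \<and> x \<in> {lo..hi} \<longrightarrow> norm (pairing (h (k n)) x - g x) < e"
      then show thesis by (rule that)
    qed
    have lim: "(\<lambda>n. pairing (h (r n)) t) \<longlonglongrightarrow> g t" if "t \<in> {lo..hi}" for t
      using g(3) that unfolding LIMSEQ_iff by blast
    have dual: "(\<Sum>t\<in>F. c t * g t) \<le> \<alpha> + var (\<lambda>x. \<Sum>t\<in>F. c t * tailw t x) / 2" if F: "finite F" "F \<subseteq> {lo..hi}" for F c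
    proof (rule LIMSEQ_le_const2)
      show "(\<lambda>n. \<Sum>t\<in>F. c t * pairing (h (r n)) t) \<longlonglongrightarrow> (\<Sum>t\<in>F. c t * g t)"
        using F by (intro tendsto_sum tendsto_mult tendsto_const lim) auto
      show "\<exists>N. \<forall>n\<ge>N. (\<Sum>t\<in>F. c t * pairing (h (r n)) t) \<le> \<alpha> + var (\<lambda>x. \<Sum>t\<in>F. c t * tailw t x) / 2"
        using energy_ball_dual[OF h(1) F(1)] by blast
    qed
    obtain h0 where h0: "h0 \<in> energy_ball \<alpha>" "\<And>t. t \<in> {lo..hi} \<Longrightarrow> pairing h0 t = g t"
      using energy_ball_of_dual[OF dual] by metis
    have "limitin L.mtopology (\<sigma> \<circ> r) (path h0) sequentially"
      unfolding L.limit_metric_sequentially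
    proof (intro conjI allI impI)
      show "path h0 \<in> mspace ?L" by (rule path_in_l_infty[OF h0(1)])
      fix e :: real assume e: "0 < e"
      then have "0 < m * e / 2" using m by simp
      then obtain N where N: "\<And>n x. n \<ge> N \<Longrightarrow> x \<in> {lo..hi} \<Longrightarrow> \<bar>pairing (h (r n)) x - g x\<bar> < m * e / 2"
        using g(3) by (metis real_norm_def)
      have "mdist ?L (path (h (r n))) (path h0) \<le> e / 2" if n: "n \<ge> N" for n
      proof (rule l_infty_dist_le)
        fix u assume u: "u \<in> {q..p}"
        have t: "tq u \<in> {lo..hi}" using tq_range[OF u] lo_hi by auto
        have fp: "0 < f (tq u)" using m u by force
        have "\<bar>path (h (r n)) u - path h0 u\<bar> = \<bar>pairing (h (r n)) (tq u) - g (tq u)\<bar> / f (tq u)"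
          using u fp h0(2)[OF t] by (simp add: path_def diff_divide_distrib[symmetric] abs_divide)
        also have "\<dots> \<le> (m * e / 2) / m" using N[OF n t] m(1) m(2)[OF u] e by (intro frac_le) auto
        finally show "\<bar>path (h (r n)) u - path h0 u\<bar> \<le> e / 2" using m by simp
      qed (use path_in_l_infty h(1) h0(1) qp in auto)
      then have "(\<sigma> \<circ> r) n \<in> mspace ?L \<and> mdist ?L ((\<sigma> \<circ> r) n) (path h0) < e" if "n \<ge> N" for n
        using that e path_in_l_infty[OF h(1)] by (fastforce simp: h(2))
      then show "\<exists>N. \<forall>n\<ge>N. (\<sigma> \<circ> r) n \<in> mspace ?L \<and> mdist ?L ((\<sigma> \<circ> r) n) (path h0) < e" by blast
    qed
    then show ?thesis using g(2) path_in_l_infty[OF h0(1)] quantile_rate_path[OF h0(1)] by blast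
  qed
  then have "compactin L.mtopology {G \<in> mspace ?L. quantile_rate \<mu> \<nu> w f q p G \<le> ennreal \<alpha>}"
    unfolding L.compactin_sequentially by blast
  then show ?thesis unfolding \<alpha>(2) mtopology_of_def .
qed

section \<open>Large deviations and convergence of the quantile process\<close>

definition Yr :: "nat \<Rightarrow> 'a \<Rightarrow> real \<Rightarrow> real" where
  "Yr n \<omega> = (\<lambda>u\<in>{q..p}. Yd n \<omega> u)"

lemma Tn_zero:
  assumes "\<And>i. i \<in> {1..n} \<Longrightarrow> X i \<omega> \<le> t"
  shows "Tn n t \<omega> = 0"
  using assms unfolding Tn_def by (force intro!: sum.neutral)

text \<open>At each sample point the empirical quantile lies between the smallest and the largest
  observation, or else is the default value of \<open>Inf\<close>. The bound is uniform in
  \<open>u\<close>, though not in the sample point.\<close>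

lemma Yr_in_l_infty:
  assumes n: "n \<ge> 1"
  shows "Yr n \<omega> \<in> mspace (l_infty q p)"
proof -
  define H where "H t = Tn n t \<omega>" for t
  define a where "a = Min ((\<lambda>i. X i \<omega>) ` {1..n})"
  define b where "b = Max ((\<lambda>i. X i \<omega>) ` {1..n})"
  have ne: "(\<lambda>i. X i \<omega>) ` {1..n} \<noteq> {}" using n by auto
  have ab: "a \<le> X i \<omega>" "X i \<omega> \<le> b" if "i \<in> {1..n}" for i using that by (auto simp: a_def b_def)
  \<comment> \<open>\<open>\<bar>Inf UNIV\<bar>\<close> covers the levels \<open>u\<close> not below
    the total mass, for which \<open>{t. H t \<le> u}\<close> is the whole line.\<close>
  define B where "B = \<bar>Inf (UNIV :: real set)\<bar> + \<bar>a\<bar> + \<bar>b\<bar>"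
  have gB: "\<bar>ginv H u\<bar> \<le> B" if u: "u \<in> {q..p}" for u
  proof (cases "\<forall>t. H t \<le> u")
    case True
    then have "{t. H t \<le> u} = UNIV" by auto
    then show ?thesis by (simp add: ginv_def B_def)
  next
    case False
    then obtain s where s: "u < H s" by (auto simp: not_le)
    have const: "H t = H s'" if "t < a" "s' < a" for t s'
    proof -
      have "indicator {t<..} (X i \<omega>) = (indicator {s'<..} (X i \<omega>) :: real)" if "i \<in> {1..n}" for i
        using ab(1)[OF that] \<open>t < a\<close> \<open>s' < a\<close> by simp
      then show ?thesis unfolding H_def Tn_def by simp
    qed
    have big: "u < H t" if "t < a" for t
    proof -
      have "H s \<le> H (min s t)" unfolding H_def by (intro Tn_antimono) simp
      also have "H (min s t) = H t" using that by (intro const) auto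
      finally show ?thesis using s by simp
    qed
    have "H b = 0" unfolding H_def using ab by (intro Tn_zero)
    then have bin: "b \<in> {t. H t \<le> u}" using u q by auto
    have low: "a \<le> t" if "t \<in> {t. H t \<le> u}" for t using big[of t] that by (auto simp: not_less[symmetric])
    have "ginv H u \<le> b" unfolding ginv_def using bin low by (intro cInf_lower bdd_belowI) auto
    moreover have "a \<le> ginv H u" unfolding ginv_def using bin low by (intro cInf_greatest) auto
    ultimately show ?thesis unfolding B_def by linarith
  qed
  show ?thesis
  proof (rule l_infty_mem)
    show "Yr n \<omega> \<in> extensional {q..p}" by (simp add: Yr_def)
    fix u assume u: "u \<in> {q..p}"
    have "\<bar>tq u\<bar> \<le> \<bar>tq p\<bar> + \<bar>tq q\<bar>" using tq_range[OF u] by auto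
    then have "\<bar>ginv H u - tq u\<bar> \<le> B + (\<bar>tq p\<bar> + \<bar>tq q\<bar>)" using gB[OF u] by linarith
    then have "scale n * \<bar>ginv H u - tq u\<bar> \<le> scale n * (B + (\<bar>tq p\<bar> + \<bar>tq q\<bar>))"
      using scale_pos[OF n] by (intro mult_left_mono) auto
    then show "\<bar>Yr n \<omega> u\<bar> \<le> scale n * (B + (\<bar>tq p\<bar> + \<bar>tq q\<bar>))"
      using u scale_pos[OF n] by (simp add: Yr_def Yd_def abs_mult H_def[abs_def])
  qed
qed

lemma Yr_path_dist:
  assumes "n \<ge> 1" "h \<in> energy_ball \<alpha>" "\<forall>u\<in>{q..p}. \<bar>Yd n \<omega> u - pairing h (tq u) / f (tq u)\<bar> \<le> r"
  shows "mdist (l_infty q p) (Yr n \<omega>) (path h) \<le> r"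
  using assms qp by (intro l_infty_dist_le Yr_in_l_infty path_in_l_infty) (auto simp: Yr_def path_def)

lemma lam_sq_pos: "n \<ge> 1 \<Longrightarrow> 0 < (lam n)\<^sup>2"
  using lam_pos[of n] by simp

text \<open>\<open>Y\<close> has to agree with \<open>Yr\<close> from \<open>n = 1\<close> on, which
  is the range where the maps are constrained. The radius \<open>r / 2\<close> turns the non-strict
  uniform estimates into strict ones.\<close>

lemma quantile_LDP:
  assumes Y: "\<And>n \<omega>. n \<ge> 1 \<Longrightarrow> Y n \<omega> = Yr n \<omega>"
  shows "satisfies_LDP (\<lambda>_. M) Y (l_infty q p) (\<lambda>n. (lam n)\<^sup>2) (quantile_rate \<mu> \<nu> w f q p)"
proof (rule satisfies_LDPI)
  fix a r e :: real assume a: "0 \<le> a" and r: "0 < r" and e: "0 < e"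
  have "0 < r / 2" using r by simp
  from Yd_upper[OF this a e, unfolded likely_def] eventually_ge_at_top[of 1]
  show "\<forall>\<^sub>F n in sequentially. \<exists>E\<in>events. prob E \<le> exp (- (a - e) * (lam n)\<^sup>2) \<and>
        (\<forall>\<omega>\<in>space M - E. \<exists>G\<in>mspace (l_infty q p). quantile_rate \<mu> \<nu> w f q p G \<le> ennreal a \<and> mdist (l_infty q p) (Y n \<omega>) G < r)"
  proof (eventually_elim, elim bexE conjE)
    fix n E assume n: "1 \<le> n" and E: "E \<in> events" "prob E \<le> exp (- (a - e) * (lam n)\<^sup>2)"
      "\<forall>\<omega>\<in>space M - E. \<exists>h\<in>energy_ball a. \<forall>u\<in>{q..p}. \<bar>Yd n \<omega> u - pairing h (tq u) / f (tq u)\<bar> \<le> r / 2"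
    have "\<exists>G\<in>mspace (l_infty q p). quantile_rate \<mu> \<nu> w f q p G \<le> ennreal a \<and> mdist (l_infty q p) (Y n \<omega>) G < r"
      if om: "\<omega> \<in> space M - E" for \<omega>
    proof -
      obtain h where h: "h \<in> energy_ball a" "\<forall>u\<in>{q..p}. \<bar>Yd n \<omega> u - pairing h (tq u) / f (tq u)\<bar> \<le> r / 2" using bspec[OF E(3) om] by blast
      have "mdist (l_infty q p) (Y n \<omega>) (path h) < r" using Yr_path_dist[OF n h] r unfolding Y[OF n] by linarith
      then show ?thesis using path_in_l_infty[OF h(1)] quantile_rate_path[OF h(1)] by blast
    qed
    then show "\<exists>E\<in>events. prob E \<le> exp (- (a - e) * (lam n)\<^sup>2) \<and>
        (\<forall>\<omega>\<in>space M - E. \<exists>G\<in>mspace (l_infty q p). quantile_rate \<mu> \<nu> w f q p G \<le> ennreal a \<and> mdist (l_infty q p) (Y n \<omega>) G < r)"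
      using E by blast
  qed
next
  fix G and r e :: real
  assume G: "G \<in> mspace (l_infty q p)" "quantile_rate \<mu> \<nu> w f q p G < \<infinity>" and r: "0 < r" and e: "0 < e"
  define \<alpha> where "\<alpha> = enn2real (quantile_rate \<mu> \<nu> w f q p G)"
  have \<alpha>: "0 \<le> \<alpha>" "quantile_rate \<mu> \<nu> w f q p G \<le> ennreal \<alpha>" using G(2) by (auto simp: \<alpha>_def)
  obtain h where h: "h \<in> energy_ball \<alpha>" "G = path h" using rate_le_obtain_path[OF \<alpha>(1) G(1) \<alpha>(2)] by metis
  have "0 < r / 2" using r by simp
  from Yd_lower[OF h(1) \<alpha>(1) this e] eventually_ge_at_top[of 1]
  show "\<forall>\<^sub>F n in sequentially. \<exists>E\<in>events. exp (- (enn2real (quantile_rate \<mu> \<nu> w f q p G) + e) * (lam n)\<^sup>2) \<le> prob E \<and>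
        (\<forall>\<omega>\<in>E. mdist (l_infty q p) (Y n \<omega>) G < r)"
    unfolding \<alpha>_def[symmetric]
  proof (eventually_elim, elim bexE conjE)
    fix n E assume n: "1 \<le> n" and E: "E \<in> events" "exp (- (\<alpha> + e) * (lam n)\<^sup>2) \<le> prob E"
      "\<forall>\<omega>\<in>E. \<forall>u\<in>{q..p}. \<bar>Yd n \<omega> u - pairing h (tq u) / f (tq u)\<bar> \<le> r / 2"
    have "mdist (l_infty q p) (Y n \<omega>) G < r" if "\<omega> \<in> E" for \<omega>
      using Yr_path_dist[OF n h(1), of \<omega> "r / 2"] E(3) that r h(2) unfolding Y[OF n] by fastforce
    then show "\<exists>E\<in>events. exp (- (\<alpha> + e) * (lam n)\<^sup>2) \<le> prob E \<and> (\<forall>\<omega>\<in>E. mdist (l_infty q p) (Y n \<omega>) G < r)"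
      using E by blast
  qed
qed (use level_set_compact Y Yr_in_l_infty lam_sq_at_top lam_sq_pos prob_space_axioms in auto)

text \<open>The upper bound at a level \<open>\<alpha>\<close> so small that every path of energy at
  most \<open>\<alpha>\<close> is within \<open>\<delta> / 2\<close> of zero; the failing event has
  probability at most \<open>exp (- (\<alpha> / 2) * (lam n)\<^sup>2)\<close>.\<close>

lemma quantile_converges:
  assumes Y: "\<And>n \<omega>. n \<ge> 1 \<Longrightarrow> Y n \<omega> = Yr n \<omega>"
  shows "converges_in_outer_prob (\<lambda>_. M) Y (l_infty q p) (\<lambda>u\<in>{q..p}. 0)"
proof -
  have "(\<lambda>x. 0) \<in> energy_ball 0" by (simp add: energy_ball_def L2_def mean_def)
  then have z: "(\<lambda>u\<in>{q..p}. 0) = path (\<lambda>x. 0)" by (simp add: path_def pairing_def)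
  have zm: "(\<lambda>u\<in>{q..p}. 0) \<in> mspace (l_infty q p)" by (rule l_infty_mem[of _ _ _ 0]) auto
  have "(\<lambda>n. outer_measure_of M {\<omega> \<in> space M. \<delta> < mdist (l_infty q p) (Y n \<omega>) (\<lambda>u\<in>{q..p}. 0)}) \<longlonglongrightarrow> 0" if \<delta>: "0 < \<delta>" for \<delta>
  proof -
    obtain m where m: "0 < m" "\<And>u. u \<in> {q..p} \<Longrightarrow> m \<le> f (tq u)" using path_bound by metis
    define W where "W = (LINT x|\<nu>. (w x)\<^sup>2)"
    have W: "0 \<le> W" by (simp add: W_def)
    \<comment> \<open>Chosen so that \<open>sqrt (2 * \<alpha> * W)\<close>, the bound of
      \<open>energy_ball_pairing_bound\<close>, is at most \<open>m * (\<delta> / 2)\<close>; the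
      denominator has \<open>W + 1\<close> because \<open>W\<close> is only known to be
      nonnegative.\<close>
    define \<alpha> where "\<alpha> = (m * (\<delta> / 2))\<^sup>2 / (2 * (W + 1))"
    have \<alpha>: "0 < \<alpha>" using m \<delta> W by (simp add: \<alpha>_def)
    have small: "sqrt (2 * \<alpha> * W) \<le> m * (\<delta> / 2)"
    proof -
      have "2 * \<alpha> * W \<le> 2 * \<alpha> * (W + 1)" using \<alpha> by (intro mult_left_mono) auto
      also have "\<dots> = (m * (\<delta> / 2))\<^sup>2" using W by (simp add: \<alpha>_def field_simps)
      finally have "sqrt (2 * \<alpha> * W) \<le> sqrt ((m * (\<delta> / 2))\<^sup>2)" by (rule real_sqrt_le_mono)
      then show ?thesis using m \<delta> by simp
    qed
    have \<delta>2: "0 < \<delta> / 2" and \<alpha>2: "0 < \<alpha> / 2" using \<delta> \<alpha> by auto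
    have ev: "\<forall>\<^sub>F n in sequentially. outer_measure_of M {\<omega> \<in> space M. \<delta> < mdist (l_infty q p) (Y n \<omega>) (\<lambda>u\<in>{q..p}. 0)} \<le> ennreal (exp (- (\<alpha> / 2) * (lam n)\<^sup>2))"
      using Yd_upper[OF \<delta>2 less_imp_le[OF \<alpha>] \<alpha>2, unfolded likely_def] eventually_ge_at_top[of 1]
    proof (eventually_elim, elim bexE conjE)
      fix n E assume n: "1 \<le> n" and E: "E \<in> events" "prob E \<le> exp (- (\<alpha> - \<alpha> / 2) * (lam n)\<^sup>2)"
        "\<forall>\<omega>\<in>space M - E. \<exists>h\<in>energy_ball \<alpha>. \<forall>u\<in>{q..p}. \<bar>Yd n \<omega> u - pairing h (tq u) / f (tq u)\<bar> \<le> \<delta> / 2"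
      have "mdist (l_infty q p) (Y n \<omega>) (\<lambda>u\<in>{q..p}. 0) \<le> \<delta>" if om: "\<omega> \<in> space M - E" for \<omega>
        unfolding Y[OF n]
      proof (rule l_infty_dist_le[OF Yr_in_l_infty[OF n] zm less_imp_le[OF qp]])
        fix u assume u: "u \<in> {q..p}"
        obtain h where h: "h \<in> energy_ball \<alpha>" "\<forall>u\<in>{q..p}. \<bar>Yd n \<omega> u - pairing h (tq u) / f (tq u)\<bar> \<le> \<delta> / 2" using bspec[OF E(3) om] by blast
        have "\<bar>pairing h (tq u) / f (tq u)\<bar> = \<bar>pairing h (tq u)\<bar> / f (tq u)" using m(1) m(2)[OF u] by (simp add: abs_divide)
        also have "\<dots> \<le> (m * (\<delta> / 2)) / m"
          using order_trans[OF energy_ball_pairing_bound[OF h(1)] small[unfolded W_def]] m(1) m(2)[OF u] \<delta> by (intro frac_le) auto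
        finally have "\<bar>pairing h (tq u) / f (tq u)\<bar> \<le> \<delta> / 2" using m(1) by simp
        moreover have "\<bar>Yd n \<omega> u - pairing h (tq u) / f (tq u)\<bar> \<le> \<delta> / 2" using h(2) u by blast
        ultimately have "\<bar>Yd n \<omega> u\<bar> \<le> \<delta>" by linarith
        then show "\<bar>Yr n \<omega> u - (\<lambda>u\<in>{q..p}. 0) u\<bar> \<le> \<delta>" using u by (simp add: Yr_def)
      qed
      then have "{\<omega> \<in> space M. \<delta> < mdist (l_infty q p) (Y n \<omega>) (\<lambda>u\<in>{q..p}. 0)} \<subseteq> E" by (force simp: not_less[symmetric])
      then have "outer_measure_of M {\<omega> \<in> space M. \<delta> < mdist (l_infty q p) (Y n \<omega>) (\<lambda>u\<in>{q..p}. 0)} \<le> emeasure M E"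
        unfolding outer_measure_of_def using E(1) by (intro INF_lower) auto
      also have "\<dots> \<le> ennreal (exp (- (\<alpha> / 2) * (lam n)\<^sup>2))"
        using E(2) by (simp add: emeasure_eq_measure ennreal_leI)
      finally show "outer_measure_of M {\<omega> \<in> space M. \<delta> < mdist (l_infty q p) (Y n \<omega>) (\<lambda>u\<in>{q..p}. 0)} \<le> ennreal (exp (- (\<alpha> / 2) * (lam n)\<^sup>2))" .
    qed
    have "filterlim (\<lambda>n. (\<alpha> / 2) * (lam n)\<^sup>2) at_top sequentially"
      using \<alpha>2 by (intro filterlim_tendsto_pos_mult_at_top[OF tendsto_const _ lam_sq_at_top])
    then have "filterlim (\<lambda>n. - (\<alpha> / 2) * (lam n)\<^sup>2) at_bot sequentially"
      by (simp add: filterlim_uminus_at_top)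
    then have "(\<lambda>n. exp (- (\<alpha> / 2) * (lam n)\<^sup>2)) \<longlonglongrightarrow> 0"
      by (rule filterlim_compose[OF exp_at_bot])
    then have "(\<lambda>n. ennreal (exp (- (\<alpha> / 2) * (lam n)\<^sup>2))) \<longlonglongrightarrow> ennreal 0" by (rule tendsto_ennrealI)
    then have lim0: "(\<lambda>n. ennreal (exp (- (\<alpha> / 2) * (lam n)\<^sup>2))) \<longlonglongrightarrow> 0" by simp
    show ?thesis by (rule tendsto_sandwich[OF _ ev tendsto_const lim0]) simp
  qed
  then show ?thesis using zm Y Yr_in_l_infty by (simp add: converges_in_outer_prob_def)
qed

end

theorem theorem4p2:
  fixes \<mu> \<nu> :: "real measure" and w f :: "real \<Rightarrow> real"
    and M :: "'a measure" and X :: "nat \<Rightarrow> 'a \<Rightarrow> real"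
    and lam b :: "nat \<Rightarrow> real" and A \<delta> p q \<epsilon> :: real
  assumes "real_distribution \<mu>" and "real_distribution \<nu>"
    and "absolutely_continuous \<nu> \<mu>"
    and "w \<in> borel_measurable borel" and "\<And>x. 0 \<le> w x"
    and "AE x in \<nu>. ennreal (w x) = RN_deriv \<nu> \<mu> x"
    and "prob_space M"
    and "prob_space.indep_vars M (\<lambda>_. borel) X {1..}"
    and "\<And>i. i \<ge> 1 \<Longrightarrow> distr M borel (X i) = \<nu>"
    and "\<And>n. n \<ge> 1 \<Longrightarrow> 0 < lam n" and "mono_on {1..} lam"
    and "filterlim lam at_top sequentially"
    and "lam \<in> o(\<lambda>n. sqrt (real n))"
    and "1 \<le> A" and "0 < \<delta>" and "\<delta> < 1"
    and "\<And>n k. n \<ge> 1 \<Longrightarrow> k \<ge> 1 \<Longrightarrow> lam (n * k) \<le> A * real k powr (- (\<delta> - 1/2)) * lam n"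
    and "\<And>n. n \<ge> 1 \<Longrightarrow> b n = sqrt (real n) / lam n"
    and "0 < q" and "q < p" and "p < 1" and "0 < \<epsilon>"
    and "continuous_on {ginv (tail \<mu>) p - \<epsilon> .. ginv (tail \<mu>) q + \<epsilon>} f"
    and "\<And>t. t \<in> {ginv (tail \<mu>) p - \<epsilon> .. ginv (tail \<mu>) q + \<epsilon>} \<Longrightarrow> 0 < f t"
    and "\<And>s t. ginv (tail \<mu>) p - \<epsilon> \<le> s \<Longrightarrow> s \<le> t \<Longrightarrow> t \<le> ginv (tail \<mu>) q + \<epsilon> \<Longrightarrow>
           cdf \<mu> t - cdf \<mu> s = (LBINT x:{s..t}. f x)"
    and "\<And>\<alpha>. 0 < \<alpha> \<Longrightarrow> integrable \<nu> (\<lambda>x. exp (\<alpha> * w x))"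
  shows "satisfies_LDP (\<lambda>_. M) (quantile_dev \<mu> w X b q p) (l_infty q p) (\<lambda>n. (lam n)\<^sup>2)
           (quantile_rate \<mu> \<nu> w f q p)
       \<and> converges_in_outer_prob (\<lambda>_. M) (quantile_dev \<mu> w X b q p) (l_infty q p) (\<lambda>u\<in>{q..p}. 0)"
proof -
  interpret mu: real_distribution \<mu> by fact
  interpret W: weighted_sample M \<nu> w X lam
    by (intro weighted_sample.intro weighted_sample_axioms.intro; fact)
  have dens: "density \<nu> (\<lambda>x. ennreal (w x)) = \<mu>"
  proof -
    have "density \<nu> (\<lambda>x. ennreal (w x)) = density \<nu> (RN_deriv \<nu> \<mu>)"
      using assms(4,6) by (intro density_cong) auto
    also have "\<dots> = \<mu>" using assms(3) by (intro W.nu.density_RN_deriv) auto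
    finally show ?thesis .
  qed
  have tail: "tail \<mu> t = W.Tw t" for t
  proof -
    have "emeasure \<mu> {t<..} = (\<integral>\<^sup>+x. ennreal (w x * indicator {t<..} x) \<partial>\<nu>)"
      unfolding dens[symmetric] using assms(4) by (subst emeasure_density) (auto intro!: nn_integral_cong split: split_indicator)
    also have "\<dots> = ennreal (W.Tw t)"
      unfolding W.Tw_def W.mean_def using assms(5)
      by (intro nn_integral_eq_integral W.lin_growth_integrable W.lin_growth_w) auto
    finally have "measure \<mu> {t<..} = W.Tw t"
      using assms(5) by (simp add: measure_def W.Tw_def W.mean_def integral_nonneg_AE)
    moreover have "measure \<mu> (space \<mu> - {..t}) = 1 - measure \<mu> {..t}" by (rule mu.prob_compl) simp
    moreover have "space \<mu> - {..t} = {t<..}" by auto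
    ultimately show ?thesis by (simp add: tail_def cdf_def)
  qed
  interpret Q: quantile_sample M \<nu> w X lam \<mu> f q p \<epsilon>
    by (intro quantile_sample.intro quantile_sample_axioms.intro W.weighted_sample_axioms tail; fact)
  \<comment> \<open>The identity of \<open>b n\<close> with \<open>scale n\<close> is given from
    \<open>n = 1\<close> on.\<close>
  have "quantile_dev \<mu> w X b q p n \<omega> = Q.Yr n \<omega>" if "n \<ge> 1" for n \<omega>
    using that assms(18)[OF that] emp_tail_eq_sum[of w X n \<omega>, OF assms(5)]
    by (simp add: quantile_dev_def Q.Yr_def Q.Yd_def Q.tq_def W.scale_def W.Tn_def[abs_def] fun_eq_iff ginv_def)
  then show ?thesis using Q.quantile_LDP[of "quantile_dev \<mu> w X b q p"] Q.quantile_converges[of "quantile_dev \<mu> w X b q p"] by blast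
qed

end
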